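(* Let $\mathbf p=(p_k)_{k\ge0}$ be a probability mass function on $\{0,1,2,\dots\}$ and $Z\sim\mathbf p$. Assume $\mathbb E[Z]<\infty$, $p_0\in(0,1)$, $p_0+p_1<1$ and $\gcd\{j:p_j>0\}=1$. Let $f,R,s_0,q_*$ and the limiting PageRank variable $\mathcal R_{\emptyset,c}(\infty)$ be as in the context. (a) If $\mathbb E[Z]>1$, then for every $c\in(0,1)$, $$-R\le\liminf_{r\to\infty}\frac{\log\mathbb P(\mathcal R_{\emptyset,c}(\infty)\ge r)}{\log r}\le\limsup_{r\to\infty}\frac{\log\mathbb P(\mathcal R_{\emptyset,c}(\infty)\ge r)}{\log r}\le-\Big(R\wedge\frac{\log q_*}{\log s_0}\Big).$$ (b) If $\mathbb E[Z]\le1$, then $$\lim_{r\to\infty}\frac{\log\mathbb P(\mathcal R_{\emptyset,c}(\infty)\ge r)}{\log r}=\begin{cases}-R&\text{for }c\in(0,s_0^{-1}]\text{ with }c<1,\\[2pt]-\dfrac1{cf(1/c)}&\text{for }c\in(s_0^{-1},1),\text{ provided }s_0>1.\end{cases}$$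
   Context: Constants. $f(s)=\sum_{k\ge0}p_ks^k$, $s\ge0$. $s_0$ is the unique positive root of $sf'(s)=f(s)$ if it exists, and otherwise the radius of convergence of $f$. $R:=\lim_{s\uparrow s_0}s/f(s)$. $q_*$ is the smallest positive solution of $f(q)=q$ (the extinction probability of a Galton–Watson process with offspring law $\mathbf p$); $q_*<1$ when $\mathbb E[Z]>1$. Limiting PageRank variable. $\mathcal T^*(t)$, $t\ge0$, is the continuous time tree process starting at time $0$ from a single root vertex $\emptyset$, in which every existing vertex $v$ reproduces independently at rate one; when $v$ reproduces, an independent $Z\sim\mathbf p$ is sampled; if $Z\le\mathrm{dist}(\emptyset,v)$ then a new vertex is attached as a child to the vertex $u$ on the path from $v$ to the root with $\mathrm{dist}(v,u)=Z$; if $Z>\mathrm{dist}(\emptyset,v)$ nothing happens. Let $\tau\sim\mathrm{Exp}(1)$ be independent of $\mathcal T^*$, and let $P_l(\emptyset)$ be the number of directed paths of length $l$ ending at the root in $\mathcal T^*(\tau)$ (edges directed from child to parent), i.e. the number of vertices at distance $l$ from the root. For $c\in(0,1)$, $\mathcal R_{\emptyset,c}(\infty)=(1-c)\big(1+\sum_{l=1}^\infty c^lP_l(\emptyset)\big)$. *)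

theory Defs
  imports "HOL-Probability.Probability"
begin

section \<open>Constants attached to the offspring law\<close>

definition pgf :: "nat pmf \<Rightarrow> real \<Rightarrow> real" where
  "pgf p s = (\<Sum>k. pmf p k * s ^ k)"

text \<open>
  Roots of \<open>s f'(s) = f(s)\<close> are looked for inside the disc of convergence only, since \<^const>\<open>suminf\<close>
  is meaningless outside it.  A root sitting exactly at a finite radius of convergence gives the same
  value through the second branch.  If some \<open>p\<^sub>k\<close> with \<open>k \<ge> 2\<close> is positive and the radius is
  infinite, then a root exists, so the second branch only ever returns a finite radius.
\<close>

definition s0 :: "nat pmf \<Rightarrow> real" where
  "s0 p =
     (if \<exists>s>0. ereal s < conv_radius (pmf p) \<and> s * deriv (pgf p) s = pgf p s
      then THE s. 0 < s \<and> ereal s < conv_radius (pmf p) \<and> s * deriv (pgf p) s = pgf p s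
      else real_of_ereal (conv_radius (pmf p)))"

definition R_const :: "nat pmf \<Rightarrow> real" where
  "R_const p = Lim (at_left (s0 p)) (\<lambda>s. s / pgf p s)"

text \<open>
  As \<open>q = 1\<close> always is a solution, values of \<^const>\<open>pgf\<close> beyond the radius of convergence
  cannot affect the least one.
\<close>

definition q_star :: "nat pmf \<Rightarrow> real" where
  "q_star p = (LEAST q. 0 < q \<and> pgf p q = q)"


section \<open>The tree process\<close>

text \<open>
  A vertex is named by its reproduction history: \<^term>\<open>[]\<close> is the root and \<^term>\<open>k # v\<close> is
  the vertex created at the \<open>k\<close>-th reproduction of \<open>v\<close> (\<open>k = 0, 1, \<dots>\<close>).  Its parent in the
  tree need not be the reproducing vertex \<open>v\<close>, but is the vertex \<open>u\<close> on the path from \<open>v\<close> to the root at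
  distance \<open>Z\<close> from \<open>v\<close>.

  An environment \<open>\<xi>\<close> provides, for each \<open>v\<close> and \<open>k\<close>, the pair \<open>\<xi> (v, k)\<close> of the time between the
  reproductions \<open>k - 1\<close> and \<open>k\<close> of \<open>v\<close> (between its birth and its first reproduction, if \<open>k = 0\<close>)
  and the value of \<open>Z\<close> sampled at reproduction \<open>k\<close>.
\<close>

type_synonym vertex = "nat list"
type_synonym environment = "vertex \<times> nat \<Rightarrow> real \<times> nat"

abbreviation waiting :: "environment \<Rightarrow> vertex \<Rightarrow> nat \<Rightarrow> real" where
  "waiting \<xi> v k \<equiv> fst (\<xi> (v, k))"

abbreviation jump :: "environment \<Rightarrow> vertex \<Rightarrow> nat \<Rightarrow> nat" where
  "jump \<xi> v k \<equiv> snd (\<xi> (v, k))"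

text \<open>
  The tree path from a vertex up to the root, both included: entry \<open>i\<close> is the ancestor at
  distance \<open>i\<close>.  Its value is relevant for vertices satisfying \<open>exists_vertex\<close> below only.
\<close>

primrec root_path :: "environment \<Rightarrow> vertex \<Rightarrow> vertex list" where
  "root_path \<xi> [] = [[]]"
| "root_path \<xi> (k # v) = (k # v) # drop (jump \<xi> v k) (root_path \<xi> v)"

definition root_dist :: "environment \<Rightarrow> vertex \<Rightarrow> nat" where
  "root_dist \<xi> v = length (root_path \<xi> v) - 1"

primrec exists_vertex :: "environment \<Rightarrow> vertex \<Rightarrow> bool" where
  "exists_vertex \<xi> [] \<longleftrightarrow> True"
| "exists_vertex \<xi> (k # v) \<longleftrightarrow> exists_vertex \<xi> v \<and> jump \<xi> v k \<le> root_dist \<xi> v"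

primrec birth_time :: "environment \<Rightarrow> vertex \<Rightarrow> real" where
  "birth_time \<xi> [] = 0"
| "birth_time \<xi> (k # v) = birth_time \<xi> v + (\<Sum>i\<le>k. waiting \<xi> v i)"

definition tree_verts :: "environment \<Rightarrow> real \<Rightarrow> vertex set" where
  "tree_verts \<xi> t = {v. exists_vertex \<xi> v \<and> birth_time \<xi> v \<le> t}"

definition tree_edges :: "environment \<Rightarrow> real \<Rightarrow> (vertex \<times> vertex) set" where
  "tree_edges \<xi> t =
     {(k # v, u) | k v u. k # v \<in> tree_verts \<xi> t \<and> u = root_path \<xi> v ! jump \<xi> v k}"

definition directed_paths_to_root :: "environment \<Rightarrow> real \<Rightarrow> nat \<Rightarrow> vertex list set" where
  "directed_paths_to_root \<xi> t l =
     {xs. length xs = Suc l \<and> last xs = [] \<and> set xs \<subseteq> tree_verts \<xi> t \<and>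
          successively (\<lambda>x y. (x, y) \<in> tree_edges \<xi> t) xs}"

text \<open>
  Counts are taken in \<^typ>\<open>ennreal\<close>, so that no convention is needed on the null event that the
  tree is infinite.
\<close>

definition num_paths :: "environment \<Rightarrow> real \<Rightarrow> nat \<Rightarrow> ennreal" where
  "num_paths \<xi> t l = emeasure (count_space UNIV) (directed_paths_to_root \<xi> t l)"


section \<open>The limiting PageRank variable\<close>

abbreviation exp1 :: "real measure" where
  "exp1 \<equiv> density lborel (exponential_density 1)"

text \<open>
  The canonical probability space: independent waiting times and jumps for all vertices and
  reproductions, and an independent time \<open>\<tau>\<close>.  Exponential waiting times make every vertex
  reproduce at the times of a rate one Poisson process started at its birth.
\<close>

definition pagerank_space :: "nat pmf \<Rightarrow> (environment \<times> real) measure" where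
  "pagerank_space p =
     (\<Pi>\<^sub>M vk \<in> (UNIV :: (vertex \<times> nat) set). exp1 \<Otimes>\<^sub>M measure_pmf p) \<Otimes>\<^sub>M exp1"

definition pagerank :: "real \<Rightarrow> environment \<times> real \<Rightarrow> ennreal" where
  "pagerank c = (\<lambda>(\<xi>, \<tau>).
     ennreal (1 - c) * (1 + (\<Sum>l. ennreal (c ^ Suc l) * num_paths \<xi> \<tau> (Suc l))))"

definition pagerank_tail :: "nat pmf \<Rightarrow> real \<Rightarrow> real \<Rightarrow> real" where
  "pagerank_tail p c r = \<P>(\<omega> in pagerank_space p. ennreal r \<le> pagerank c \<omega>)"

end

theory Submission
  imports Defs "HOL-Real_Asymp.Real_Asymp"
begin

text \<open>
  The depths of the vertices form a branching random walk: a particle at depth \<open>d\<close> gives birth at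
  rate one to a particle at depth \<open>d + 1 - Z\<close>, unless \<open>Z > d\<close>.  Weighting depth \<open>d\<close> by \<open>s\<^sup>-\<^sup>d\<close>,
  the mean grows at rate at most \<open>f s / s\<close>, whose minimum is \<open>1 / R\<close>; a growth rate \<open>\<lambda>\<close> observed at an
  exponential time gives the tail exponent \<open>1 / \<lambda>\<close>.

  Splitting at the first reproduction of the root, the exponential moment \<open>u\<^sub>d(t) = E exp (a X\<^sub>d(t))\<close> of
  the weighted sum \<open>X\<close> started from depth \<open>d\<close> solves \<open>u\<^sub>d' = u\<^sub>d (E u\<^bsub>d+1-Z\<^esub> - 1)\<close>, with \<open>1\<close> in
  place of \<open>u\<^bsub>d+1-Z\<^esub>\<close> for killed particles.  For \<open>a > 0\<close>, \<open>exp (\<eta> e\<^bsup>\<lambda>t\<^esup> s\<^sup>-\<^sup>d)\<close> with \<open>\<lambda>\<close> slightly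
  above \<open>f s / s\<close> is a supersolution below a space-time barrier on which the exponent is of order one.
  The expected number of barrier crossings is of order \<open>r\<^sup>-\<^sup>\<theta>\<close> provided that weights \<open>s\<^bsup>-\<theta>d\<^esup>\<close> grow at rate
  less than one, that is \<open>s\<^sup>\<theta> > q\<^sub>*\<close>; this is where \<open>log q\<^sub>* / log s\<^sub>0\<close> enters.  For \<open>a < 0\<close>,
  \<open>1 - \<eta> e\<^bsup>\<mu>t\<^esup> h d\<close> is a supersolution whenever \<open>h\<close> is a sub-eigenvector of the killed mean operator, and
  it shows that \<open>X\<close> reaches \<open>e\<^bsup>\<mu>t\<^esup>\<close> with probability bounded below.  Such \<open>h\<close> is \<open>c\<^sup>d - s\<^sub>1\<^sup>-\<^sup>d\<close> for
  rates above \<open>1 / R\<close>, and the positive part of an oscillating solution of the eigenvalue equation for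
  rates below \<open>1 / R\<close>.
\<close>

section \<open>The generating function and its constants\<close>

text \<open>The differential equation for \<open>u\<close> is never set up. Splitting at the first
  reproduction turns a bound for n unfoldings into one for n + 1, and a supersolution V only has to
  satisfy V + V' \<ge> \<Phi> for the integrand \<Phi> of that splitting. Truncation after n
  unfoldings lowers the weighted sum, which is harmless for a > 0 but costs an error (2 t)^n / n!
  for a < 0.

  The barrier is forced by exp x \<le> 1 + (1 + e) x, which holds for small x only, whereas s^-d is
  unbounded in d for s < 1: one particle far from the root already makes the exponent large.
  Crossings are therefore counted separately by a first moment, whose weight may have another base
  than s. The barrier is tuned by a level \<rho> slightly smaller than r, so that the exponential
  bound becomes negligible and the crossings decide.

  If the mean is at most one and s_0 = 1, then f y / y \<ge> 1 / R = 1 everywhere, so no weight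
  grows at a rate below one and the first moment of the crossings is not integrable against the
  exponential time. A power of it with exponent a < 1 is integrated instead.\<close>

lemma power_tangent:
  fixes s y :: real
  assumes "0 < s" "0 \<le> y"
  shows "s ^ k * s + real k * s ^ k * (y - s) \<le> y ^ k * s"
proof -
  have "1 + real k * (y / s - 1) \<le> (1 + (y / s - 1)) ^ k"
    using assms by (intro Bernoulli_inequality) auto
  then have "(1 + real k * (y / s - 1)) * (s ^ k * s) \<le> (y / s) ^ k * (s ^ k * s)"
    using assms by (intro mult_right_mono) auto
  moreover have "(1 + real k * (y / s - 1)) * (s ^ k * s) = s ^ k * s + real k * s ^ k * (y - s)"
    "(y / s) ^ k * (s ^ k * s) = y ^ k * s"
    using assms by (auto simp: field_simps power_divide)
  ultimately show ?thesis by simp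
qed

text \<open>For k = n + 1 one factor 1 + x is set aside and Bernoulli's inequality is applied to the
  other n, where x = y / s - 1. The product exceeds 1 + k x by n x^2, which is positive.\<close>

lemma power_tangent_strict:
  fixes s y :: real
  assumes "0 < s" "0 \<le> y" "y \<noteq> s" "2 \<le> k"
  shows "s ^ k * s + real k * s ^ k * (y - s) < y ^ k * s"
proof -
  define x where "x = y / s - 1"
  obtain n where k: "k = Suc n" and n: "1 \<le> n" using assms(4) by (cases k) auto
  have x: "0 \<le> 1 + x" "x \<noteq> 0" using assms by (auto simp: x_def)
  have "1 + real n * x \<le> (1 + x) ^ n"
    using x by (intro Bernoulli_inequality) auto
  then have "(1 + x) * (1 + real n * x) \<le> (1 + x) ^ k"
    unfolding k using x by (simp add: mult_left_mono)
  moreover have "0 < real n * (x * x)"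
    using n x by (auto simp: zero_less_mult_iff neq_iff)
  moreover have "(1 + x) * (1 + real n * x) = 1 + real k * x + real n * (x * x)"
    by (simp add: k algebra_simps)
  ultimately have "1 + real k * x < (1 + x) ^ k" by linarith
  then have "(1 + real k * x) * (s ^ k * s) < (1 + x) ^ k * (s ^ k * s)"
    using assms by (intro mult_strict_right_mono) auto
  moreover have "(1 + real k * x) * (s ^ k * s) = s ^ k * s + real k * s ^ k * (y - s)"
    "(1 + x) ^ k * (s ^ k * s) = y ^ k * s"
    using assms by (auto simp: field_simps power_divide x_def)
  ultimately show ?thesis by simp
qed

locale offspring =
  fixes p :: "nat pmf"
  assumes integrable_p: "integrable (measure_pmf p) real"
    and p0_pos: "0 < pmf p 0"
    and p01: "pmf p 0 + pmf p 1 < 1"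
begin

abbreviation "f \<equiv> pgf p"

abbreviation summ :: "real \<Rightarrow> bool" where
  "summ s \<equiv> summable (\<lambda>k. pmf p k * s ^ k)"

text \<open>This is s f'(s) - f(s), that is s^2 times the derivative of f(s) / s. The series is
  preferred to \<open>deriv\<close> because it still converges at s = 1 when 1 is the radius of
  convergence; its value there is the mean minus one.\<close>

definition tilt :: "real \<Rightarrow> real" where
  "tilt s = (\<Sum>k. (real k - 1) * pmf p k * s ^ k)"

abbreviation summt :: "real \<Rightarrow> bool" where
  "summt s \<equiv> summable (\<lambda>k. (real k - 1) * pmf p k * s ^ k)"

lemma sums_pmf: "pmf p sums 1"
proof -
  have "(\<lambda>k. measure (measure_pmf p) {k}) sums measure (measure_pmf p) (\<Union>k. {k})"
    by (intro measure_pmf.finite_measure_UNION) (auto simp: disjoint_family_on_def)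
  moreover have "(\<Union>k::nat. {k}) = UNIV" by auto
  ultimately show ?thesis by (simp add: measure_pmf_single)
qed

lemma obtain_ge2: obtains m where "2 \<le> m" "0 < pmf p m"
proof (rule ccontr)
  assume *: "\<not> thesis"
  have "pmf p m = 0" if "2 \<le> m" for m
    using that * \<open>\<And>m. 2 \<le> m \<Longrightarrow> 0 < pmf p m \<Longrightarrow> thesis\<close> pmf_nonneg[of p m]
    by (auto simp: less_le)
  then have "pmf p k = 0" if "k \<notin> {0, 1}" for k
    using that by (metis One_nat_def insertCI less_2_cases not_less)
  then have "pmf p sums (\<Sum>k\<in>{0, 1}. pmf p k)"
    by (intro sums_finite) auto
  with sums_pmf have "(\<Sum>k\<in>{0, 1}. pmf p k) = 1"
    using sums_unique2 by blast
  with p01 show False by simp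
qed

lemma sums_mean: "(\<lambda>k. real k * pmf p k) sums measure_pmf.expectation p real"
proof -
  have "integrable (density (count_space UNIV) (\<lambda>x. ennreal (pmf p x))) real"
    using integrable_p by (simp add: measure_pmf_eq_density)
  then have "integrable (count_space UNIV) (\<lambda>k. pmf p k *\<^sub>R real k)"
    by (subst (asm) integrable_density) auto
  then have "(\<lambda>k. pmf p k *\<^sub>R real k) sums integral\<^sup>L (count_space UNIV) (\<lambda>k. pmf p k *\<^sub>R real k)"
    by (rule sums_integral_count_space_nat)
  moreover have "integral\<^sup>L (count_space UNIV) (\<lambda>k. pmf p k *\<^sub>R real k)
      = measure_pmf.expectation p real"
    by (subst measure_pmf_eq_density, subst integral_density) auto
  ultimately show ?thesis by (simp add: mult.commute)
qed

lemma summ_le: "summ t \<Longrightarrow> 0 \<le> s \<Longrightarrow> s \<le> t \<Longrightarrow> summ s"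
  by (rule summable_comparison_test[where g = "\<lambda>k. pmf p k * t ^ k"])
     (auto intro!: exI[of _ 0] mult_left_mono power_mono)

lemma summ_1: "summ 1" using sums_pmf by (auto simp: sums_iff)

lemma f_1: "f 1 = 1" using sums_pmf by (simp add: pgf_def sums_iff)

lemma summ_mean_of_less:
  assumes "summ t" "0 \<le> s" "s < t"
  shows "summable (\<lambda>k. real k * pmf p k * s ^ k)"
proof -
  have "summable (\<lambda>k. diffs (pmf p) k * s ^ k)"
  proof (rule termdiff_converges)
    show "norm s < t" using assms by simp
    show "summ x" if "norm x < t" for x
      by (rule summable_rabs_cancel, rule summable_comparison_test[OF _ assms(1)])
         (use that in \<open>auto intro!: exI[of _ 0] mult_left_mono power_mono simp: abs_mult power_abs\<close>)
  qed
  then have "summable (\<lambda>k. s * (diffs (pmf p) k * s ^ k))"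
    by (rule summable_mult)
  then have "summable (\<lambda>k. real (Suc k) * pmf p (Suc k) * s ^ Suc k)"
    by (simp add: diffs_def mult_ac)
  then show ?thesis
    by (subst (asm) summable_Suc_iff)
qed

lemma tilt_eq:
  assumes "summ s" "summable (\<lambda>k. real k * pmf p k * s ^ k)"
  shows "(\<lambda>k. (real k - 1) * pmf p k * s ^ k) sums ((\<Sum>k. real k * pmf p k * s ^ k) - f s)"
  using sums_diff[OF summable_sums[OF assms(2)] summable_sums[OF assms(1)]]
  by (simp add: pgf_def left_diff_distrib)

lemma summt_of_less: "summ t \<Longrightarrow> 0 \<le> s \<Longrightarrow> s < t \<Longrightarrow> summt s"
  using tilt_eq[of s] summ_mean_of_less[of t s] summ_le[of t s] sums_summable by force

lemma tilt_sums_1: "(\<lambda>k. (real k - 1) * pmf p k * 1 ^ k) sums (measure_pmf.expectation p real - 1)"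
  using tilt_eq[of 1] sums_mean summ_1 by (simp add: f_1 sums_iff)

lemma pgf_pos: "summ s \<Longrightarrow> 0 \<le> s \<Longrightarrow> 0 < f s"
  unfolding pgf_def using p0_pos by (intro suminf_pos2[where i = 0]) auto

lemma pgf_ge_p0: "summ s \<Longrightarrow> 0 \<le> s \<Longrightarrow> pmf p 0 \<le> f s"
  unfolding pgf_def using sum_le_suminf[of "\<lambda>k. pmf p k * s ^ k" "{0}"] by simp

text \<open>Convexity of f: the tangent inequality at s multiplied by s, with s f'(s) written as
  tilt s + f s. In this form the sign of tilt s * (y - s) decides how f y / y compares with f s / s.
  Strictness comes from a positive p_k with k \<ge> 2.\<close>

lemma pgf_tangent:
  assumes "summ s" "summt s" "summ y" "0 < s" "0 \<le> y"
  shows "f s * y + tilt s * (y - s) \<le> f y * s"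
    and "y \<noteq> s \<Longrightarrow> f s * y + tilt s * (y - s) < f y * s"
proof -
  let ?a = "\<lambda>k. pmf p k * s ^ k * y + (real k - 1) * pmf p k * s ^ k * (y - s)"
  let ?b = "\<lambda>k. pmf p k * y ^ k * s"
  have a: "?a sums (f s * y + tilt s * (y - s))"
    unfolding pgf_def tilt_def using assms by (intro sums_add sums_mult2 summable_sums)
  have b: "?b sums (f y * s)"
    unfolding pgf_def using assms by (intro sums_mult2 summable_sums)
  have eq: "?a k = pmf p k * (s ^ k * s + real k * s ^ k * (y - s))" for k
    by (simp add: algebra_simps)
  have le: "?a k \<le> ?b k" for k
    unfolding eq using power_tangent[OF assms(4,5), of k]
    by (simp add: mult_left_mono mult.assoc)
  then show "f s * y + tilt s * (y - s) \<le> f y * s"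
    using a b by (rule sums_le)
  assume "y \<noteq> s"
  obtain m where m: "2 \<le> m" "0 < pmf p m" by (rule obtain_ge2)
  have "?a m < ?b m"
    unfolding eq using power_tangent_strict[OF assms(4,5) \<open>y \<noteq> s\<close> m(1)] m(2)
    by (simp add: mult.assoc)
  then have "0 < (\<Sum>k. ?b k - ?a k)"
    using a b le by (intro suminf_pos2[where i = m] summable_diff sums_summable) auto
  moreover have "(\<Sum>k. ?b k - ?a k) = f y * s - (f s * y + tilt s * (y - s))"
    using sums_diff[OF b a] by (simp add: sums_iff)
  ultimately show "f s * y + tilt s * (y - s) < f y * s" by simp
qed

text \<open>Only the coefficient of s^0 is negative, and its term is constant; some coefficient with
  k \<ge> 2 is positive.\<close>

lemma tilt_strict_mono:
  assumes "summt s" "summt t" "0 \<le> s" "s < t"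
  shows "tilt s < tilt t"
proof -
  let ?d = "\<lambda>k. (real k - 1) * pmf p k * t ^ k - (real k - 1) * pmf p k * s ^ k"
  obtain m where m: "2 \<le> m" "0 < pmf p m" by (rule obtain_ge2)
  have d: "?d k = (real k - 1) * pmf p k * (t ^ k - s ^ k)" for k
    by (simp add: algebra_simps)
  have "0 \<le> ?d k" for k
  proof (cases "k = 0")
    case False
    then show ?thesis unfolding d using assms
      by (intro mult_nonneg_nonneg) (auto intro!: power_mono)
  qed simp
  moreover have "0 < ?d m"
    unfolding d using m assms
    by (intro mult_pos_pos) (auto intro!: power_strict_mono)
  ultimately have "0 < (\<Sum>k. ?d k)"
    using assms by (intro suminf_pos2[where i = m] summable_diff) auto
  also have "\<dots> = tilt t - tilt s"
    unfolding tilt_def using assms by (intro suminf_diff[symmetric])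
  finally show ?thesis by simp
qed

lemma tilt_isCont:
  assumes "summt t" "0 \<le> s" "s < t"
  shows "isCont tilt s"
  unfolding tilt_def[abs_def] by (rule isCont_powser[of _ t]) (use assms in auto)

lemma pgf_isCont:
  assumes "summ t" "0 \<le> s" "s < t"
  shows "isCont f s"
  unfolding pgf_def[abs_def] by (rule isCont_powser[of _ t]) (use assms in auto)

lemma pgf_deriv:
  assumes "summ t" "0 < s" "s < t"
  shows "s * deriv f s - f s = tilt s"
proof -
  have "(f has_field_derivative (\<Sum>k. diffs (pmf p) k * s ^ k)) (at s)"
    unfolding pgf_def[abs_def] by (rule termdiffs_strong[of _ t]) (use assms in auto)
  then have d: "deriv f s = (\<Sum>k. diffs (pmf p) k * s ^ k)"
    by (rule DERIV_imp_deriv)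
  have sm: "summable (\<lambda>k. real k * pmf p k * s ^ k)"
    using summ_mean_of_less assms by simp
  then have "summable (\<lambda>k. real (Suc k) * pmf p (Suc k) * s ^ Suc k)"
    by (subst summable_Suc_iff)
  then have "summable (\<lambda>k. s * (diffs (pmf p) k * s ^ k))"
    by (simp add: diffs_def mult_ac)
  then have sd: "summable (\<lambda>k. diffs (pmf p) k * s ^ k)"
    using assms(2) by (subst (asm) summable_cmult_iff) auto
  have "s * deriv f s = (\<Sum>k. real (Suc k) * pmf p (Suc k) * s ^ Suc k)"
    unfolding d using suminf_mult[OF sd, of s] by (simp add: diffs_def mult_ac)
  also have "\<dots> = (\<Sum>k. real k * pmf p k * s ^ k)"
    using suminf_split_head[OF sm] by simp
  finally show ?thesis
    using tilt_eq[OF summ_le[OF assms(1)] sm] assms by (simp add: sums_iff tilt_def)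
qed

section \<open>The constants s_0 and R\<close>

lemma radius_ge_1: "1 \<le> conv_radius (pmf p)"
  using conv_radius_geI[of "pmf p" 1] summ_1 by (simp add: one_ereal_def)

lemma summ_inside: "0 \<le> s \<Longrightarrow> ereal s < conv_radius (pmf p) \<Longrightarrow> summ s"
  by (rule summable_in_conv_radius) simp

lemma tilt_0: "tilt 0 = - pmf p 0"
proof -
  have "(\<lambda>k. (real k - 1) * pmf p k * 0 ^ k) sums (\<Sum>k\<in>{0}. (real k - 1) * pmf p k * 0 ^ k)"
    by (rule sums_finite) auto
  then show ?thesis by (simp add: tilt_def sums_iff)
qed

lemma summ_inside_dense:
  assumes "0 \<le> s" "ereal s < conv_radius (pmf p)"
  obtains t where "s < t" "summ t"
proof -
  obtain t where "ereal s < ereal t" "ereal t < conv_radius (pmf p)"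
    using ereal_dense2[OF assms(2)] by blast
  with assms(1) show ?thesis by (intro that[of t] summ_inside) auto
qed

lemma summt_inside:
  assumes "0 \<le> s" "ereal s < conv_radius (pmf p)"
  shows "summt s"
proof -
  obtain t where "s < t" "summ t" using summ_inside_dense assms .
  with assms show ?thesis by (intro summt_of_less[of t])
qed

lemma root_iff:
  assumes "0 < s" "ereal s < conv_radius (pmf p)"
  shows "s * deriv f s = f s \<longleftrightarrow> tilt s = 0"
proof -
  obtain t where "s < t" "summ t" using summ_inside_dense[OF less_imp_le] assms .
  with assms pgf_deriv[of t s] show ?thesis by auto
qed

lemma tilt_ge:
  assumes "summt s" "0 \<le> s" "finite I" "0 \<in> I"
  shows "(\<Sum>k\<in>I. (real k - 1) * pmf p k * s ^ k) \<le> tilt s"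
  unfolding tilt_def
proof (rule sum_le_suminf[OF assms(1,3)])
  fix k assume "k \<in> - I"
  with assms(4) have "1 \<le> k" by (cases k) auto
  with assms(2) show "0 \<le> (real k - 1) * pmf p k * s ^ k" by simp
qed

lemma tilt_root:
  assumes "0 < s" "ereal s < conv_radius (pmf p)" "0 \<le> tilt s"
  obtains u where "0 < u" "u \<le> s" "tilt u = 0"
proof -
  obtain t where t: "s < t" "summ t" using summ_inside_dense[OF less_imp_le] assms(1,2) .
  have "\<exists>u. 0 \<le> u \<and> u \<le> s \<and> tilt u = 0"
  proof (rule IVT)
    show "tilt 0 \<le> 0" using p0_pos by (simp add: tilt_0)
    show "\<forall>x. 0 \<le> x \<and> x \<le> s \<longrightarrow> isCont tilt x"
    proof safe
      fix x assume x: "0 \<le> x" "x \<le> s"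
      obtain y where "s < y" "y < t" using dense t(1) by blast
      with x t assms show "isCont tilt x"
        by (intro tilt_isCont[of y] summt_of_less[of t]) auto
    qed
  qed (use assms in auto)
  then obtain u where u: "0 \<le> u" "u \<le> s" "tilt u = 0" by blast
  moreover from u p0_pos have "u \<noteq> 0" by (auto simp: tilt_0)
  ultimately show ?thesis by (intro that[of u]) auto
qed

text \<open>A root inside the disc is unique because \<open>tilt\<close> is strictly increasing
  there. Without a root \<open>tilt\<close> stays negative, being negative at 0 and continuous; this
  excludes an infinite radius, for which \<open>tilt\<close> would become positive. All later facts
  about s_0 rest on this dichotomy.\<close>

lemma s0_cases:
  obtains (root) "0 < s0 p" "ereal (s0 p) < conv_radius (pmf p)" "tilt (s0 p) = 0"
  | (radius) "conv_radius (pmf p) = ereal (s0 p)"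
      "\<And>s. 0 < s \<Longrightarrow> s < s0 p \<Longrightarrow> tilt s < 0"
proof (cases "\<exists>s>0. ereal s < conv_radius (pmf p) \<and> s * deriv (pgf p) s = pgf p s")
  case True
  let ?P = "\<lambda>s. 0 < s \<and> ereal s < conv_radius (pmf p) \<and> s * deriv (pgf p) s = pgf p s"
  have uniq: "s = t" if "?P s" "?P t" for s t
  proof (rule ccontr)
    assume "s \<noteq> t"
    moreover have "tilt s = 0" "tilt t = 0" using that root_iff by auto
    ultimately show False
      using tilt_strict_mono[of s t] tilt_strict_mono[of t s] summt_inside[of s] summt_inside[of t] that
      by (cases s t rule: linorder_cases) auto
  qed
  from True have "\<exists>!s. ?P s" using uniq by blast
  then have "?P (s0 p)" unfolding s0_def if_P[OF True] by (rule theI')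
  with root show thesis using root_iff by blast
next
  case False
  have neg: "tilt s < 0" if s: "0 < s" "ereal s < conv_radius (pmf p)" for s
  proof (rule ccontr)
    assume "\<not> tilt s < 0"
    then obtain u where "0 < u" "u \<le> s" "tilt u = 0"
      using tilt_root[OF s] by auto
    moreover from this s have "ereal u < conv_radius (pmf p)"
      by (meson ereal_less_eq(3) le_less_trans)
    ultimately show False using False root_iff by auto
  qed
  have "conv_radius (pmf p) \<noteq> \<infinity>"
  proof
    assume inf: "conv_radius (pmf p) = \<infinity>"
    obtain m where m: "2 \<le> m" "0 < pmf p m" by (rule obtain_ge2)
    \<comment> \<open>Chosen so that p_m t > p_0: the term of index m alone then outweighs the
      negative term - p_0 of \<open>tilt t\<close>.\<close>
    define t where "t = 1 + pmf p 0 / pmf p m"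
    have t: "1 \<le> t" using m by (simp add: t_def)
    have "(\<Sum>k\<in>{0, m}. (real k - 1) * pmf p k * t ^ k) \<le> tilt t"
      using t inf by (intro tilt_ge summt_inside) auto
    moreover have "pmf p 0 < (real m - 1) * pmf p m * t ^ m"
    proof -
      have "pmf p 0 < pmf p m * t" using m by (simp add: t_def field_simps)
      also have "\<dots> \<le> pmf p m * t ^ m"
        using m t power_increasing[of 1 m t] by (intro mult_left_mono) auto
      also have "\<dots> \<le> (real m - 1) * (pmf p m * t ^ m)"
        using m t mult_right_mono[of 1 "real m - 1" "pmf p m * t ^ m"] by simp
      finally show ?thesis by (simp add: mult.assoc)
    qed
    ultimately have "0 < tilt t" using m by simp
    with neg[of t] t inf show False by simp
  qed
  moreover have "s0 p = real_of_ereal (conv_radius (pmf p))"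
    unfolding s0_def using False by (rule if_not_P)
  ultimately have r: "conv_radius (pmf p) = ereal (s0 p)"
    using radius_ge_1 by (cases "conv_radius (pmf p)") auto
  then show thesis using neg by (intro radius) auto
qed

lemma s0_pos: "0 < s0 p"
  using radius_ge_1 by (cases rule: s0_cases) (auto simp: one_ereal_def)

lemma s0_le_radius: "ereal (s0 p) \<le> conv_radius (pmf p)"
  by (cases rule: s0_cases) auto

lemma below_s0:
  assumes "0 < s" "s < s0 p"
  shows "ereal s < conv_radius (pmf p)" "summ s" "summt s" "tilt s < 0"
proof -
  have "ereal s < ereal (s0 p)" using assms by simp
  then show r: "ereal s < conv_radius (pmf p)" using s0_le_radius by (rule less_le_trans)
  then show "summ s" "summt s" using assms by (auto intro: summ_inside summt_inside)
  show "tilt s < 0"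
  proof (cases rule: s0_cases)
    case root
    with assms r show ?thesis
      using tilt_strict_mono[of s "s0 p"] by (simp add: summt_inside)
  qed (use assms in auto)
qed

lemma ratio_mono:
  assumes "0 < s" "s \<le> t" "t < s0 p"
  shows "s / f s \<le> t / f t"
proof -
  note s = below_s0[of s] and t = below_s0[of t]
  have "f t * s + tilt t * (s - t) \<le> f s * t"
    using assms s t by (intro pgf_tangent) auto
  moreover have "0 \<le> tilt t * (s - t)" using t assms by (intro mult_nonpos_nonpos) auto
  ultimately have "s * f t \<le> t * f s" by (simp add: mult.commute)
  moreover have "0 < f s" "0 < f t" using s t assms by (auto intro!: pgf_pos)
  ultimately show ?thesis by (simp add: field_simps)
qed

lemma ratio_bdd: "bdd_above ((\<lambda>s. s / f s) ` {0<..<s0 p})"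
proof (rule bdd_aboveI2)
  fix s assume s: "s \<in> {0<..<s0 p}"
  then have "pmf p 0 \<le> f s" by (intro pgf_ge_p0 below_s0) auto
  then show "s / f s \<le> s0 p / pmf p 0"
    using s p0_pos by (intro frac_le) auto
qed

text \<open>The ratio is monotone on (0, s_0) and bounded because f \<ge> p_0, so its left limit is
  a supremum. This form treats both cases of s_0 at once.\<close>

lemma R_const_eq: "R_const p = (SUP s\<in>{0<..<s0 p}. s / f s)" (is "_ = ?R")
proof -
  have ne: "{0<..<s0 p} \<noteq> {}" using s0_pos by simp
  have "((\<lambda>s. s / f s) \<longlongrightarrow> ?R) (at_left (s0 p))"
  proof (rule order_tendstoI)
    fix a assume "a < ?R"
    then obtain s where s: "s \<in> {0<..<s0 p}" "a < s / f s"
      using less_cSUP_iff[OF ne ratio_bdd] by blast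
    have "eventually (\<lambda>t. t \<in> {s<..<s0 p}) (at_left (s0 p))"
      using s by (intro eventually_at_leftI) auto
    then show "eventually (\<lambda>t. a < t / f t) (at_left (s0 p))"
    proof eventually_elim
      case (elim t)
      with s have "s / f s \<le> t / f t" by (intro ratio_mono) auto
      with s show ?case by simp
    qed
  next
    fix a assume "?R < a"
    have "eventually (\<lambda>t. t \<in> {0<..<s0 p}) (at_left (s0 p))"
      using s0_pos by (intro eventually_at_leftI) auto
    then show "eventually (\<lambda>t. t / f t < a) (at_left (s0 p))"
      by eventually_elim (use cSUP_upper[OF _ ratio_bdd] \<open>?R < a\<close> in force)
  qed
  then show ?thesis unfolding R_const_def
    by (intro tendsto_Lim) (auto simp: trivial_limit_at_left_real)
qed

lemma ratio_le_R: "0 < s \<Longrightarrow> s < s0 p \<Longrightarrow> s / f s \<le> R_const p"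
  unfolding R_const_eq by (rule cSUP_upper[OF _ ratio_bdd]) auto

lemma R_pos: "0 < R_const p"
proof -
  have s: "0 < s0 p / 2" "s0 p / 2 < s0 p" using s0_pos by auto
  then have "0 < (s0 p / 2) / f (s0 p / 2)"
    by (intro divide_pos_pos pgf_pos below_s0) auto
  with ratio_le_R[OF s] show ?thesis by simp
qed

lemma pgf_mono: "summ t \<Longrightarrow> 0 \<le> s \<Longrightarrow> s \<le> t \<Longrightarrow> f s \<le> f t"
  unfolding pgf_def using summ_le[of t s]
  by (intro suminf_le) (auto intro!: mult_left_mono power_mono)

lemma le_R_pgf_s0:
  assumes "summ (s0 p)"
  shows "s0 p \<le> R_const p * f (s0 p)"
proof (rule dense_le_bounded[OF s0_pos])
  fix s assume s: "0 < s" "s < s0 p"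
  then have "s \<le> R_const p * f s"
    using ratio_le_R[OF s] pgf_pos[of s] below_s0[of s] by (simp add: field_simps)
  also have "\<dots> \<le> R_const p * f (s0 p)"
    using s assms R_pos by (intro mult_left_mono pgf_mono) auto
  finally show "s \<le> R_const p * f (s0 p)" .
qed

text \<open>Beyond s_0 the series can converge only if s_0 is an interior root of
  \<open>tilt\<close>, and then the tangent inequality at s_0 loses its second term. Such y matter
  because the accumulation point in \<open>truncated_pgf_ge\<close> may lie on either side of
  s_0.\<close>

lemma le_R_pgf:
  assumes "0 < y" "summ y"
  shows "y \<le> R_const p * f y"
proof (cases y "s0 p" rule: linorder_cases)
  case less
  with assms show ?thesis using ratio_le_R[of y] pgf_pos[of y] by (simp add: field_simps)
next
  case equal
  with assms le_R_pgf_s0 show ?thesis by simp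
next
  case greater
  have "ereal y \<le> conv_radius (pmf p)" using conv_radius_geI[OF assms(2)] assms(1) by simp
  then have "conv_radius (pmf p) \<noteq> ereal (s0 p)" using greater by auto
  then have root: "ereal (s0 p) < conv_radius (pmf p)" "tilt (s0 p) = 0"
    by (cases rule: s0_cases; simp)+
  have sm: "summ (s0 p)" using root s0_pos by (intro summ_inside) auto
  have "f (s0 p) * y \<le> f y * s0 p"
    using pgf_tangent(1)[of "s0 p" y] sm summt_inside root s0_pos assms by simp
  also have "\<dots> \<le> f y * (R_const p * f (s0 p))"
    using le_R_pgf_s0[OF sm] pgf_pos[of y] assms by (intro mult_left_mono) auto
  finally have "f (s0 p) * y \<le> f (s0 p) * (R_const p * f y)" by (simp add: mult_ac)
  then show ?thesis using pgf_pos[OF sm] s0_pos by simp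
qed

lemma ratio_near_R:
  assumes "1 / R_const p < x" "a < s0 p"
  obtains s where "a < s" "0 < s" "s < s0 p" "f s / s < x"
proof -
  have x: "0 < x" using assms(1) R_pos by (smt (verit) divide_pos_pos)
  then have "1 / x < R_const p" using assms(1) R_pos by (simp add: field_simps)
  then obtain u where u: "0 < u" "u < s0 p" "1 / x < u / f u"
    unfolding R_const_eq using less_cSUP_iff[OF _ ratio_bdd] s0_pos by force
  define s where "s = (max a u + s0 p) / 2"
  have s: "a < s" "u < s" "s < s0 p" using assms u by (auto simp: s_def)
  then have "1 / x < s / f s" using ratio_mono[of u s] u by simp
  moreover have "0 < f s" using s u below_s0[of s] by (intro pgf_pos) auto
  ultimately have "f s / s < x" using x s u by (simp add: field_simps)
  with s u show ?thesis by (intro that[of s]) auto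
qed

lemma ratio_decreasing:
  assumes "0 < s" "s < t" "t < s0 p"
  shows "f t / t < f s / s"
proof -
  note s = below_s0[of s] and t = below_s0[of t]
  have "f t * s + tilt t * (s - t) < f s * t"
    using assms s t by (intro pgf_tangent) auto
  moreover have "0 \<le> tilt t * (s - t)" using t assms by (intro mult_nonpos_nonpos) auto
  ultimately show ?thesis using assms by (simp add: field_simps)
qed

section \<open>Position of s_0 relative to 1, and the extinction probability\<close>

lemma summt_1: "summt 1" and tilt_1: "tilt 1 = measure_pmf.expectation p real - 1"
  using tilt_sums_1 by (auto simp: tilt_def sums_iff)

lemma s0_ge_1:
  assumes "measure_pmf.expectation p real \<le> 1"
  shows "1 \<le> s0 p"
proof (cases rule: s0_cases)
  case root
  show ?thesis
  proof (rule ccontr)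
    assume "\<not> 1 \<le> s0 p"
    then have "tilt (s0 p) < tilt 1"
      using root by (intro tilt_strict_mono summt_inside summt_1) auto
    with root assms tilt_1 show False by simp
  qed
next
  case radius
  with radius_ge_1 show ?thesis by (simp add: one_ereal_def)
qed

lemma R_eq_1:
  assumes "measure_pmf.expectation p real \<le> 1" "s0 p = 1"
  shows "R_const p = 1"
proof (rule antisym)
  show "R_const p \<le> 1"
    unfolding R_const_eq
  proof (rule cSUP_least)
    fix s assume s: "s \<in> {0<..<s0 p}"
    have "0 \<le> (measure_pmf.expectation p real - 1) * (s - 1)"
      using assms s by (intro mult_nonpos_nonpos) auto
    with s assms have "s \<le> f s"
      using pgf_tangent(1)[of 1 s] summ_1 summt_1 below_s0[of s] by (simp add: f_1 tilt_1)
    then show "s / f s \<le> 1" using s by (simp add: divide_le_eq)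
  qed (use s0_pos in simp)
  show "1 \<le> R_const p" using le_R_pgf[of 1] summ_1 by (simp add: f_1)
qed

text \<open>It suffices to find s < 1 with tilt s > 0. As the radius may be 1, this is read off a
  partial sum: it is positive at 1 because the sums tend to the mean minus one, it is continuous as
  a polynomial, and the omitted terms are nonnegative.\<close>

lemma supercritical_s0:
  assumes "1 < measure_pmf.expectation p real"
  shows "s0 p < 1" "tilt (s0 p) = 0" "summ (s0 p)" "summt (s0 p)"
proof -
  let ?S = "\<lambda>K s. \<Sum>k<K. (real k - 1) * pmf p k * s ^ k"
  have "(\<lambda>K. ?S K 1) \<longlonglongrightarrow> measure_pmf.expectation p real - 1"
    using tilt_sums_1 by (simp add: sums_def)
  then have e1: "eventually (\<lambda>K. 0 < ?S K 1) sequentially"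
    using assms by (intro order_tendstoD) auto
  obtain K where K: "0 < ?S K 1" "1 \<le> K"
    using eventually_happens'[OF sequentially_bot eventually_conj[OF e1 eventually_ge_at_top[of 1]]]
    by blast
  have "isCont (?S K) 1" by (intro continuous_intros)
  then have "((?S K) \<longlongrightarrow> ?S K 1) (at_left 1)"
    by (simp add: isCont_def filterlim_at_split)
  then have e2: "eventually (\<lambda>s. 0 < ?S K s) (at_left 1)"
    using K by (intro order_tendstoD) auto
  have e3: "eventually (\<lambda>s. s \<in> {0<..<1}) (at_left (1::real))"
    by (intro eventually_at_leftI[of 0]) auto
  have "\<exists>s. 0 < ?S K s \<and> s \<in> {0<..<1}"
    by (rule eventually_happens'[OF trivial_limit_at_left_real eventually_conj[OF e2 e3]])
  then obtain s where s: "0 < ?S K s" "0 < s" "s < 1" by auto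
  have "summt s" using summt_of_less[OF summ_1] s by auto
  then have "0 < tilt s" using tilt_ge[of s "{..<K}"] s K by auto
  then have "\<not> s < s0 p" using below_s0(4)[of s] s by auto
  then show less: "s0 p < 1" using s by simp
  then have "ereal (s0 p) < conv_radius (pmf p)"
    using less_le_trans[OF _ radius_ge_1, of "ereal (s0 p)"] by (simp add: one_ereal_def)
  then show "summ (s0 p)" "summt (s0 p)"
    using s0_pos by (intro summ_inside summt_inside; simp)+
  show "tilt (s0 p) = 0"
    using \<open>ereal (s0 p) < _\<close> by (cases rule: s0_cases) auto
qed

text \<open>\<open>LEAST\<close> over the reals needs an attained minimum. Fixed points in (0, s_0]
  are at least p_0 because f \<ge> p_0, and f s_0 < s_0 by the strict tangent inequality at s_0
  taken at y = 1. Hence fixed points exist in [p_0, s_0], and they form a closed set.\<close>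

lemma supercritical_q_star:
  assumes "1 < measure_pmf.expectation p real"
  shows "0 < q_star p" "q_star p < s0 p" "f (q_star p) = q_star p"
proof -
  note s0 = supercritical_s0[OF assms]
  have s0_less: "f (s0 p) < s0 p"
    using pgf_tangent(2)[of "s0 p" 1] s0 s0_pos summ_1 by (simp add: f_1)
  have p0s0: "pmf p 0 \<le> f (s0 p)" using s0 s0_pos by (intro pgf_ge_p0) auto
  have cont: "isCont f x" if "0 \<le> x" "x \<le> s0 p" for x
    using that s0 by (intro pgf_isCont[OF summ_1]) auto
  define S where "S = {q. pmf p 0 \<le> q \<and> q \<le> s0 p \<and> f q = q}"
  have "\<exists>q. pmf p 0 \<le> q \<and> q \<le> s0 p \<and> f q - q = 0"
  proof (rule IVT2)
    show "0 \<le> f (pmf p 0) - pmf p 0"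
      using pgf_ge_p0[of "pmf p 0"] summ_le[OF summ_1, of "pmf p 0"] by (simp add: pmf_le_1)
  qed (use s0_less p0s0 p0_pos in \<open>auto intro!: continuous_intros cont\<close>)
  then have ne: "S \<noteq> {}" by (auto simp: S_def)
  have "closed S"
  proof -
    have "S = {pmf p 0..s0 p} \<inter> (\<lambda>q. f q - q) -` {0}" by (auto simp: S_def)
    moreover have "continuous_on {pmf p 0..s0 p} (\<lambda>q. f q - q)"
      using p0_pos by (intro continuous_at_imp_continuous_on ballI continuous_intros cont) auto
    ultimately show ?thesis
      by (simp add: continuous_closed_preimage)
  qed
  then have inf: "Inf S \<in> S"
    using ne by (intro closed_contains_Inf) (auto simp: S_def intro!: bdd_belowI[of _ "pmf p 0"])
  have "q_star p = Inf S"
    unfolding q_star_def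
  proof (rule Least_equality)
    show "0 < Inf S \<and> f (Inf S) = Inf S" using inf p0_pos by (auto simp: S_def)
    fix q assume q: "0 < q \<and> f q = q"
    show "Inf S \<le> q"
    proof (cases "q \<le> s0 p")
      case True
      then have "pmf p 0 \<le> f q" using q summ_le[of "s0 p" q] s0 by (intro pgf_ge_p0) auto
      then have "q \<in> S" using q True by (auto simp: S_def)
      then show ?thesis by (intro cInf_lower) (auto simp: S_def intro!: bdd_belowI[of _ "pmf p 0"])
    qed (use inf in \<open>auto simp: S_def\<close>)
  qed
  moreover from inf have "0 < Inf S" "Inf S \<le> s0 p" "f (Inf S) = Inf S"
    using p0_pos by (auto simp: S_def)
  ultimately show "0 < q_star p" "q_star p < s0 p" "f (q_star p) = q_star p"
    using s0_less by (auto simp: order.order_iff_strict)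
qed

text \<open>Strict convexity between the two fixed points q = \<open>q_star p\<close> and 1: the
  tangent inequalities at s towards both are added with weights s - q and 1 - s, for which the terms
  with tilt s cancel.\<close>

lemma supercritical_pgf_less:
  assumes "1 < measure_pmf.expectation p real" "q_star p < s" "s < 1"
  shows "f s < s"
proof -
  note q = supercritical_q_star[OF assms(1)]
  have s: "summ s" "summt s" "summ (q_star p)"
    using summ_1 assms q by (auto intro: summ_le[OF summ_1] summt_of_less[OF summ_1])
  have 1: "f s + tilt s * (1 - s) < s"
    using pgf_tangent(2)[of s 1] s summ_1 assms q by (simp add: f_1)
  have 2: "f s * q_star p + tilt s * (q_star p - s) < q_star p * s"
    using pgf_tangent(2)[of s "q_star p"] s summ_1 assms q by simp
  have "(s - q_star p) * (f s + tilt s * (1 - s)) + (1 - s) * (f s * q_star p + tilt s * (q_star p - s))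
      < (s - q_star p) * s + (1 - s) * (q_star p * s)"
    using 1 2 assms by (intro add_strict_mono mult_strict_left_mono) auto
  then have "(s * (1 - q_star p)) * f s < (s * (1 - q_star p)) * s"
    by (simp add: algebra_simps)
  moreover have "0 < s * (1 - q_star p)" using assms q by simp
  ultimately show ?thesis by (simp only: mult_less_cancel_left_pos)
qed

end

section \<open>Splitting the environment at the first reproduction of the root\<close>

text \<open>The index set is a disjoint union of one point and two copies of itself, so an i.i.d.
  family over it can be assembled from one variable and two independent copies of the family. The
  laws are compared on finite-dimensional cylinders.\<close>

lemma distr_join_PiM:
  fixes N :: "'a measure" and z :: 'c and \<alpha> \<beta> :: "'c \<Rightarrow> 'c"
  defines "P \<equiv> \<Pi>\<^sub>M i\<in>(UNIV :: 'c set). N"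
    and "S \<equiv> \<lambda>(x, \<omega>, \<omega>') i. if i = z then x
      else if i \<in> range \<alpha> then \<omega> (inv \<alpha> i) else \<omega>' (inv \<beta> i)"
  assumes N: "prob_space N"
    and inj: "inj \<alpha>" "inj \<beta>"
    and disj: "z \<notin> range \<alpha>" "z \<notin> range \<beta>" "range \<alpha> \<inter> range \<beta> = {}"
    and cover: "insert z (range \<alpha> \<union> range \<beta>) = UNIV"
  shows "S \<in> measurable (N \<Otimes>\<^sub>M (P \<Otimes>\<^sub>M P)) P"
    and "distr (N \<Otimes>\<^sub>M (P \<Otimes>\<^sub>M P)) P S = P"
proof -
  interpret N: prob_space N by fact
  interpret product_prob_space "\<lambda>_. N" "UNIV :: 'c set" ..
  have P: "prob_space P" unfolding P_def by (rule prob_space_PiM) (rule N)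
  have sf: "sigma_finite_measure P" "sigma_finite_measure (P \<Otimes>\<^sub>M P)"
    using P prob_space_pair[OF P P] by (auto simp: prob_space_imp_sigma_finite)
  have "S \<in> measurable (N \<Otimes>\<^sub>M (P \<Otimes>\<^sub>M P)) (\<Pi>\<^sub>M i\<in>(UNIV :: 'c set). N)"
    by (rule measurable_PiM_single') (auto simp: S_def P_def split_beta' space_pair_measure space_PiM PiE_iff)
  then show S[measurable]: "S \<in> measurable (N \<Otimes>\<^sub>M (P \<Otimes>\<^sub>M P)) P"
    by (simp add: P_def)
  have "distr (N \<Otimes>\<^sub>M (P \<Otimes>\<^sub>M P)) P S = (\<Pi>\<^sub>M i\<in>(UNIV :: 'c set). N)"
  proof (rule PiM_eq)
    fix J :: "'c set" and E
    assume J: "finite J" "J \<subseteq> UNIV" and E: "\<And>j. j \<in> J \<Longrightarrow> E j \<in> sets N"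
    let ?X = "prod_emb UNIV (\<lambda>_. N) J (\<Pi>\<^sub>E j\<in>J. E j)"
    let ?A = "if z \<in> J then E z else space N"
    let ?B = "prod_emb UNIV (\<lambda>_. N) (\<alpha> -` J) (\<Pi>\<^sub>E j\<in>\<alpha> -` J. E (\<alpha> j))"
    let ?C = "prod_emb UNIV (\<lambda>_. N) (\<beta> -` J) (\<Pi>\<^sub>E j\<in>\<beta> -` J. E (\<beta> j))"
    have emb: "prod_emb UNIV (\<lambda>_. N) K (\<Pi>\<^sub>E j\<in>K. F j) = {\<omega> \<in> space P. \<forall>j\<in>K. \<omega> j \<in> F j}"
      for K :: "'c set" and F
      by (auto simp: prod_emb_def P_def space_PiM PiE_iff)
    have fin: "finite (\<alpha> -` J)" "finite (\<beta> -` J)"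
      using J inj by (auto intro: finite_vimageI)
    have "\<beta> i \<notin> range \<alpha>" for i using disj by blast
    then have S_simps: "S (x, \<omega>, \<omega>') z = x" "S (x, \<omega>, \<omega>') (\<alpha> i) = \<omega> i" "S (x, \<omega>, \<omega>') (\<beta> i) = \<omega>' i"
      for x \<omega> \<omega>' i
      using disj inj by (auto simp: S_def)
    have all_J: "(\<forall>j\<in>J. Q j) \<longleftrightarrow> (z \<in> J \<longrightarrow> Q z) \<and> (\<forall>i\<in>\<alpha> -` J. Q (\<alpha> i)) \<and> (\<forall>i\<in>\<beta> -` J. Q (\<beta> i))" for Q
    proof -
      have *: "Q j" if "j \<in> J" and Q: "z \<in> J \<longrightarrow> Q z" "\<forall>i\<in>\<alpha> -` J. Q (\<alpha> i)" "\<forall>i\<in>\<beta> -` J. Q (\<beta> i)" for j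
      proof -
        consider "j = z" | i where "j = \<alpha> i" | i where "j = \<beta> i" using cover by blast
        then show ?thesis by cases (use that in auto)
      qed
      show ?thesis
      proof (rule iffI)
        assume "\<forall>j\<in>J. Q j"
        then show "(z \<in> J \<longrightarrow> Q z) \<and> (\<forall>i\<in>\<alpha> -` J. Q (\<alpha> i)) \<and> (\<forall>i\<in>\<beta> -` J. Q (\<beta> i))" by simp
      next
        assume H: "(z \<in> J \<longrightarrow> Q z) \<and> (\<forall>i\<in>\<alpha> -` J. Q (\<alpha> i)) \<and> (\<forall>i\<in>\<beta> -` J. Q (\<beta> i))"
        show "\<forall>j\<in>J. Q j" by (rule ballI, rule *) (use H in simp_all)
      qed
    qed
    have "S -` ?X \<inter> space (N \<Otimes>\<^sub>M (P \<Otimes>\<^sub>M P)) = ?A \<times> (?B \<times> ?C)"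
    proof -
      have iff: "(x, \<omega>, \<omega>') \<in> S -` ?X \<inter> space (N \<Otimes>\<^sub>M (P \<Otimes>\<^sub>M P)) \<longleftrightarrow> (x, \<omega>, \<omega>') \<in> ?A \<times> (?B \<times> ?C)" for x \<omega> \<omega>'
        using measurable_space[OF S, of "(x, \<omega>, \<omega>')"] E[THEN sets.sets_into_space]
        by (auto simp: emb all_J S_simps space_pair_measure)
      show ?thesis
      proof (rule set_eqI)
        fix y :: "'a \<times> ('c \<Rightarrow> 'a) \<times> ('c \<Rightarrow> 'a)"
        obtain x \<omega> \<omega>' where "y = (x, \<omega>, \<omega>')" by (cases y)
        with iff[of x \<omega> \<omega>'] show "y \<in> S -` ?X \<inter> space (N \<Otimes>\<^sub>M (P \<Otimes>\<^sub>M P)) \<longleftrightarrow> y \<in> ?A \<times> (?B \<times> ?C)"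
          by (simp only:)
      qed
    qed
    moreover have sets: "?X \<in> sets P" "?B \<in> sets P" "?C \<in> sets P" "?A \<in> sets N"
      using J E fin by (auto simp: P_def intro!: sets_PiM_I)
    ultimately have "emeasure (distr (N \<Otimes>\<^sub>M (P \<Otimes>\<^sub>M P)) P S) ?X
        = emeasure (N \<Otimes>\<^sub>M (P \<Otimes>\<^sub>M P)) (?A \<times> (?B \<times> ?C))"
      using emeasure_distr[OF S sets(1)] by (simp only:)
    also have "\<dots> = emeasure N ?A * emeasure (P \<Otimes>\<^sub>M P) (?B \<times> ?C)"
      by (rule sigma_finite_measure.emeasure_pair_measure_Times[OF sf(2) sets(4) pair_measureI[OF sets(2,3)]])
    also have "emeasure (P \<Otimes>\<^sub>M P) (?B \<times> ?C) = emeasure P ?B * emeasure P ?C"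
      by (rule sigma_finite_measure.emeasure_pair_measure_Times[OF sf(1) sets(2,3)])
    also have "emeasure P ?B = (\<Prod>j\<in>\<alpha> -` J. emeasure N (E (\<alpha> j)))"
      unfolding P_def using fin E by (intro emeasure_PiM_emb) auto
    also have "\<dots> = (\<Prod>j\<in>J \<inter> range \<alpha>. emeasure N (E j))"
      by (rule prod.reindex_cong[symmetric, of \<alpha>]) (auto intro: inj_on_subset[OF inj(1)])
    also have "emeasure P ?C = (\<Prod>j\<in>\<beta> -` J. emeasure N (E (\<beta> j)))"
      unfolding P_def using fin E by (intro emeasure_PiM_emb) auto
    also have "\<dots> = (\<Prod>j\<in>J \<inter> range \<beta>. emeasure N (E j))"
      by (rule prod.reindex_cong[symmetric, of \<beta>]) (auto intro: inj_on_subset[OF inj(2)])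
    also have "emeasure N ?A = (\<Prod>j\<in>J \<inter> {z}. emeasure N (E j))"
      by (auto simp: N.emeasure_space_1 Int_insert_right)
    also have "\<dots> * ((\<Prod>j\<in>J \<inter> range \<alpha>. emeasure N (E j)) * (\<Prod>j\<in>J \<inter> range \<beta>. emeasure N (E j)))
        = (\<Prod>j\<in>J \<inter> {z} \<union> (J \<inter> range \<alpha> \<union> J \<inter> range \<beta>). emeasure N (E j))"
    proof -
      have "J \<inter> {z} \<inter> (J \<inter> range \<alpha> \<union> J \<inter> range \<beta>) = {}" "J \<inter> range \<alpha> \<inter> (J \<inter> range \<beta>) = {}"
        using disj by auto
      with J show ?thesis by (simp add: prod.union_disjoint)
    qed
    also have "J \<inter> {z} \<union> (J \<inter> range \<alpha> \<union> J \<inter> range \<beta>) = J"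
      using cover by blast
    finally show "emeasure (distr (N \<Otimes>\<^sub>M (P \<Otimes>\<^sub>M P)) P S) ?X = (\<Prod>j\<in>J. emeasure N (E j))" .
  qed (simp add: P_def)
  then show "distr (N \<Otimes>\<^sub>M (P \<Otimes>\<^sub>M P)) P S = P" by (simp add: P_def)
qed

abbreviation env_law :: "nat pmf \<Rightarrow> environment measure" where
  "env_law p \<equiv> \<Pi>\<^sub>M vk \<in> (UNIV :: (vertex \<times> nat) set). exp1 \<Otimes>\<^sub>M measure_pmf p"

text \<open>
  At its first reproduction the root is replaced by two roots: the vertex born there, whose
  environment is \<open>child_env\<close>, and the root itself with its later reproductions, \<open>rest_env\<close>.
\<close>

fun child_idx :: "vertex \<times> nat \<Rightarrow> vertex \<times> nat" where
  "child_idx (v, j) = (v @ [0], j)"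

text \<open>The last entry of a name is the number of a reproduction of the root. Hence appending 0
  selects what descends from the first reproduction, and raising the last entry by one shifts the
  reproductions of the root.\<close>

fun later :: "vertex \<Rightarrow> vertex" where
  "later v = butlast v @ [Suc (last v)]"

fun rest_idx :: "vertex \<times> nat \<Rightarrow> vertex \<times> nat" where
  "rest_idx (v, j) = (if v = [] then ([], Suc j) else (later v, j))"

declare later.simps [simp del] child_idx.simps [simp del] rest_idx.simps [simp del]

definition child_env :: "environment \<Rightarrow> environment" where
  "child_env \<xi> i = \<xi> (child_idx i)"

definition rest_env :: "environment \<Rightarrow> environment" where
  "rest_env \<xi> i = \<xi> (rest_idx i)"

lemma vertex_cases:
  obtains "v = []" | w where "v = w @ [0]" | w where "w \<noteq> []" "v = later w"
proof (cases v rule: rev_cases)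
  case (snoc w k)
  show ?thesis
  proof (cases k)
    case 0
    with snoc that show ?thesis by simp
  next
    case (Suc j)
    then show ?thesis using that(3)[of "w @ [j]"] snoc by (simp add: later.simps)
  qed
qed (use that in simp)

lemma later_ne: "later v \<noteq> []" "later v \<noteq> w @ [0]"
  by (auto simp: later.simps)

lemma later_inj: "v \<noteq> [] \<Longrightarrow> w \<noteq> [] \<Longrightarrow> later v = later w \<longleftrightarrow> v = w"
  by (cases v rule: rev_cases; cases w rule: rev_cases) (auto simp: later.simps)

lemma prob_space_exp1: "prob_space exp1"
  by (rule prob_space_exponential_density) simp

lemma prob_space_mark: "prob_space (exp1 \<Otimes>\<^sub>M measure_pmf p)"
  using prob_space_exp1 measure_pmf.prob_space_axioms by (rule prob_space_pair)

lemma prob_space_env: "prob_space (env_law p)"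
  by (rule prob_space_PiM) (rule prob_space_mark)

lemma measurable_child_env [measurable]: "child_env \<in> measurable (env_law p) (env_law p)"
proof (rule measurable_PiM_single')
  show "(\<lambda>\<xi>. child_env \<xi> i) \<in> measurable (env_law p) (exp1 \<Otimes>\<^sub>M measure_pmf p)" for i
    unfolding child_env_def by measurable
qed (auto simp: space_PiM PiE_iff child_env_def)

lemma measurable_rest_env [measurable]: "rest_env \<in> measurable (env_law p) (env_law p)"
proof (rule measurable_PiM_single')
  show "(\<lambda>\<xi>. rest_env \<xi> i) \<in> measurable (env_law p) (exp1 \<Otimes>\<^sub>M measure_pmf p)" for i
    unfolding rest_env_def by measurable
qed (auto simp: space_PiM PiE_iff rest_env_def)

text \<open>The branching property in integrated form: first mark, child environment and remaining
  environment use disjoint sets of indices that exhaust all indices, so they are independent, and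
  the last two are again distributed as \<open>env_law p\<close>.\<close>

lemma nn_integral_env_split:
  fixes p :: "nat pmf"
  assumes F[measurable]: "F \<in> borel_measurable ((exp1 \<Otimes>\<^sub>M measure_pmf p) \<Otimes>\<^sub>M (env_law p \<Otimes>\<^sub>M env_law p))"
  shows "(\<integral>\<^sup>+\<xi>. F (\<xi> ([], 0), child_env \<xi>, rest_env \<xi>) \<partial>env_law p)
    = (\<integral>\<^sup>+w. \<integral>\<^sup>+k. \<integral>\<^sup>+\<xi>. \<integral>\<^sup>+\<xi>'. F ((w, k), \<xi>, \<xi>') \<partial>env_law p \<partial>env_law p \<partial>measure_pmf p \<partial>exp1)"
proof -
  let ?N = "exp1 \<Otimes>\<^sub>M measure_pmf p"
  let ?S = "\<lambda>(x, \<omega>, \<omega>') i. if i = ([], 0 :: nat) then x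
      else if i \<in> range child_idx then \<omega> (inv child_idx i) else \<omega>' (inv rest_idx i)"
  interpret E: prob_space exp1 by (rule prob_space_exp1)
  interpret P: prob_space "env_law p" by (rule prob_space_env)
  interpret PP: pair_prob_space "env_law p" "env_law p" ..
  interpret N: pair_prob_space exp1 "measure_pmf p" ..
  have inj: "inj child_idx" "inj rest_idx"
    by (auto simp: inj_on_def child_idx.simps rest_idx.simps later_ne[symmetric] later_ne later_inj split: if_splits)
  have ne: "child_idx i \<noteq> ([], 0)" "rest_idx i \<noteq> ([], 0)" "rest_idx i \<notin> range child_idx" for i
    by (cases i; auto simp: child_idx.simps rest_idx.simps later_ne later_ne[symmetric] split: if_splits)+
  have "([], 0) \<notin> range child_idx" using ne(1) by (metis imageE)
  moreover have "([], 0) \<notin> range rest_idx" using ne(2) by (metis imageE)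
  moreover have "range child_idx \<inter> range rest_idx = {}"
  proof (rule equals0I)
    fix x assume x: "x \<in> range child_idx \<inter> range rest_idx"
    then obtain i where "x = rest_idx i" by (elim IntE imageE)
    with ne(3)[of i] x show False by simp
  qed
  ultimately have disj: "([], 0) \<notin> range child_idx" "([], 0) \<notin> range rest_idx"
    "range child_idx \<inter> range rest_idx = {}" .
  have cover: "insert ([], 0) (range child_idx \<union> range rest_idx) = UNIV"
  proof -
    have "(v, j) \<in> insert ([], 0) (range child_idx \<union> range rest_idx)" for v j
    proof (cases v rule: vertex_cases)
      case 1
      have "([], Suc i) = rest_idx ([], i)" for i by (simp add: rest_idx.simps)
      with 1 show ?thesis by (cases j) auto
    next
      case (2 w)
      then have "(v, j) = child_idx (w, j)" by (simp add: child_idx.simps)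
      then show ?thesis by blast
    next
      case (3 w)
      then have "(v, j) = rest_idx (w, j)" by (simp add: rest_idx.simps)
      then show ?thesis by blast
    qed
    then show ?thesis by auto
  qed
  note join = distr_join_PiM[OF prob_space_mark inj disj cover, of p]
  have F': "(\<lambda>\<xi>. F (\<xi> ([], 0), child_env \<xi>, rest_env \<xi>)) \<in> borel_measurable (env_law p)"
    by measurable
  have "(\<integral>\<^sup>+\<xi>. F (\<xi> ([], 0), child_env \<xi>, rest_env \<xi>) \<partial>env_law p)
     = (\<integral>\<^sup>+x. F (?S x ([], 0), child_env (?S x), rest_env (?S x)) \<partial>(?N \<Otimes>\<^sub>M (env_law p \<Otimes>\<^sub>M env_law p)))"
    by (subst join(2)[symmetric], subst nn_integral_distr[OF join(1)]) (use F' in simp_all)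
  also have "\<dots> = (\<integral>\<^sup>+x. F x \<partial>(?N \<Otimes>\<^sub>M (env_law p \<Otimes>\<^sub>M env_law p)))"
  proof (rule nn_integral_cong)
    fix x :: "(real \<times> nat) \<times> environment \<times> environment"
    obtain y \<omega> \<omega>' where x: "x = (y, \<omega>, \<omega>')" by (cases x)
    have "?S x ([], 0) = y" "child_env (?S x) = \<omega>" "rest_env (?S x) = \<omega>'"
      using inj by (auto simp: fun_eq_iff x child_env_def rest_env_def ne)
    then show "F (?S x ([], 0), child_env (?S x), rest_env (?S x)) = F x"
      by (simp add: x)
  qed
  also have "\<dots> = (\<integral>\<^sup>+w. \<integral>\<^sup>+k. \<integral>\<^sup>+\<xi>. \<integral>\<^sup>+\<xi>'. F ((w, k), \<xi>, \<xi>') \<partial>env_law p \<partial>env_law p \<partial>measure_pmf p \<partial>exp1)"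
  proof -
    have sf: "sigma_finite_measure (env_law p \<Otimes>\<^sub>M env_law p)" by unfold_locales
    show ?thesis
      by (simp add: sigma_finite_measure.nn_integral_fst[OF sf, symmetric]
          measure_pmf.nn_integral_fst[symmetric] P.nn_integral_fst[symmetric])
  qed
  finally show ?thesis .
qed

text \<open>The left side is b e^-t plus the integral of e^-w \<Phi>(t - w) over [0, t], which is
  the solution operator of u' = \<Phi> - u with u(0) = b. A function V as assumed stays above it,
  because e^-w (V + V')(t - w) is the derivative in w of - e^-w V(t - w).\<close>

lemma nn_integral_exp1_step:
  fixes V V' :: "real \<Rightarrow> real" and \<Phi> :: "real \<Rightarrow> ennreal"
  assumes V: "\<And>y. (V has_real_derivative V' y) (at y)"
    and nonneg: "\<And>y. 0 \<le> y \<Longrightarrow> y \<le> t \<Longrightarrow> 0 \<le> V y + V' y"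
    and \<Phi>: "\<And>y. 0 \<le> y \<Longrightarrow> y \<le> t \<Longrightarrow> \<Phi> y \<le> ennreal (V y + V' y)"
    and b: "0 \<le> b" "b \<le> V 0" and t: "0 \<le> t"
    and [measurable]: "\<Phi> \<in> borel_measurable borel" "V' \<in> borel_measurable borel"
  shows "(\<integral>\<^sup>+w. (if t < w then ennreal b else \<Phi> (t - w)) \<partial>exp1) \<le> ennreal (V t)"
proof -
  have [measurable]: "V \<in> borel_measurable borel"
    using V by (intro borel_measurable_continuous_onI continuous_at_imp_continuous_on) (auto intro: DERIV_isCont)
  let ?G = "\<lambda>w. exp (- w) * (V (t - w) + V' (t - w))"
  let ?F = "\<lambda>w. - exp (- w) * V (t - w)"
  have F: "(?F has_real_derivative ?G w) (at w)" for w
  proof -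
    have "((\<lambda>w. V (t - w)) has_real_derivative V' (t - w) * (- 1)) (at w)"
      by (rule DERIV_chain2[of V, OF V]) (auto intro!: derivative_eq_intros)
    then show ?thesis by (auto intro!: derivative_eq_intros simp: algebra_simps)
  qed
  have F_le: "?F 0 \<le> ?F t"
  proof (rule DERIV_nonneg_imp_nondecreasing[OF t])
    fix w assume w: "0 \<le> w" "w \<le> t"
    have "0 \<le> ?G w" using nonneg[of "t - w"] w by simp
    with F[of w] show "\<exists>y. (?F has_real_derivative y) (at w) \<and> 0 \<le> y" by blast
  qed
  have "(\<integral>\<^sup>+w. (if t < w then ennreal b else \<Phi> (t - w)) \<partial>exp1)
      = (\<integral>\<^sup>+w. ennreal (exponential_density 1 w) * (if t < w then ennreal b else \<Phi> (t - w)) \<partial>lborel)"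
    by (subst nn_integral_density) (auto simp: exponential_density_nonneg)
  also have "\<dots> \<le> (\<integral>\<^sup>+w. ennreal (b * exp (- w)) * indicator {t..} w + ennreal (?G w) * indicator {0..t} w \<partial>lborel)"
  proof (rule nn_integral_mono)
    fix w :: real
    consider "w < 0" | "0 \<le> w" "w \<le> t" | "t < w" by linarith
    then show "ennreal (exponential_density 1 w) * (if t < w then ennreal b else \<Phi> (t - w))
        \<le> ennreal (b * exp (- w)) * indicator {t..} w + ennreal (?G w) * indicator {0..t} w"
    proof cases
      case 1
      then show ?thesis by (simp add: exponential_density_def)
    next
      case 2
      then have "ennreal (exp (- w)) * \<Phi> (t - w) \<le> ennreal (exp (- w)) * ennreal (V (t - w) + V' (t - w))"
        by (intro mult_left_mono \<Phi>) auto
      also have "\<dots> = ennreal (?G w)" by (simp add: ennreal_mult')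
      also have "\<dots> \<le> ennreal (b * exp (- w)) * indicator {t..} w + ennreal (?G w)" by simp
      finally show ?thesis using 2 by (simp add: exponential_density_def)
    next
      case 3
      then show ?thesis using t b
        by (simp add: exponential_density_def ennreal_mult' mult.commute)
    qed
  qed
  also have "\<dots> = (\<integral>\<^sup>+w. ennreal (b * exp (- w)) * indicator {t..} w \<partial>lborel)
      + (\<integral>\<^sup>+w. ennreal (?G w) * indicator {0..t} w \<partial>lborel)"
    by (rule nn_integral_add) measurable
  also have "(\<integral>\<^sup>+w. ennreal (b * exp (- w)) * indicator {t..} w \<partial>lborel) = ennreal (0 - (- b * exp (- t)))"
  proof (rule nn_integral_FTC_atLeast[where F = "\<lambda>w. - b * exp (- w)"])
    have "((\<lambda>w. - b * exp (- w)) \<longlongrightarrow> - b * 0) at_top"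
      by (intro tendsto_intros filterlim_compose[OF exp_at_bot filterlim_uminus_at_bot_at_top])
    then show "((\<lambda>w. - b * exp (- w)) \<longlongrightarrow> 0) at_top" by simp
  qed (use b in \<open>auto intro!: derivative_eq_intros\<close>)
  also have "(\<integral>\<^sup>+w. ennreal (?G w) * indicator {0..t} w \<partial>lborel) = ennreal (?F t - ?F 0)"
  proof (rule nn_integral_FTC_Icc[where F = ?F])
    fix w assume w: "w \<in> {0..t}"
    show "(?F has_real_derivative ?G w) (at w)" by (rule F)
    show "0 \<le> ?G w" using nonneg[of "t - w"] w by simp
  qed (use t in simp_all)
  also have "ennreal (0 - (- b * exp (- t))) + ennreal (?F t - ?F 0) = ennreal (b * exp (- t) + (?F t - ?F 0))"
    using b F_le by (subst ennreal_plus[symmetric]) auto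
  also have "\<dots> \<le> ennreal (V t)"
    using b by (intro ennreal_leI) simp
  finally show ?thesis .
qed

section \<open>Functionals of the branching process of depths\<close>

text \<open>
  \<open>weight_sum c n d \<xi> t\<close> is the sum of \<open>c ^ depth\<close> over the vertices born by time \<open>t\<close> when the root
  is put at depth \<open>d\<close>, restricted to the finitely many vertices that are found by unfolding the
  splitting at the root \<open>n\<close> times.
\<close>

primrec weight_sum :: "real \<Rightarrow> nat \<Rightarrow> nat \<Rightarrow> environment \<Rightarrow> real \<Rightarrow> real" where
  "weight_sum c 0 d \<xi> t = c ^ d"
| "weight_sum c (Suc n) d \<xi> t =
     (if t < waiting \<xi> [] 0 then c ^ d
      else weight_sum c n d (rest_env \<xi>) (t - waiting \<xi> [] 0) +
        (if jump \<xi> [] 0 \<le> d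
         then weight_sum c n (Suc d - jump \<xi> [] 0) (child_env \<xi>) (t - waiting \<xi> [] 0) else 0))"

text \<open>One recursion for the multiplicative and the additive functional, so that measurability
  and the splitting are proved once. A particle at the barrier, which is evaluated at the remaining
  time, contributes \<open>a\<close>; a killed child contributes \<open>u\<close>, the neutral
  element of \<open>opr\<close> in both uses; \<open>b\<close> is the terminal value.\<close>

primrec branch_fun :: "(nat \<Rightarrow> real \<Rightarrow> bool) \<Rightarrow> ennreal \<Rightarrow> ennreal \<Rightarrow> (ennreal \<Rightarrow> ennreal \<Rightarrow> ennreal) \<Rightarrow>
    (nat \<Rightarrow> ennreal) \<Rightarrow> nat \<Rightarrow> nat \<Rightarrow> environment \<Rightarrow> real \<Rightarrow> ennreal" where
  "branch_fun bar a u opr b 0 d \<xi> t = (if bar d t then a else b d)"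
| "branch_fun bar a u opr b (Suc n) d \<xi> t =
     (if bar d t then a else if t < waiting \<xi> [] 0 then b d
      else opr (branch_fun bar a u opr b n d (rest_env \<xi>) (t - waiting \<xi> [] 0))
        (if jump \<xi> [] 0 \<le> d
         then branch_fun bar a u opr b n (Suc d - jump \<xi> [] 0) (child_env \<xi>) (t - waiting \<xi> [] 0) else u))"

text \<open>
  The exponential functional of \<^const>\<open>weight_sum\<close>, set to \<open>0\<close> as soon as a vertex crosses the
  barrier, and a bound for the number of such crossings.
\<close>

abbreviation exp_fun :: "(nat \<Rightarrow> real \<Rightarrow> bool) \<Rightarrow> (nat \<Rightarrow> ennreal) \<Rightarrow> nat \<Rightarrow> nat \<Rightarrow> environment \<Rightarrow> real \<Rightarrow> ennreal" where
  "exp_fun bar b \<equiv> branch_fun bar 0 1 (*) b"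

abbreviation crossings :: "(nat \<Rightarrow> real \<Rightarrow> bool) \<Rightarrow> nat \<Rightarrow> nat \<Rightarrow> environment \<Rightarrow> real \<Rightarrow> ennreal" where
  "crossings bar \<equiv> branch_fun bar 1 0 (+) (\<lambda>_. 0)"

text \<open>Each visit to the barrier adds 1, so a count below 1 means no visit. The exponential
  functional is then never cut off, and sums turn into products.\<close>

lemma crossings_or_exp_fun:
  assumes "crossings bar n d \<xi> t < 1"
  shows "exp_fun bar (\<lambda>d. ennreal (exp (a * c ^ d))) n d \<xi> t = ennreal (exp (a * weight_sum c n d \<xi> t))"
  using assms
proof (induction n arbitrary: d \<xi> t)
  case 0
  then show ?case by (auto split: if_splits)
next
  case (Suc n)
  show ?case
  proof (cases "bar d t \<or> t < waiting \<xi> [] 0")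
    case True
    with Suc.prems show ?thesis by (auto split: if_splits)
  next
    case False
    let ?t = "t - waiting \<xi> [] 0"
    have sum: "crossings bar n d (rest_env \<xi>) ?t
      + (if jump \<xi> [] 0 \<le> d then crossings bar n (Suc d - jump \<xi> [] 0) (child_env \<xi>) ?t else 0) < 1"
      using Suc.prems False by simp
    have rest: "crossings bar n d (rest_env \<xi>) ?t < 1"
      by (rule le_less_trans[OF _ sum]) simp
    have child: "crossings bar n (Suc d - jump \<xi> [] 0) (child_env \<xi>) ?t < 1" if "jump \<xi> [] 0 \<le> d"
      by (rule le_less_trans[OF _ sum]) (use that in simp)
    show ?thesis
      using False Suc.IH[OF rest] Suc.IH[OF child]
      by (simp add: ennreal_mult'[symmetric] exp_add[symmetric] distrib_left)
  qed
qed

lemma crossings_False: "crossings (\<lambda>_ _. False) n d \<xi> t = 0"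
  by (induction n arbitrary: d \<xi> t) auto

section \<open>Measurability and the recursion at the first reproduction\<close>

lemma measurable_first_mark [measurable]:
  "(\<lambda>\<xi>. waiting \<xi> v k) \<in> borel_measurable (env_law p)"
  "(\<lambda>\<xi>. jump \<xi> v k) \<in> measurable (env_law p) (count_space UNIV)"
proof -
  have 1: "(\<lambda>\<xi>. \<xi> (v, k)) \<in> measurable (env_law p) (exp1 \<Otimes>\<^sub>M measure_pmf p)"
    by (rule measurable_component_singleton) simp
  have 2: "fst \<in> borel_measurable (exp1 \<Otimes>\<^sub>M measure_pmf p)"
    using measurable_fst[of exp1 "measure_pmf p"] by (simp cong: measurable_cong_sets)
  have 3: "snd \<in> measurable (exp1 \<Otimes>\<^sub>M measure_pmf p) (count_space UNIV)"
    using measurable_snd[of exp1 "measure_pmf p"] by (simp cong: measurable_cong_sets)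
  show "(\<lambda>\<xi>. waiting \<xi> v k) \<in> borel_measurable (env_law p)"
    by (rule measurable_compose[OF 1 2])
  show "(\<lambda>\<xi>. jump \<xi> v k) \<in> measurable (env_law p) (count_space UNIV)"
    by (rule measurable_compose[OF 1 3])
qed

lemma measurable_branch_fun:
  assumes bar[measurable]: "\<And>d. Measurable.pred borel (bar d)"
    and opr[measurable]: "(\<lambda>(x, y). opr x y) \<in> borel_measurable (borel \<Otimes>\<^sub>M borel)"
  shows "(\<lambda>(\<xi>, t). branch_fun bar a u opr b n d \<xi> t) \<in> borel_measurable (env_law p \<Otimes>\<^sub>M borel)"
proof (induction n arbitrary: d)
  case 0
  show ?case by (simp add: split_beta')
next
  case (Suc n)
  let ?w = "\<lambda>x :: environment \<times> real. waiting (fst x) [] 0"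
  let ?j = "\<lambda>x :: environment \<times> real. jump (fst x) [] 0"
  have rest: "(\<lambda>x. branch_fun bar a u opr b n d (rest_env (fst x)) (snd x - ?w x))
      \<in> borel_measurable (env_law p \<Otimes>\<^sub>M borel)"
    using measurable_compose[OF _ Suc.IH[of d], of "\<lambda>x. (rest_env (fst x), snd x - ?w x)"]
    by (simp add: split_beta')
  have child': "(\<lambda>x. branch_fun bar a u opr b n e (child_env (fst x)) (snd x - ?w x))
      \<in> borel_measurable (env_law p \<Otimes>\<^sub>M borel)" for e
    using measurable_compose[OF _ Suc.IH[of e], of "\<lambda>x. (child_env (fst x), snd x - ?w x)"]
    by (simp add: split_beta')
  have child: "(\<lambda>x. branch_fun bar a u opr b n (Suc d - ?j x) (child_env (fst x)) (snd x - ?w x))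
      \<in> borel_measurable (env_law p \<Otimes>\<^sub>M borel)"
    by (rule measurable_compose_countable[where f = "\<lambda>e x. branch_fun bar a u opr b n e (child_env (fst x)) (snd x - ?w x)", OF child'])
       measurable
  have both: "(\<lambda>x. opr (branch_fun bar a u opr b n d (rest_env (fst x)) (snd x - ?w x))
      (if ?j x \<le> d then branch_fun bar a u opr b n (Suc d - ?j x) (child_env (fst x)) (snd x - ?w x) else u))
      \<in> borel_measurable (env_law p \<Otimes>\<^sub>M borel)"
    using measurable_compose[OF measurable_Pair[OF rest measurable_If[OF child measurable_const[of u]]] opr]
    by simp
  show ?case
    unfolding split_beta' branch_fun.simps
    by (intro measurable_If both) measurable
qed

lemma measurable_branch_fun_env:
  assumes bar: "\<And>d. Measurable.pred borel (bar d)"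
    and opr: "(\<lambda>(x, y). opr x y) \<in> borel_measurable (borel \<Otimes>\<^sub>M borel)"
  shows "(\<lambda>\<xi>. branch_fun bar a u opr b n d \<xi> t) \<in> borel_measurable (env_law p)"
  using measurable_compose[OF _ measurable_branch_fun[OF assms], of "\<lambda>\<xi>. (\<xi>, t)"] by simp

lemma measurable_branch_fun_time:
  assumes bar: "\<And>d. Measurable.pred borel (bar d)"
    and opr: "(\<lambda>(x, y). opr x y) \<in> borel_measurable (borel \<Otimes>\<^sub>M borel)"
  shows "(\<lambda>t. \<integral>\<^sup>+\<xi>. branch_fun bar a u opr b n d \<xi> t \<partial>env_law p) \<in> borel_measurable borel"
proof -
  interpret prob_space "env_law p" by (rule prob_space_env)
  have "(\<lambda>(t, \<xi>). branch_fun bar a u opr b n d \<xi> t) \<in> borel_measurable (borel \<Otimes>\<^sub>M env_law p)"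
    using measurable_compose[OF _ measurable_branch_fun[OF assms], of "\<lambda>(t, \<xi>). (\<xi>, t)"]
    by (simp add: split_beta')
  then show ?thesis by (rule borel_measurable_nn_integral)
qed

lemma measurable_ops:
  "(\<lambda>(x, y). x * y :: ennreal) \<in> borel_measurable (borel \<Otimes>\<^sub>M borel)"
  "(\<lambda>(x, y). x + y :: ennreal) \<in> borel_measurable (borel \<Otimes>\<^sub>M borel)"
  by measurable

lemma nn_integral_branch_fun_Suc:
  fixes p :: "nat pmf"
  assumes bar: "\<And>d. Measurable.pred borel (bar d)"
    and opr: "(\<lambda>(x, y). opr x y) \<in> borel_measurable (borel \<Otimes>\<^sub>M borel)"
    and nb: "\<not> bar d t"
  shows "(\<integral>\<^sup>+\<xi>. branch_fun bar a u opr b (Suc n) d \<xi> t \<partial>env_law p) =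
    (\<integral>\<^sup>+w. (if t < w then b d else \<integral>\<^sup>+k. \<integral>\<^sup>+\<xi>. \<integral>\<^sup>+\<xi>'.
        opr (branch_fun bar a u opr b n d \<xi>' (t - w))
          (if k \<le> d then branch_fun bar a u opr b n (Suc d - k) \<xi> (t - w) else u)
      \<partial>env_law p \<partial>env_law p \<partial>measure_pmf p) \<partial>exp1)"
proof -
  interpret P: prob_space "env_law p" by (rule prob_space_env)
  let ?B = "branch_fun bar a u opr b n"
  define F where "F = (\<lambda>((w :: real, k), \<xi>, \<xi>'). if t < w then b d
      else opr (?B d \<xi>' (t - w)) (if k \<le> d then ?B (Suc d - k) \<xi> (t - w) else u))"
  let ?M = "(exp1 \<Otimes>\<^sub>M measure_pmf p) \<Otimes>\<^sub>M (env_law p \<Otimes>\<^sub>M env_law p)"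
  have w[measurable]: "(\<lambda>x. fst (fst x)) \<in> borel_measurable ?M"
    using measurable_compose[OF measurable_fst[of "exp1 \<Otimes>\<^sub>M measure_pmf p" "env_law p \<Otimes>\<^sub>M env_law p"] measurable_fst[of exp1 "measure_pmf p"]]
    by (simp cong: measurable_cong_sets)
  have k[measurable]: "(\<lambda>x. snd (fst x)) \<in> measurable ?M (count_space UNIV)"
    using measurable_compose[OF measurable_fst[of "exp1 \<Otimes>\<^sub>M measure_pmf p" "env_law p \<Otimes>\<^sub>M env_law p"] measurable_snd[of exp1 "measure_pmf p"]]
    by (simp cong: measurable_cong_sets)
  have rest: "(\<lambda>x. ?B d (snd (snd x)) (t - fst (fst x))) \<in> borel_measurable ?M"
    using measurable_compose[OF _ measurable_branch_fun[where bar = bar and opr = opr, OF bar opr], of "\<lambda>x. (snd (snd x), t - fst (fst x))" ?M]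
    by simp
  have child': "(\<lambda>x. ?B e (fst (snd x)) (t - fst (fst x))) \<in> borel_measurable ?M" for e
    using measurable_compose[OF _ measurable_branch_fun[where bar = bar and opr = opr, OF bar opr], of "\<lambda>x. (fst (snd x), t - fst (fst x))" ?M]
    by simp
  have child: "(\<lambda>x. ?B (Suc d - snd (fst x)) (fst (snd x)) (t - fst (fst x))) \<in> borel_measurable ?M"
    by (rule measurable_compose_countable[where f = "\<lambda>e x. ?B e (fst (snd x)) (t - fst (fst x))", OF child'])
       measurable
  have both: "(\<lambda>x. opr (?B d (snd (snd x)) (t - fst (fst x)))
      (if snd (fst x) \<le> d then ?B (Suc d - snd (fst x)) (fst (snd x)) (t - fst (fst x)) else u))
      \<in> borel_measurable ?M"
    using measurable_compose[OF measurable_Pair[OF rest measurable_If[OF child measurable_const[of u]]] opr]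
    by simp
  have F: "F \<in> borel_measurable ?M"
    unfolding F_def split_beta' by (rule measurable_If[OF measurable_const both]) measurable
  have "(\<integral>\<^sup>+\<xi>. branch_fun bar a u opr b (Suc n) d \<xi> t \<partial>env_law p)
      = (\<integral>\<^sup>+\<xi>. F (\<xi> ([], 0), child_env \<xi>, rest_env \<xi>) \<partial>env_law p)"
    using nb by (intro nn_integral_cong) (simp add: F_def split_beta')
  also have "\<dots> = (\<integral>\<^sup>+w. \<integral>\<^sup>+k. \<integral>\<^sup>+\<xi>. \<integral>\<^sup>+\<xi>'. F ((w, k), \<xi>, \<xi>') \<partial>env_law p \<partial>env_law p \<partial>measure_pmf p \<partial>exp1)"
    by (rule nn_integral_env_split[OF F])
  also have "\<dots> = (\<integral>\<^sup>+w. (if t < w then b d else \<integral>\<^sup>+k. \<integral>\<^sup>+\<xi>. \<integral>\<^sup>+\<xi>'.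
        opr (?B d \<xi>' (t - w)) (if k \<le> d then ?B (Suc d - k) \<xi> (t - w) else u)
      \<partial>env_law p \<partial>env_law p \<partial>measure_pmf p) \<partial>exp1)"
    by (intro nn_integral_cong) (auto simp: F_def P.emeasure_space_1)
  finally show ?thesis .
qed

text \<open>Child and rest are independent, so the integral of the product factorises. This is the
  integrated form of the equation u' = u (E u - 1) for one more unfolding.\<close>

lemma nn_integral_exp_fun_Suc:
  fixes p :: "nat pmf" and b :: "nat \<Rightarrow> ennreal" and n :: nat
  assumes bar: "\<And>d. Measurable.pred borel (bar d)" and nb: "\<not> bar d t"
  defines "E \<equiv> \<lambda>d t. \<integral>\<^sup>+\<xi>. exp_fun bar b n d \<xi> t \<partial>env_law p"
  shows "(\<integral>\<^sup>+\<xi>. exp_fun bar b (Suc n) d \<xi> t \<partial>env_law p) =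
    (\<integral>\<^sup>+w. (if t < w then b d
       else E d (t - w) * (\<integral>\<^sup>+k. (if k \<le> d then E (Suc d - k) (t - w) else 1) \<partial>measure_pmf p)) \<partial>exp1)"
proof -
  interpret P: prob_space "env_law p" by (rule prob_space_env)
  note m = measurable_branch_fun_env[where bar = bar and opr = "(*)", OF bar measurable_ops(1), measurable]
  have *: "(\<integral>\<^sup>+k. \<integral>\<^sup>+\<xi>. \<integral>\<^sup>+\<xi>'. exp_fun bar b n d \<xi>' (t - w) *
          (if k \<le> d then exp_fun bar b n (Suc d - k) \<xi> (t - w) else 1)
      \<partial>env_law p \<partial>env_law p \<partial>measure_pmf p)
    = E d (t - w) * (\<integral>\<^sup>+k. (if k \<le> d then E (Suc d - k) (t - w) else 1) \<partial>measure_pmf p)" for w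
  proof -
    have "(\<integral>\<^sup>+\<xi>. \<integral>\<^sup>+\<xi>'. exp_fun bar b n d \<xi>' (t - w) *
          (if k \<le> d then exp_fun bar b n (Suc d - k) \<xi> (t - w) else 1) \<partial>env_law p \<partial>env_law p)
        = E d (t - w) * (if k \<le> d then E (Suc d - k) (t - w) else 1)" for k
      by (simp add: nn_integral_multc nn_integral_cmult E_def P.emeasure_space_1)
    then show ?thesis by (simp add: nn_integral_cmult)
  qed
  show ?thesis
    by (subst nn_integral_branch_fun_Suc[where bar = bar and opr = "(*)", OF bar measurable_ops(1) nb]) (simp only: *)
qed

lemma nn_integral_crossings_Suc:
  fixes p :: "nat pmf" and n :: nat
  assumes bar: "\<And>d. Measurable.pred borel (bar d)" and nb: "\<not> bar d t"
  defines "E \<equiv> \<lambda>d t. \<integral>\<^sup>+\<xi>. crossings bar n d \<xi> t \<partial>env_law p"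
  shows "(\<integral>\<^sup>+\<xi>. crossings bar (Suc n) d \<xi> t \<partial>env_law p) =
    (\<integral>\<^sup>+w. (if t < w then 0
       else E d (t - w) + (\<integral>\<^sup>+k. (if k \<le> d then E (Suc d - k) (t - w) else 0) \<partial>measure_pmf p)) \<partial>exp1)"
proof -
  interpret P: prob_space "env_law p" by (rule prob_space_env)
  note m = measurable_branch_fun_env[where bar = bar and opr = "(+)", OF bar measurable_ops(2), measurable]
  have *: "(\<integral>\<^sup>+k. \<integral>\<^sup>+\<xi>. \<integral>\<^sup>+\<xi>'. crossings bar n d \<xi>' (t - w) +
          (if k \<le> d then crossings bar n (Suc d - k) \<xi> (t - w) else 0)
      \<partial>env_law p \<partial>env_law p \<partial>measure_pmf p)
    = E d (t - w) + (\<integral>\<^sup>+k. (if k \<le> d then E (Suc d - k) (t - w) else 0) \<partial>measure_pmf p)" for w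
  proof -
    have "(\<integral>\<^sup>+\<xi>. \<integral>\<^sup>+\<xi>'. crossings bar n d \<xi>' (t - w) +
          (if k \<le> d then crossings bar n (Suc d - k) \<xi> (t - w) else 0) \<partial>env_law p \<partial>env_law p)
        = E d (t - w) + (if k \<le> d then E (Suc d - k) (t - w) else 0)" for k
      by (simp add: nn_integral_add E_def P.emeasure_space_1)
    then show ?thesis by (simp add: nn_integral_add)
  qed
  show ?thesis
    by (subst nn_integral_branch_fun_Suc[where bar = bar and opr = "(+)", OF bar measurable_ops(2) nb]) (simp only: *)
qed

lemma measurable_exp_fun_time:
  assumes "\<And>d. Measurable.pred borel (bar d)"
  shows "(\<lambda>t. \<integral>\<^sup>+\<xi>. exp_fun bar b n d \<xi> t \<partial>env_law p) \<in> borel_measurable borel"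
    and "(\<lambda>t. \<integral>\<^sup>+\<xi>. crossings bar n d \<xi> t \<partial>env_law p) \<in> borel_measurable borel"
  using measurable_branch_fun_time[where bar = bar and opr = "(*)", OF assms measurable_ops(1)]
    measurable_branch_fun_time[where bar = bar and opr = "(+)", OF assms measurable_ops(2)] by blast+

lemma measurable_nn_integral_pmf:
  fixes p :: "nat pmf" and h :: "nat \<Rightarrow> real \<Rightarrow> ennreal"
  assumes [measurable]: "\<And>k. h k \<in> borel_measurable borel"
  shows "(\<lambda>t. \<integral>\<^sup>+k. h k t \<partial>measure_pmf p) \<in> borel_measurable borel"
  by (simp add: nn_integral_measure_pmf nn_integral_count_space_nat)

section \<open>Supersolutions for the upper bound\<close>

context offspring
begin

lemma nn_integral_pgf:
  assumes "summ s" "0 \<le> s"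
  shows "(\<integral>\<^sup>+k. ennreal (s ^ k) \<partial>measure_pmf p) = ennreal (f s)"
proof -
  have "(\<integral>\<^sup>+k. ennreal (s ^ k) \<partial>measure_pmf p) = (\<Sum>k. ennreal (pmf p k * s ^ k))"
    using assms by (simp add: nn_integral_measure_pmf nn_integral_count_space_nat ennreal_mult)
  also have "\<dots> = ennreal (f s)"
    unfolding pgf_def using assms by (intro suminf_ennreal2) auto
  finally show ?thesis .
qed

text \<open>A child born with Z = k has weight s^-d s^(k - 1); averaging over Z produces the growth
  rate f s / s.\<close>

lemma scaled_power:
  fixes s :: real
  assumes "0 < s" "k \<le> d"
  shows "(1 / s) ^ (Suc d - k) = (1 / s) ^ d * (1 / s) * s ^ k"
proof -
  have "(1 / s) ^ Suc d = (1 / s) ^ (Suc d - k) * (1 / s) ^ k"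
    using assms by (simp add: power_add[symmetric])
  then show ?thesis using assms by (simp add: power_divide field_simps)
qed

text \<open>For V = exp G and \<mu> = (1 + e) f s / s one has V + V' = (1 + \<mu> G) exp G, and 1 +
  \<mu> G bounds the mean contribution of the child: below the barrier exp x \<le> 1 + (1 + e) x
  applies, beyond it the functional vanishes. As G increases with the remaining time, a particle not
  absorbed now is not absorbed later at the same depth. The assumption c \<le> 1 / s compares the
  terminal values.\<close>

lemma exp_fun_bound:
  fixes s e \<kappa> \<eta> c :: real
  assumes s: "0 < s" "summ s" and e: "0 \<le> e" and \<eta>: "0 \<le> \<eta>" and c: "0 \<le> c" "c \<le> 1 / s"
    and \<kappa>: "\<And>x. 0 \<le> x \<Longrightarrow> x \<le> \<kappa> \<Longrightarrow> exp x \<le> 1 + (1 + e) * x"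
  defines "G \<equiv> \<lambda>d t. \<eta> * exp ((1 + e) * (f s / s) * t) * (1 / s) ^ d"
  defines "bar \<equiv> \<lambda>d t. \<kappa> < G d t"
  assumes t: "0 \<le> t"
  shows "(\<integral>\<^sup>+\<xi>. exp_fun bar (\<lambda>d. ennreal (exp (\<eta> * c ^ d))) n d \<xi> t \<partial>env_law p)
    \<le> (if bar d t then 0 else ennreal (exp (G d t)))"
  using t
proof (induction n arbitrary: d t)
  case 0
  interpret P: prob_space "env_law p" by (rule prob_space_env)
  have "c ^ d \<le> (1 / s) ^ d" using c by (rule power_mono[rotated])
  also have "\<dots> \<le> exp ((1 + e) * (f s / s) * t) * (1 / s) ^ d"
  proof -
    have "1 \<le> exp ((1 + e) * (f s / s) * t)" using s e 0 pgf_pos[OF s(2)] by simp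
    from mult_right_mono[OF this, of "(1 / s) ^ d"] show ?thesis using s by simp
  qed
  finally have "\<eta> * c ^ d \<le> G d t" unfolding G_def using \<eta> by (simp add: mult_left_mono mult.assoc)
  then show ?case by (simp add: P.emeasure_space_1 ennreal_leI)
next
  case (Suc n)
  interpret P: prob_space "env_law p" by (rule prob_space_env)
  have meas: "Measurable.pred borel (bar d)" for d
    unfolding bar_def G_def by measurable
  let ?b = "\<lambda>d. ennreal (exp (\<eta> * c ^ d))"
  define E where "E d t = (\<integral>\<^sup>+\<xi>. exp_fun bar ?b n d \<xi> t \<partial>env_law p)" for d t
  have [measurable]: "E d \<in> borel_measurable borel" for d
    unfolding E_def by (rule measurable_exp_fun_time[OF meas])
  show ?case
  proof (cases "bar d t")
    case True
    then show ?thesis by simp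
  next
    case False
    define \<mu> where "\<mu> = (1 + e) * (f s / s)"
    have \<mu>: "0 \<le> \<mu>" using e s pgf_pos[OF s(2)] by (simp add: \<mu>_def)
    have G_mono: "G d y \<le> G d t" if "0 \<le> y" "y \<le> t" for y
      unfolding G_def \<mu>_def[symmetric] using that \<mu> \<eta> s
      by (intro mult_right_mono mult_left_mono) (auto intro!: mult_left_mono)
    have G_nonneg: "0 \<le> G d y" for d y unfolding G_def using \<eta> s by simp
    let ?V = "\<lambda>y. exp (G d y)"
    let ?V' = "\<lambda>y. \<mu> * G d y * exp (G d y)"
    let ?\<Phi> = "\<lambda>y. E d y * (\<integral>\<^sup>+k. (if k \<le> d then E (Suc d - k) y else 1) \<partial>measure_pmf p)"
    have "(\<integral>\<^sup>+\<xi>. exp_fun bar ?b (Suc n) d \<xi> t \<partial>env_law p)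
        = (\<integral>\<^sup>+w. (if t < w then ennreal (exp (\<eta> * c ^ d)) else ?\<Phi> (t - w)) \<partial>exp1)"
      unfolding E_def by (rule nn_integral_exp_fun_Suc[where bar = bar, OF meas False])
    also have "\<dots> \<le> ennreal (?V t)"
    proof (rule nn_integral_exp1_step[where V' = ?V'])
      fix y
      have "(G d has_real_derivative \<mu> * G d y) (at y)"
        unfolding G_def \<mu>_def[symmetric] by (auto intro!: derivative_eq_intros)
      then show "(?V has_real_derivative ?V' y) (at y)"
        by (auto intro!: derivative_eq_intros)
    next
      show "0 \<le> ?V y + ?V' y" for y using \<mu> G_nonneg by simp
      show "?\<Phi> y \<le> ennreal (?V y + ?V' y)" if y: "0 \<le> y" "y \<le> t" for y
      proof -
        have "\<not> bar d y" using False G_mono[OF y] by (simp add: bar_def)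
        then have 1: "E d y \<le> ennreal (exp (G d y))"
          using Suc.IH[OF y(1), of d] by (simp add: E_def)
        \<comment> \<open>The bound holds for every k, absorbed and killed children included, so
          that averaging over k gives the full series f s.\<close>
        have 2: "(if k \<le> d then E (Suc d - k) y else 1)
            \<le> ennreal (1 + (1 + e) * (G d y / s) * s ^ k)" for k
        proof (cases "k \<le> d \<and> \<not> bar (Suc d - k) y")
          case True
          then have "E (Suc d - k) y \<le> ennreal (exp (G (Suc d - k) y))"
            using Suc.IH[OF y(1), of "Suc d - k"] by (simp add: E_def)
          also have "exp (G (Suc d - k) y) \<le> 1 + (1 + e) * G (Suc d - k) y"
            using True by (intro \<kappa> G_nonneg) (simp add: bar_def)
          also have "G (Suc d - k) y = G d y / s * s ^ k"
            using scaled_power[OF s(1), of k d] True by (simp add: G_def)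
          finally show ?thesis using True by (simp add: mult.assoc ennreal_leI)
        next
          case F: False
          show ?thesis
          proof (cases "k \<le> d")
            case True
            then have "E (Suc d - k) y \<le> 0"
              using Suc.IH[OF y(1), of "Suc d - k"] F by (simp add: E_def)
            with True show ?thesis by simp
          next
            case False
            have "0 \<le> (1 + e) * (G d y / s) * s ^ k" using e s G_nonneg by simp
            with False show ?thesis by (simp add: ennreal_1[symmetric] ennreal_leI del: ennreal_1)
          qed
        qed
        have "(\<integral>\<^sup>+k. (if k \<le> d then E (Suc d - k) y else 1) \<partial>measure_pmf p)
            \<le> (\<integral>\<^sup>+k. ennreal (1 + (1 + e) * (G d y / s) * s ^ k) \<partial>measure_pmf p)"
          by (rule nn_integral_mono) (rule 2)
        also have "\<dots> = (\<integral>\<^sup>+k. 1 + ennreal ((1 + e) * (G d y / s)) * ennreal (s ^ k) \<partial>measure_pmf p)"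
        proof (rule nn_integral_cong)
          fix k :: nat
          have "0 \<le> (1 + e) * (G d y / s)" "0 \<le> s ^ k" using e s G_nonneg by simp_all
          then show "ennreal (1 + (1 + e) * (G d y / s) * s ^ k)
              = 1 + ennreal ((1 + e) * (G d y / s)) * ennreal (s ^ k)"
            by (simp only: ennreal_mult[symmetric] ennreal_1[symmetric] ennreal_plus[symmetric]
                mult_nonneg_nonneg zero_le_one)
        qed
        also have "\<dots> = 1 + ennreal ((1 + e) * (G d y / s)) * ennreal (f s)"
          using s by (simp add: nn_integral_add nn_integral_cmult nn_integral_pgf measure_pmf.emeasure_space_1)
        also have "\<dots> = ennreal (1 + \<mu> * G d y)"
          using e s G_nonneg[of d y] pgf_pos[OF s(2)]
          by (simp add: ennreal_mult[symmetric] ennreal_plus[symmetric] ennreal_1[symmetric] \<mu>_def mult_ac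
              del: ennreal_1 ennreal_plus)
        finally have "?\<Phi> y \<le> ennreal (exp (G d y)) * ennreal (1 + \<mu> * G d y)"
          by (intro mult_mono 1) auto
        also have "\<dots> = ennreal (?V y + ?V' y)"
          using \<mu> G_nonneg by (simp add: ennreal_mult[symmetric] algebra_simps del: ennreal_plus)
        finally show ?thesis .
      qed
      show "exp (\<eta> * c ^ d) \<le> ?V 0"
        unfolding G_def using power_mono[OF c(2,1), of d] \<eta> by (simp add: mult_left_mono)
      show "?\<Phi> \<in> borel_measurable borel"
        by (intro borel_measurable_times_ennreal measurable_nn_integral_pmf) auto
      show "?V' \<in> borel_measurable borel" unfolding G_def by measurable
    qed (use Suc.prems in auto)
    finally show ?thesis using False by simp
  qed
qed

text \<open>A first-moment bound: C s^-d e^(\<sigma> t) is a supersolution of the linear recursion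
  as soon as f s / s \<le> \<sigma>, and by assumption it is at least 1 on the barrier. The base s
  here need not be the one that defines the barrier.\<close>

lemma crossings_bound:
  fixes s C \<sigma> :: real
  assumes s: "0 < s" "summ s" and \<sigma>: "f s / s \<le> \<sigma>" and C: "0 \<le> C"
    and meas: "\<And>d. Measurable.pred borel (bar d)"
    and bar: "\<And>d t. 0 \<le> t \<Longrightarrow> bar d t \<Longrightarrow> 1 \<le> C * (1 / s) ^ d * exp (\<sigma> * t)"
    and t: "0 \<le> t"
  shows "(\<integral>\<^sup>+\<xi>. crossings bar n d \<xi> t \<partial>env_law p) \<le> ennreal (C * (1 / s) ^ d * exp (\<sigma> * t))"
  using t
proof (induction n arbitrary: d t)
  case 0
  interpret P: prob_space "env_law p" by (rule prob_space_env)
  show ?case using bar[OF 0, of d] by (simp add: P.emeasure_space_1)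
next
  case (Suc n)
  interpret P: prob_space "env_law p" by (rule prob_space_env)
  define E where "E d t = (\<integral>\<^sup>+\<xi>. crossings bar n d \<xi> t \<partial>env_law p)" for d t
  have [measurable]: "E d \<in> borel_measurable borel" for d
    unfolding E_def by (rule measurable_exp_fun_time[OF meas])
  have \<sigma>0: "0 \<le> \<sigma>" using \<sigma> pgf_pos[OF s(2)] s by (smt (verit) divide_nonneg_pos)
  show ?case
  proof (cases "bar d t")
    case True
    with bar[OF Suc.prems True] show ?thesis by (simp add: P.emeasure_space_1)
  next
    case False
    define V where "V = (\<lambda>y. C * (1 / s) ^ d * exp (\<sigma> * y))"
    let ?\<Phi> = "\<lambda>y. E d y + (\<integral>\<^sup>+k. (if k \<le> d then E (Suc d - k) y else 0) \<partial>measure_pmf p)"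
    have V_nonneg: "0 \<le> V y" for y using C s by (simp add: V_def)
    have "(\<integral>\<^sup>+\<xi>. crossings bar (Suc n) d \<xi> t \<partial>env_law p)
        = (\<integral>\<^sup>+w. (if t < w then ennreal 0 else ?\<Phi> (t - w)) \<partial>exp1)"
      unfolding E_def ennreal_0 by (rule nn_integral_crossings_Suc[where bar = bar, OF meas False])
    also have "\<dots> \<le> ennreal (V t)"
    proof (rule nn_integral_exp1_step[where V' = "\<lambda>y. \<sigma> * V y"])
      show "(V has_real_derivative \<sigma> * V y) (at y)" for y
        unfolding V_def by (auto intro!: derivative_eq_intros)
      show "0 \<le> V y + \<sigma> * V y" for y using V_nonneg \<sigma>0 by simp
      show "?\<Phi> y \<le> ennreal (V y + \<sigma> * V y)" if y: "0 \<le> y" "y \<le> t" for y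
      proof -
        have 2: "(if k \<le> d then E (Suc d - k) y else 0) \<le> ennreal (V y / s) * ennreal (s ^ k)" for k
        proof (cases "k \<le> d")
          case True
          have "E (Suc d - k) y \<le> ennreal (C * (1 / s) ^ (Suc d - k) * exp (\<sigma> * y))"
            using Suc.IH[OF y(1)] by (simp add: E_def)
          also have "C * (1 / s) ^ (Suc d - k) * exp (\<sigma> * y) = V y / s * s ^ k"
            using scaled_power[OF s(1) True] by (simp add: V_def)
          finally show ?thesis using True V_nonneg s by (simp add: ennreal_mult[symmetric])
        qed simp
        have "(\<integral>\<^sup>+k. (if k \<le> d then E (Suc d - k) y else 0) \<partial>measure_pmf p)
            \<le> (\<integral>\<^sup>+k. ennreal (V y / s) * ennreal (s ^ k) \<partial>measure_pmf p)"
          by (rule nn_integral_mono) (rule 2)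
        also have "\<dots> = ennreal (V y / s) * ennreal (f s)"
          using s by (simp add: nn_integral_cmult nn_integral_pgf)
        also have "\<dots> = ennreal (V y * (f s / s))"
          using s V_nonneg[of y] pgf_pos[OF s(2)] by (simp add: ennreal_mult[symmetric])
        also have "\<dots> \<le> ennreal (\<sigma> * V y)"
          using \<sigma> V_nonneg[of y] by (intro ennreal_leI) (simp add: mult.commute[of \<sigma>] mult_left_mono del: times_divide_eq_right)
        finally have "?\<Phi> y \<le> ennreal (V y) + ennreal (\<sigma> * V y)"
          using Suc.IH[OF y(1), of d] by (intro add_mono) (simp_all add: E_def V_def)
        then show ?thesis using V_nonneg[of y] \<sigma>0 by (simp add: ennreal_plus)
      qed
      show "?\<Phi> \<in> borel_measurable borel"
        by (intro borel_measurable_add measurable_nn_integral_pmf) auto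
      show "(\<lambda>y. \<sigma> * V y) \<in> borel_measurable borel" unfolding V_def by measurable
    qed (use Suc.prems V_nonneg in auto)
    finally show ?thesis by (simp add: V_def)
  qed
qed

end

lemma weight_sum_eq_exp_fun:
  "exp_fun (\<lambda>_ _. False) (\<lambda>d. ennreal (exp (a * c ^ d))) n d \<xi> t = ennreal (exp (a * weight_sum c n d \<xi> t))"
  by (rule crossings_or_exp_fun) (simp add: crossings_False)

lemma weight_sum_nonneg: "0 \<le> c \<Longrightarrow> 0 \<le> weight_sum c n d \<xi> t"
  by (induction n arbitrary: d \<xi> t) auto

text \<open>The error term of \<open>exp_fun_lower\<close>: its derivative is twice the error for
  one unfolding less, the factor 2 accounting for the two branches at a reproduction.\<close>

lemma power_fact_deriv:
  "((\<lambda>y. (2 * y) ^ Suc n / fact (Suc n)) has_real_derivative 2 * ((2 * y) ^ n / fact n)) (at y)"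
proof -
  have "((\<lambda>y. (2 * y) ^ Suc n / fact (Suc n)) has_real_derivative
      (real (Suc n) * (2 * y) ^ n * 2) / fact (Suc n)) (at y)"
    by (rule derivative_eq_intros refl | simp)+
  moreover have "(real (Suc n) * (2 * y) ^ n * 2) / fact (Suc n) = 2 * ((2 * y) ^ n / fact n)"
    unfolding fact_Suc by (simp add: field_simps del: of_nat_Suc)
  ultimately show ?thesis by (simp only:)
qed

section \<open>Supersolution for the lower bound\<close>

context offspring
begin

text \<open>After n unfoldings the weighted sum may still be far too small, so 1 - G alone cannot be
  a bound; the error term pays for this and is 1 for n = 0. The quadratic term of the equation is
  absorbed by the gap between the rates: with v = 1 - G one has v (1 - \<mu> G) = v - \<mu> v G
  \<le> v - \<mu>' G.\<close>

lemma exp_fun_lower: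
  fixes h :: "nat \<Rightarrow> real" and c m \<eta> \<mu> \<mu>' T :: real
  assumes c: "0 \<le> c" and \<eta>: "0 \<le> \<eta>" and m: "0 \<le> m" and \<mu>: "0 \<le> \<mu>"
    and h: "\<And>d. 0 \<le> h d"
    and super: "\<And>d. \<mu> * h d \<le> (\<Sum>k\<le>d. pmf p k * h (Suc d - k))"
    and start: "\<And>d. exp (- \<eta> * c ^ d) \<le> 1 - m * h d"
  defines "G \<equiv> \<lambda>d y. m * exp (\<mu>' * y) * h d"
  assumes small: "\<And>d y. 0 \<le> y \<Longrightarrow> y \<le> T \<Longrightarrow> G d y \<le> 1 \<and> \<mu>' \<le> \<mu> * (1 - G d y)"
    and t: "0 \<le> t" "t \<le> T"
  shows "(\<integral>\<^sup>+\<xi>. exp_fun (\<lambda>_ _. False) (\<lambda>d. ennreal (exp (- \<eta> * c ^ d))) n d \<xi> t \<partial>env_law p)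
    \<le> ennreal (1 - G d t + (2 * t) ^ n / fact n)"
  using t
proof (induction n arbitrary: d t)
  case 0
  interpret P: prob_space "env_law p" by (rule prob_space_env)
  have "exp (- \<eta> * c ^ d) \<le> 1" using \<eta> c by simp
  moreover have "G d t \<le> 1" using small[OF 0, of d] by simp
  moreover have "(2 * t) ^ 0 / fact 0 = 1" by simp
  ultimately have "exp (- \<eta> * c ^ d) \<le> 1 - G d t + (2 * t) ^ 0 / fact 0" by linarith
  then show ?case by (simp add: P.emeasure_space_1 ennreal_leI)
next
  case (Suc n)
  interpret P: prob_space "env_law p" by (rule prob_space_env)
  let ?b = "\<lambda>d. ennreal (exp (- \<eta> * c ^ d))"
  define E where "E d t = (\<integral>\<^sup>+\<xi>. exp_fun (\<lambda>_ _. False) ?b n d \<xi> t \<partial>env_law p)" for d t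
  have [measurable]: "E d \<in> borel_measurable borel" for d
    unfolding E_def by (rule measurable_exp_fun_time) simp
  have E_le_1: "E d y \<le> 1" for d y
  proof -
    have "E d y \<le> (\<integral>\<^sup>+\<xi>. 1 \<partial>env_law p)"
      unfolding E_def weight_sum_eq_exp_fun
      using weight_sum_nonneg[OF c] \<eta> by (intro nn_integral_mono) (simp add: ennreal_le_1)
    then show ?thesis by (simp add: P.emeasure_space_1)
  qed
  let ?V = "\<lambda>y. 1 - G d y + (2 * y) ^ Suc n / fact (Suc n)"
  let ?V' = "\<lambda>y. - \<mu>' * G d y + 2 * ((2 * y) ^ n / fact n)"
  let ?\<Phi> = "\<lambda>y. E d y * (\<integral>\<^sup>+k. (if k \<le> d then E (Suc d - k) y else 1) \<partial>measure_pmf p)"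
  have G_nonneg: "0 \<le> G d y" for d y unfolding G_def using m h by simp
  have key: "?\<Phi> y \<le> ennreal (?V y + ?V' y) \<and> 0 \<le> ?V y + ?V' y" if y: "0 \<le> y" "y \<le> t" for y
  proof -
    have yT: "y \<le> T" using y Suc.prems by simp
    define \<epsilon> where "\<epsilon> = (2 * y) ^ n / fact n"
    define v where "v = 1 - G d y"
    define q where "q k = (if k \<le> d then G (Suc d - k) y else 0)" for k
    define w where "w = 1 - (\<Sum>k\<le>d. pmf p k * G (Suc d - k) y)"
    have \<epsilon>: "0 \<le> \<epsilon>" using y by (simp add: \<epsilon>_def)
    have v: "0 \<le> v" "v \<le> 1" "\<mu>' \<le> \<mu> * v"
      using small[OF y(1) yT, of d] G_nonneg by (auto simp: v_def)
    have q: "0 \<le> q k" "q k \<le> 1" for k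
      using small[OF y(1) yT] G_nonneg by (auto simp: q_def)
    have int_q: "integrable (measure_pmf p) q"
      by (rule measure_pmf.integrable_const_bound[where B = 1]) (use q in \<open>auto intro!: AE_I2\<close>)
    have "(\<integral>k. q k \<partial>measure_pmf p) = (\<Sum>k\<in>{..d}. q k * pmf p k)"
      by (rule integral_measure_pmf_real) (auto simp: q_def split: if_splits)
    also have "\<dots> = (\<Sum>k\<le>d. pmf p k * G (Suc d - k) y)"
      by (rule sum.cong) (auto simp: q_def)
    finally have exp_q: "(\<integral>k. q k \<partial>measure_pmf p) = 1 - w" by (simp add: w_def)
    have w: "0 \<le> w" "w \<le> 1"
    proof -
      have "(\<integral>k. q k \<partial>measure_pmf p) \<le> (\<integral>k. 1 \<partial>measure_pmf p)"
        by (rule integral_mono[OF int_q]) (use q in auto)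
      with exp_q show "0 \<le> w" by simp
      have "0 \<le> (\<integral>k. q k \<partial>measure_pmf p)" by (rule Bochner_Integration.integral_nonneg) (use q in auto)
      with exp_q show "w \<le> 1" by simp
    qed
    \<comment> \<open>The cap at 1 matters: \<epsilon> may be large, and without the cap the product
      would contain \<epsilon>^2, for which the derivative 2 \<epsilon> of the error leaves no
      room.\<close>
    have Ed: "E d y \<le> ennreal (min 1 (v + \<epsilon>))"
      using Suc.IH[of y d] E_le_1[of d y] y(1) yT by (simp add: E_def v_def \<epsilon>_def min_def)
    have "(\<integral>\<^sup>+k. (if k \<le> d then E (Suc d - k) y else 1) \<partial>measure_pmf p)
        \<le> (\<integral>\<^sup>+k. ennreal (1 - q k + \<epsilon>) \<partial>measure_pmf p)"
    proof (rule nn_integral_mono)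
      fix k :: nat
      show "(if k \<le> d then E (Suc d - k) y else 1) \<le> ennreal (1 - q k + \<epsilon>)"
        using Suc.IH[of y "Suc d - k"] y(1) yT \<epsilon> by (auto simp: E_def q_def \<epsilon>_def)
    qed
    also have "\<dots> = ennreal (\<integral>k. (1 - q k + \<epsilon>) \<partial>measure_pmf p)"
      using int_q q \<epsilon> by (intro nn_integral_eq_integral) (auto intro!: AE_I2 add_nonneg_nonneg)
    also have "(\<integral>k. (1 - q k + \<epsilon>) \<partial>measure_pmf p) = w + \<epsilon>"
      using int_q exp_q by simp
    finally have 1: "(\<integral>\<^sup>+k. (if k \<le> d then E (Suc d - k) y else 1) \<partial>measure_pmf p) \<le> ennreal (w + \<epsilon>)" .
    have "?\<Phi> y \<le> ennreal (min 1 (v + \<epsilon>)) * ennreal (w + \<epsilon>)"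
      by (intro mult_mono Ed 1) auto
    also have "\<dots> = ennreal (min 1 (v + \<epsilon>) * (w + \<epsilon>))"
      using v w \<epsilon> by (simp add: ennreal_mult)
    finally have \<Phi>: "?\<Phi> y \<le> ennreal (min 1 (v + \<epsilon>) * (w + \<epsilon>))" .
    have "min 1 (v + \<epsilon>) * (w + \<epsilon>) = min 1 (v + \<epsilon>) * w + min 1 (v + \<epsilon>) * \<epsilon>"
      by (simp add: distrib_left)
    also have "\<dots> \<le> (v + \<epsilon>) * w + 1 * \<epsilon>"
      using w \<epsilon> by (intro add_mono mult_right_mono) auto
    also have "\<dots> \<le> v * w + 2 * \<epsilon>"
      using mult_left_mono[OF w(2) \<epsilon>] by (simp add: algebra_simps)
    finally have 2: "min 1 (v + \<epsilon>) * (w + \<epsilon>) \<le> v * w + 2 * \<epsilon>" .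
    have "\<mu> * G d y = m * exp (\<mu>' * y) * (\<mu> * h d)" by (simp add: G_def mult_ac)
    also have "\<dots> \<le> m * exp (\<mu>' * y) * (\<Sum>k\<le>d. pmf p k * h (Suc d - k))"
      using m by (intro mult_left_mono super) simp
    also have "\<dots> = 1 - w" by (simp add: w_def G_def sum_distrib_left mult_ac)
    finally have "v * w \<le> v * (1 - \<mu> * G d y)" using v by (intro mult_left_mono) auto
    also have "\<dots> = v - (\<mu> * v) * G d y" by (simp add: algebra_simps)
    also have "\<dots> \<le> v - \<mu>' * G d y" using v G_nonneg by (simp add: mult_right_mono)
    finally have 3: "v * w + 2 * \<epsilon> \<le> v - \<mu>' * G d y + 2 * \<epsilon>" by simp
    have 4: "v - \<mu>' * G d y + 2 * \<epsilon> \<le> ?V y + ?V' y"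
      using y by (simp add: v_def \<epsilon>_def)
    have 5: "0 \<le> min 1 (v + \<epsilon>) * (w + \<epsilon>)" using v w \<epsilon> by simp
    show ?thesis
      using order_trans[OF \<Phi> ennreal_leI[OF order_trans[OF 2 order_trans[OF 3 4]]]]
        order_trans[OF 5 order_trans[OF 2 order_trans[OF 3 4]]] by blast
  qed
  have "(\<integral>\<^sup>+\<xi>. exp_fun (\<lambda>_ _. False) ?b (Suc n) d \<xi> t \<partial>env_law p)
      = (\<integral>\<^sup>+w. (if t < w then ennreal (exp (- \<eta> * c ^ d)) else ?\<Phi> (t - w)) \<partial>exp1)"
    unfolding E_def by (rule nn_integral_exp_fun_Suc[where bar = "\<lambda>_ _. False"]) simp_all
  also have "\<dots> \<le> ennreal (?V t)"
  proof (rule nn_integral_exp1_step[where V' = ?V'])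
    fix y
    have "(G d has_real_derivative \<mu>' * G d y) (at y)"
      unfolding G_def by (auto intro!: derivative_eq_intros)
    from DERIV_add[OF DERIV_diff[OF DERIV_const this] power_fact_deriv]
    show "(?V has_real_derivative ?V' y) (at y)" by simp
  next
    show "exp (- \<eta> * c ^ d) \<le> ?V 0" using start[of d] by (simp add: G_def)
    show "?\<Phi> \<in> borel_measurable borel"
      by (intro borel_measurable_times_ennreal measurable_nn_integral_pmf) auto
    show "?V' \<in> borel_measurable borel" unfolding G_def by measurable
  qed (use key Suc.prems in auto)
  finally show ?case .
qed

end

section \<open>PageRank as a weighted count of vertices\<close>

text \<open>The root is put at an arbitrary depth d because the subtree of a child starts at a
  positive depth, from which its particles may still move towards depth 0. Unlike
  \<open>root_dist\<close>, this recursion does not refer to paths and is compatible with the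
  splitting.\<close>

primrec depth_from :: "nat \<Rightarrow> environment \<Rightarrow> vertex \<Rightarrow> nat" where
  "depth_from d \<xi> [] = d"
| "depth_from d \<xi> (k # v) = Suc (depth_from d \<xi> v) - jump \<xi> v k"

primrec exists_from :: "nat \<Rightarrow> environment \<Rightarrow> vertex \<Rightarrow> bool" where
  "exists_from d \<xi> [] \<longleftrightarrow> True"
| "exists_from d \<xi> (k # v) \<longleftrightarrow> exists_from d \<xi> v \<and> jump \<xi> v k \<le> depth_from d \<xi> v"

definition vertex_weight :: "real \<Rightarrow> nat \<Rightarrow> environment \<Rightarrow> real \<Rightarrow> vertex \<Rightarrow> real" where
  "vertex_weight c d \<xi> t v = (if exists_from d \<xi> v \<and> birth_time \<xi> v \<le> t then c ^ depth_from d \<xi> v else 0)"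

text \<open>The vertices that n applications of the recursion of \<open>weight_sum\<close> can
  reach. The root is left out of the \<open>later\<close> part because it is the same vertex before
  and after its first reproduction.\<close>

primrec explored :: "nat \<Rightarrow> vertex set" where
  "explored 0 = {[]}"
| "explored (Suc n) = insert [] ((\<lambda>w. w @ [0]) ` explored n \<union> later ` (explored n - {[]}))"

abbreviation proper :: "environment \<Rightarrow> bool" where
  "proper \<xi> \<equiv> \<forall>v k. 0 \<le> waiting \<xi> v k"

lemma env_shift_simps:
  "child_env \<xi> (v, k) = \<xi> (v @ [0], k)"
  "rest_env \<xi> ([], k) = \<xi> ([], Suc k)"
  "v \<noteq> [] \<Longrightarrow> rest_env \<xi> (v, k) = \<xi> (later v, k)"
  by (simp_all add: child_env_def rest_env_def child_idx.simps rest_idx.simps)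

lemma later_simps: "later [k] = [Suc k]" "v \<noteq> [] \<Longrightarrow> later (k # v) = k # later v"
  by (simp_all add: later.simps)

lemma child_from:
  "depth_from d \<xi> (w @ [0]) = depth_from (Suc d - jump \<xi> [] 0) (child_env \<xi>) w"
  "exists_from d \<xi> (w @ [0]) \<longleftrightarrow> jump \<xi> [] 0 \<le> d \<and> exists_from (Suc d - jump \<xi> [] 0) (child_env \<xi>) w"
  "birth_time \<xi> (w @ [0]) = waiting \<xi> [] 0 + birth_time (child_env \<xi>) w"
  by (induction w) (auto simp: env_shift_simps)

lemma rest_from:
  assumes "v \<noteq> []"
  shows "depth_from d \<xi> (later v) = depth_from d (rest_env \<xi>) v"
    and "exists_from d \<xi> (later v) \<longleftrightarrow> exists_from d (rest_env \<xi>) v"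
    and "birth_time \<xi> (later v) = waiting \<xi> [] 0 + birth_time (rest_env \<xi>) v"
proof -
  have "depth_from d \<xi> (later v) = depth_from d (rest_env \<xi>) v \<and>
    (exists_from d \<xi> (later v) \<longleftrightarrow> exists_from d (rest_env \<xi>) v) \<and>
    birth_time \<xi> (later v) = waiting \<xi> [] 0 + birth_time (rest_env \<xi>) v"
    using assms
  proof (induction v)
    case (Cons k v)
    show ?case
    proof (cases "v = []")
      case True
      then show ?thesis by (simp add: later_simps env_shift_simps sum.atMost_Suc_shift del: sum.atMost_Suc)
    next
      case False
      with Cons.IH show ?thesis by (simp add: later_simps env_shift_simps)
    qed
  qed simp
  then show "depth_from d \<xi> (later v) = depth_from d (rest_env \<xi>) v"
    and "exists_from d \<xi> (later v) \<longleftrightarrow> exists_from d (rest_env \<xi>) v"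
    and "birth_time \<xi> (later v) = waiting \<xi> [] 0 + birth_time (rest_env \<xi>) v" by auto
qed

lemma birth_time_nonneg: "proper \<xi> \<Longrightarrow> 0 \<le> birth_time \<xi> v"
  by (induction v) (auto intro!: add_nonneg_nonneg sum_nonneg)

lemma proper_child: "proper \<xi> \<Longrightarrow> proper (child_env \<xi>)"
  by (simp add: env_shift_simps)

lemma proper_rest: "proper \<xi> \<Longrightarrow> proper (rest_env \<xi>)"
proof (intro allI)
  fix v k assume "proper \<xi>"
  then show "0 \<le> waiting (rest_env \<xi>) v k" by (cases "v = []") (simp_all add: env_shift_simps)
qed

lemma finite_explored: "finite (explored n)"
  by (induction n) auto

lemma sum_explored_Suc:
  "(\<Sum>v\<in>explored (Suc n). g v) = g [] + (\<Sum>w\<in>explored n. g (w @ [0])) + (\<Sum>v\<in>explored n - {[]}. g (later v))"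
  for g :: "vertex \<Rightarrow> real"
proof -
  have "inj_on later (explored n - {[]})" by (auto simp: inj_on_def later_inj)
  moreover have "inj_on (\<lambda>w :: vertex. w @ [0]) (explored n)" by (auto simp: inj_on_def)
  moreover have "(\<lambda>w. w @ [0]) ` explored n \<inter> later ` (explored n - {[]}) = {}"
    by (auto simp: later_ne later_ne[symmetric])
  moreover have "[] \<notin> (\<lambda>w. w @ [0]) ` explored n \<union> later ` (explored n - {[]})"
    by (auto simp: later_ne later_ne[symmetric])
  ultimately show ?thesis
    by (simp add: finite_explored sum.union_disjoint sum.reindex del: later.simps)
qed

lemma weight_sum_eq:
  assumes "proper \<xi>" "0 \<le> t"
  shows "weight_sum c n d \<xi> t = (\<Sum>v\<in>explored n. vertex_weight c d \<xi> t v)"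
  using assms
proof (induction n arbitrary: d \<xi> t)
  case 0
  then show ?case by (simp add: vertex_weight_def)
next
  case (Suc n)
  let ?w = "waiting \<xi> [] 0"
  have root: "vertex_weight c d \<xi> t [] = c ^ d" using Suc.prems by (simp add: vertex_weight_def)
  show ?case
  proof (cases "t < ?w")
    case True
    have "vertex_weight c d \<xi> t (w @ [0]) = 0" for w
      using birth_time_nonneg[OF proper_child[OF Suc.prems(1)], of w] True
      by (simp add: vertex_weight_def child_from)
    moreover have "vertex_weight c d \<xi> t (later v) = 0" if "v \<noteq> []" for v
      using birth_time_nonneg[OF proper_rest[OF Suc.prems(1)], of v] True that
      by (simp add: vertex_weight_def rest_from)
    ultimately show ?thesis using True by (simp add: sum_explored_Suc root del: explored.simps)
  next
    case False
    then have t: "0 \<le> t - ?w" by simp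
    have child: "vertex_weight c d \<xi> t (w @ [0]) = (if jump \<xi> [] 0 \<le> d
        then vertex_weight c (Suc d - jump \<xi> [] 0) (child_env \<xi>) (t - ?w) w else 0)" for w
      by (auto simp: vertex_weight_def child_from)
    have rest: "vertex_weight c d \<xi> t (later v) = vertex_weight c d (rest_env \<xi>) (t - ?w) v" if "v \<noteq> []" for v
      using that by (auto simp: vertex_weight_def rest_from)
    have "(\<Sum>v\<in>explored n - {[]}. vertex_weight c d \<xi> t (later v))
        = (\<Sum>v\<in>explored n - {[]}. vertex_weight c d (rest_env \<xi>) (t - ?w) v)"
      by (rule sum.cong) (auto simp: rest)
    moreover have "vertex_weight c d (rest_env \<xi>) (t - ?w) [] = c ^ d"
      using t by (simp add: vertex_weight_def)
    moreover have "[] \<in> explored n" by (cases n) auto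
    ultimately have "c ^ d + (\<Sum>v\<in>explored n - {[]}. vertex_weight c d \<xi> t (later v))
        = weight_sum c n d (rest_env \<xi>) (t - ?w)"
      using Suc.IH[OF proper_rest[OF Suc.prems(1)] t] by (simp add: sum.remove[OF finite_explored])
    moreover have "(\<Sum>w\<in>explored n. vertex_weight c d \<xi> t (w @ [0])) = (if jump \<xi> [] 0 \<le> d
        then weight_sum c n (Suc d - jump \<xi> [] 0) (child_env \<xi>) (t - ?w) else 0)"
      using Suc.IH[OF proper_child[OF Suc.prems(1)] t] by (simp add: child)
    ultimately show ?thesis using False
      by (simp add: sum_explored_Suc root del: explored.simps)
  qed
qed

lemma explored_mono: "explored n \<subseteq> explored (Suc n)"
  by (induction n) auto

text \<open>Appending 0 and raising the last entry each add exactly one to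
  \<open>sum_list (map Suc v)\<close>, so this many unfoldings reach v.\<close>

lemma in_explored: "v \<in> explored (sum_list (map Suc v))"
proof (induction "sum_list (map Suc v)" arbitrary: v rule: less_induct)
  case less
  show ?case
  proof (cases v rule: vertex_cases)
    case 1
    then show ?thesis by simp
  next
    case (2 w)
    then show ?thesis using less[of w] by simp
  next
    case (3 w)
    have "sum_list (map Suc (later w)) = Suc (sum_list (map Suc w))"
      using \<open>w \<noteq> []\<close> by (cases w rule: rev_cases) (auto simp: later.simps)
    with 3 show ?thesis using less[of w] by simp
  qed
qed

section \<open>Directed paths and their starting vertices\<close>

lemma length_root_path: "length (root_path \<xi> v) = Suc (root_dist \<xi> v)"
  unfolding root_dist_def by (cases v) auto

lemma root_dist_eq: "root_dist \<xi> v = depth_from 0 \<xi> v"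
proof (induction v)
  case (Cons k v)
  have "root_dist \<xi> (k # v) = length (root_path \<xi> v) - jump \<xi> v k"
    by (simp add: root_dist_def)
  with Cons show ?case by (simp add: length_root_path)
qed (simp add: root_dist_def)

lemma exists_vertex_eq: "exists_vertex \<xi> v = exists_from 0 \<xi> v"
  by (induction v) (auto simp: root_dist_eq)

lemma hd_root_path: "hd (root_path \<xi> v) = v"
  by (cases v) auto

text \<open>Names record who reproduced, not who the parent is, so it takes an argument that the
  tail of a root path is the root path of the ancestor where it starts. The number j is arbitrary in
  the induction because the path of k # v continues inside that of v, offset by the jump.\<close>

lemma drop_root_path:
  "exists_vertex \<xi> v \<Longrightarrow> j \<le> root_dist \<xi> v \<Longrightarrow> drop j (root_path \<xi> v) = root_path \<xi> (root_path \<xi> v ! j)"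
proof (induction v arbitrary: j)
  case Nil
  then show ?case by (simp add: root_dist_def)
next
  case (Cons k v)
  show ?case
  proof (cases j)
    case (Suc i)
    have "i + jump \<xi> v k \<le> root_dist \<xi> v"
      using Cons.prems Suc by (simp add: root_dist_eq)
    moreover have "jump \<xi> v k \<le> length (root_path \<xi> v)"
      using Cons.prems by (simp add: length_root_path)
    moreover have "exists_vertex \<xi> v" using Cons.prems by simp
    ultimately have "drop (i + jump \<xi> v k) (root_path \<xi> v) = root_path \<xi> (root_path \<xi> v ! (i + jump \<xi> v k))"
      using Cons.IH by blast
    then show ?thesis using \<open>jump \<xi> v k \<le> length _\<close> Suc by (simp add: add.commute)
  qed simp
qed

lemma last_root_path: "exists_vertex \<xi> v \<Longrightarrow> last (root_path \<xi> v) = []"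
  by (induction v) (auto simp: length_root_path)

lemma tree_verts_Cons: "proper \<xi> \<Longrightarrow> k # v \<in> tree_verts \<xi> t \<Longrightarrow> v \<in> tree_verts \<xi> t"
  using sum_nonneg[of "{..k}" "\<lambda>i. waiting \<xi> v i"] by (auto simp: tree_verts_def)

lemma set_root_path: "proper \<xi> \<Longrightarrow> v \<in> tree_verts \<xi> t \<Longrightarrow> set (root_path \<xi> v) \<subseteq> tree_verts \<xi> t"
proof (induction v)
  case (Cons k v)
  then have "set (root_path \<xi> v) \<subseteq> tree_verts \<xi> t" using tree_verts_Cons by blast
  with Cons.prems show ?case using set_drop_subset[of "jump \<xi> v k" "root_path \<xi> v"] by auto
qed simp

lemma successively_drop: "successively P xs \<Longrightarrow> successively P (drop n xs)"
  by (metis append_take_drop_id successively_append_iff)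

lemma successively_root_path:
  "proper \<xi> \<Longrightarrow> v \<in> tree_verts \<xi> t \<Longrightarrow> successively (\<lambda>x y. (x, y) \<in> tree_edges \<xi> t) (root_path \<xi> v)"
proof (induction v)
  case (Cons k v)
  have v: "v \<in> tree_verts \<xi> t" using Cons.prems tree_verts_Cons by blast
  have j: "jump \<xi> v k \<le> root_dist \<xi> v" using Cons.prems by (simp add: tree_verts_def)
  have "hd (drop (jump \<xi> v k) (root_path \<xi> v)) = root_path \<xi> v ! jump \<xi> v k"
    using j by (simp add: hd_drop_conv_nth length_root_path)
  moreover have "(k # v, root_path \<xi> v ! jump \<xi> v k) \<in> tree_edges \<xi> t"
    using Cons.prems by (auto simp: tree_edges_def)
  ultimately show ?case
    using successively_drop[OF Cons.IH[OF Cons.prems(1) v]] by (simp add: successively_Cons)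
qed simp

text \<open>A vertex other than the root has exactly one outgoing edge and the root has none, so a
  path to the root is determined by its first vertex.\<close>

lemma directed_path_unique:
  assumes "xs \<noteq> []" "last xs = []" "set xs \<subseteq> tree_verts \<xi> t"
    and "successively (\<lambda>x y. (x, y) \<in> tree_edges \<xi> t) xs"
  shows "xs = root_path \<xi> (hd xs)"
  using assms
proof (induction xs)
  case (Cons x xs)
  show ?case
  proof (cases "xs = []")
    case True
    with Cons.prems show ?thesis by simp
  next
    case False
    then have IH: "xs = root_path \<xi> (hd xs)" and e: "(x, hd xs) \<in> tree_edges \<xi> t"
      using Cons by (auto simp: successively_Cons)
    from e obtain k v where x: "x = k # v" "k # v \<in> tree_verts \<xi> t" "hd xs = root_path \<xi> v ! jump \<xi> v k"
      by (auto simp: tree_edges_def)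
    then have "drop (jump \<xi> v k) (root_path \<xi> v) = root_path \<xi> (hd xs)"
      by (simp add: drop_root_path tree_verts_def)
    with IH x show ?thesis by simp
  qed
qed simp

lemma directed_paths_eq:
  assumes "proper \<xi>"
  shows "directed_paths_to_root \<xi> t l = root_path \<xi> ` {v \<in> tree_verts \<xi> t. root_dist \<xi> v = l}"
proof (intro set_eqI iffI)
  fix xs assume xs: "xs \<in> directed_paths_to_root \<xi> t l"
  then have ne: "xs \<noteq> []" by (auto simp: directed_paths_to_root_def)
  have eq: "xs = root_path \<xi> (hd xs)"
    using xs ne by (intro directed_path_unique[of xs \<xi> t]) (auto simp: directed_paths_to_root_def)
  have "length xs = Suc l" using xs by (simp add: directed_paths_to_root_def)
  then have "root_dist \<xi> (hd xs) = l" using eq length_root_path[of \<xi> "hd xs"] by simp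
  moreover have "hd xs \<in> tree_verts \<xi> t"
    using xs ne by (auto simp: directed_paths_to_root_def)
  ultimately show "xs \<in> root_path \<xi> ` {v \<in> tree_verts \<xi> t. root_dist \<xi> v = l}"
    using eq by blast
next
  fix xs assume "xs \<in> root_path \<xi> ` {v \<in> tree_verts \<xi> t. root_dist \<xi> v = l}"
  then obtain v where v: "xs = root_path \<xi> v" "v \<in> tree_verts \<xi> t" "root_dist \<xi> v = l" by blast
  then show "xs \<in> directed_paths_to_root \<xi> t l"
    using set_root_path[OF assms v(2)] successively_root_path[OF assms v(2)] last_root_path[of \<xi> v]
    by (simp add: directed_paths_to_root_def length_root_path tree_verts_def)
qed

lemma num_paths_eq:
  assumes "proper \<xi>"
  shows "num_paths \<xi> t l = emeasure (count_space UNIV) {v \<in> tree_verts \<xi> t. root_dist \<xi> v = l}"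
proof -
  have "inj (root_path \<xi>)" by (metis hd_root_path injI)
  then have "inj_on (root_path \<xi>) {v \<in> tree_verts \<xi> t. root_dist \<xi> v = l}"
    by (rule inj_on_subset) simp
  then show ?thesis
    unfolding num_paths_def directed_paths_eq[OF assms]
    by (simp add: emeasure_count_space finite_image_iff card_image)
qed

text \<open>Paths correspond to their starting vertices, so PageRank is (1 - c) times the sum of
  c^depth over all vertices, the summand 1 being the root. The sets \<open>explored n\<close>
  increase to all vertices, and monotone convergence gives the supremum.\<close>

lemma pagerank_eq:
  assumes \<xi>: "proper \<xi>" and t: "0 \<le> t" and c: "0 \<le> c"
  shows "pagerank c (\<xi>, t) = ennreal (1 - c) * (SUP n. ennreal (weight_sum c n 0 \<xi> t))"
proof -
  let ?C = "count_space (UNIV :: vertex set)"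
  let ?A = "\<lambda>l. {v \<in> tree_verts \<xi> t. root_dist \<xi> v = Suc l}"
  have weight: "ennreal (vertex_weight c 0 \<xi> t v)
      = indicator {[]} v + (\<Sum>l. ennreal (c ^ Suc l) * indicator (?A l) v)" for v
  proof -
    have vw: "vertex_weight c 0 \<xi> t v = (if v \<in> tree_verts \<xi> t then c ^ root_dist \<xi> v else 0)"
      by (simp add: vertex_weight_def tree_verts_def exists_vertex_eq root_dist_eq)
    consider "v = []" | "v \<notin> tree_verts \<xi> t" | k u where "v = k # u" "v \<in> tree_verts \<xi> t"
      by (cases v) auto
    then show ?thesis
    proof cases
      case 1
      then show ?thesis using t by (simp add: vertex_weight_def root_dist_def)
    next
      case 2
      moreover from this have "v \<noteq> []" using t by (auto simp: tree_verts_def)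
      ultimately show ?thesis by (simp add: vw)
    next
      case (3 k u)
      \<comment> \<open>Only the root has depth 0: a child exists only if its jump is at most the
        depth of the reproducing vertex.\<close>
      then have "root_dist \<xi> v \<noteq> 0" by (simp add: tree_verts_def root_dist_eq)
      then obtain m where m: "root_dist \<xi> v = Suc m" by (cases "root_dist \<xi> v") auto
      have "(\<Sum>l. ennreal (c ^ Suc l) * indicator (?A l) v)
          = (\<Sum>l\<in>{m}. ennreal (c ^ Suc l) * indicator (?A l) v)"
        by (rule suminf_finite) (auto simp: m)
      moreover have "v \<noteq> []" using 3 by simp
      ultimately show ?thesis using 3(2) m by (simp only: vw) simp
    qed
  qed
  have "1 + (\<Sum>l. ennreal (c ^ Suc l) * num_paths \<xi> t (Suc l))
      = (\<integral>\<^sup>+v. indicator {[]} v \<partial>?C) + (\<Sum>l. \<integral>\<^sup>+v. ennreal (c ^ Suc l) * indicator (?A l) v \<partial>?C)"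
    by (simp add: num_paths_eq[OF \<xi>] nn_integral_cmult)
  also have "\<dots> = (\<integral>\<^sup>+v. ennreal (vertex_weight c 0 \<xi> t v) \<partial>?C)"
    unfolding weight by (simp add: nn_integral_suminf nn_integral_add)
  also have "\<dots> = (\<integral>\<^sup>+v. (SUP n. ennreal (vertex_weight c 0 \<xi> t v) * indicator (explored n) v) \<partial>?C)"
  proof (rule nn_integral_cong)
    fix v
    show "ennreal (vertex_weight c 0 \<xi> t v)
        = (SUP n. ennreal (vertex_weight c 0 \<xi> t v) * indicator (explored n) v)"
    proof (rule antisym)
      show "ennreal (vertex_weight c 0 \<xi> t v)
          \<le> (SUP n. ennreal (vertex_weight c 0 \<xi> t v) * indicator (explored n) v)"
        by (rule SUP_upper2[of "sum_list (map Suc v)"]) (simp_all add: in_explored)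
    qed (auto intro!: SUP_least simp: indicator_def)
  qed
  also have "\<dots> = (SUP n. \<integral>\<^sup>+v. ennreal (vertex_weight c 0 \<xi> t v) * indicator (explored n) v \<partial>?C)"
  proof (rule nn_integral_monotone_convergence_SUP)
    show "incseq (\<lambda>n v. ennreal (vertex_weight c 0 \<xi> t v) * indicator (explored n) v)"
      using explored_mono by (intro incseq_SucI le_funI) (auto split: split_indicator)
  qed simp
  also have "\<dots> = (SUP n. ennreal (weight_sum c n 0 \<xi> t))"
    using c by (simp add: nn_integral_indicator_finite finite_explored weight_sum_eq[OF \<xi> t]
        vertex_weight_def sum_ennreal)
  finally show ?thesis by (simp add: pagerank_def)
qed

lemma AE_proper: "AE \<xi> in env_law p. proper \<xi>"
proof -
  interpret N: prob_space "exp1 \<Otimes>\<^sub>M measure_pmf p" by (rule prob_space_mark)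
  interpret product_prob_space "\<lambda>_. exp1 \<Otimes>\<^sub>M measure_pmf p" "UNIV :: (vertex \<times> nat) set" ..
  interpret E: prob_space exp1 by (rule prob_space_exp1)
  have "AE w in exp1. 0 \<le> w"
    by (subst AE_density) (auto simp: exponential_density_def)
  then have "AE w in distr (exp1 \<Otimes>\<^sub>M measure_pmf p) exp1 fst. 0 \<le> w"
    by (simp only: measure_pmf.distr_pair_fst)
  then have "AE x in exp1 \<Otimes>\<^sub>M measure_pmf p. 0 \<le> fst x"
    by (rule AE_distrD[OF measurable_fst])
  then have "AE \<xi> in env_law p. 0 \<le> waiting \<xi> v k" for v k
    by (intro AE_component) auto
  then show ?thesis by (simp add: AE_all_countable)
qed

section \<open>Tail bounds at an exponential time\<close>

lemma measurable_root_path [measurable]: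
  "(\<lambda>\<xi>. root_path \<xi> v) \<in> measurable (env_law p) (count_space UNIV)"
proof (induction v)
  case (Cons k v)
  have "(\<lambda>\<xi>. (k # v) # drop j (root_path \<xi> v)) \<in> measurable (env_law p) (count_space UNIV)" for j
    by (rule measurable_compose[OF Cons]) simp
  then have "(\<lambda>\<xi>. (k # v) # drop (jump \<xi> v k) (root_path \<xi> v)) \<in> measurable (env_law p) (count_space UNIV)"
    by (rule measurable_compose_countable[where f = "\<lambda>j \<xi>. (k # v) # drop j (root_path \<xi> v)"]) measurable
  then show ?case by simp
qed simp

lemma measurable_root_dist [measurable]:
  "(\<lambda>\<xi>. root_dist \<xi> v) \<in> measurable (env_law p) (count_space UNIV)"
  unfolding root_dist_def by measurable

lemma measurable_exists_vertex [measurable]: "Measurable.pred (env_law p) (\<lambda>\<xi>. exists_vertex \<xi> v)"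
proof (induction v)
  case (Cons k v)
  note Cons[measurable]
  have "Measurable.pred (env_law p) (\<lambda>\<xi>. exists_vertex \<xi> v \<and> jump \<xi> v k \<le> root_dist \<xi> v)"
    by measurable
  then show ?case by simp
qed simp

lemma measurable_birth_time [measurable]: "(\<lambda>\<xi>. birth_time \<xi> v) \<in> borel_measurable (env_law p)"
  by (induction v) simp_all

lemma measurable_tree_verts:
  "Measurable.pred (env_law p \<Otimes>\<^sub>M exp1) (\<lambda>x. v \<in> tree_verts (fst x) (snd x))"
  unfolding tree_verts_def mem_Collect_eq by measurable

lemma measurable_tree_edges:
  "Measurable.pred (env_law p \<Otimes>\<^sub>M exp1) (\<lambda>x. (u, v) \<in> tree_edges (fst x) (snd x))"
proof (cases u)
  case Nil
  then show ?thesis by (simp add: tree_edges_def)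
next
  case (Cons k w)
  have "Measurable.pred (env_law p) (\<lambda>\<xi>. v = root_path \<xi> w ! j)" for j
    by measurable
  then have "Measurable.pred (env_law p) (\<lambda>\<xi>. v = root_path \<xi> w ! jump \<xi> w k)"
    by (rule measurable_compose_countable[where f = "\<lambda>j \<xi>. v = root_path \<xi> w ! j"]) measurable
  then have [measurable]: "Measurable.pred (env_law p \<Otimes>\<^sub>M exp1) (\<lambda>x. v = root_path (fst x) w ! jump (fst x) w k)"
    by (rule measurable_compose[OF measurable_fst])
  have [measurable]: "Measurable.pred (env_law p \<Otimes>\<^sub>M exp1) (\<lambda>x. u \<in> tree_verts (fst x) (snd x))"
    by (rule measurable_tree_verts)
  have "(u, v) \<in> tree_edges \<xi> t \<longleftrightarrow> u \<in> tree_verts \<xi> t \<and> v = root_path \<xi> w ! jump \<xi> w k" for \<xi> t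
    using Cons by (auto simp: tree_edges_def)
  then show ?thesis by simp
qed

lemma measurable_num_paths:
  "(\<lambda>x. num_paths (fst x) (snd x) l) \<in> borel_measurable (env_law p \<Otimes>\<^sub>M exp1)"
proof -
  let ?M = "env_law p \<Otimes>\<^sub>M exp1"
  note [measurable] = measurable_tree_verts measurable_tree_edges
  have pred: "Measurable.pred ?M (\<lambda>x. xs \<in> directed_paths_to_root (fst x) (snd x) l)" for xs
  proof -
    have "xs \<in> directed_paths_to_root \<xi> t l \<longleftrightarrow> length xs = Suc l \<and> last xs = [] \<and>
        (\<forall>v. v \<in> set xs \<longrightarrow> v \<in> tree_verts \<xi> t) \<and>
        (\<forall>i. Suc i < length xs \<longrightarrow> (xs ! i, xs ! Suc i) \<in> tree_edges \<xi> t)" for \<xi> t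
      by (auto simp: directed_paths_to_root_def successively_conv_nth)
    then show ?thesis by simp
  qed
  have "(\<lambda>x. indicator (directed_paths_to_root (fst x) (snd x) l) xs :: ennreal) \<in> borel_measurable ?M" for xs
    unfolding indicator_def using pred[of xs] by measurable
  then have ind: "(\<lambda>y. indicator (directed_paths_to_root (fst (fst y)) (snd (fst y)) l) xs :: ennreal)
      \<in> borel_measurable (?M \<Otimes>\<^sub>M count_space UNIV)" for xs
    by (rule measurable_compose[OF measurable_fst])
  have "(\<lambda>(x, xs). indicator (directed_paths_to_root (fst x) (snd x) l) xs :: ennreal)
      \<in> borel_measurable (?M \<Otimes>\<^sub>M count_space UNIV)"
    unfolding split_beta'
    by (rule measurable_compose_countable[where f = "\<lambda>xs y. indicator (directed_paths_to_root (fst (fst y)) (snd (fst y)) l) xs", OF ind])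
       measurable
  then have "(\<lambda>x. \<integral>\<^sup>+xs. indicator (directed_paths_to_root (fst x) (snd x) l) xs \<partial>count_space UNIV) \<in> borel_measurable ?M"
    by (intro sigma_finite_measure.borel_measurable_nn_integral sigma_finite_measure_count_space) simp
  then show ?thesis unfolding num_paths_def by simp
qed

lemma measurable_pagerank: "pagerank c \<in> borel_measurable (pagerank_space p)"
proof -
  note [measurable] = measurable_num_paths
  show ?thesis unfolding pagerank_def pagerank_space_def split_beta' by measurable
qed

text \<open>Without barrier and for a = 1 the multiplicative functional, already known to be
  measurable, is the exponential of the weighted sum.\<close>

lemma measurable_weight_sum: "(\<lambda>\<xi>. weight_sum c n d \<xi> t) \<in> borel_measurable (env_law p)"
proof -
  have "(\<lambda>\<xi>. exp_fun (\<lambda>_ _. False) (\<lambda>d. ennreal (exp (1 * c ^ d))) n d \<xi> t) \<in> borel_measurable (env_law p)"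
    by (rule measurable_branch_fun_env[where bar = "\<lambda>_ _. False" and opr = "(*)", OF _ measurable_ops(1)]) simp
  then have [measurable]: "(\<lambda>\<xi>. ennreal (exp (1 * weight_sum c n d \<xi> t))) \<in> borel_measurable (env_law p)"
    unfolding weight_sum_eq_exp_fun .
  have "(\<lambda>\<xi>. enn2real (ennreal (exp (1 * weight_sum c n d \<xi> t)))) \<in> borel_measurable (env_law p)"
    by measurable
  from borel_measurable_ln[OF this] show ?thesis by simp
qed

lemma weight_sum_mono: "0 \<le> c \<Longrightarrow> weight_sum c n d \<xi> t \<le> weight_sum c (Suc n) d \<xi> t"
proof (induction n arbitrary: d \<xi> t)
  case 0
  then show ?case by simp
next
  case (Suc n)
  show ?case
    using Suc.IH[OF Suc.prems, of d "rest_env \<xi>" "t - waiting \<xi> [] 0"]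
      Suc.IH[OF Suc.prems, of "Suc d - jump \<xi> [] 0" "child_env \<xi>" "t - waiting \<xi> [] 0"]
    by (simp only: weight_sum.simps(2)[of c "Suc n"] weight_sum.simps(2)[of c n] split: if_split) auto
qed

section \<open>Conditioning on the exponential time\<close>

definition hit_prob :: "nat pmf \<Rightarrow> real \<Rightarrow> real \<Rightarrow> real \<Rightarrow> ennreal" where
  "hit_prob p c r t = emeasure (env_law p) {\<xi> \<in> space (env_law p). ennreal r \<le> pagerank c (\<xi>, t)}"

lemma pagerank_tail_eq: "ennreal (pagerank_tail p c r) = (\<integral>\<^sup>+t. hit_prob p c r t \<partial>exp1)"
proof -
  interpret E: prob_space exp1 by (rule prob_space_exp1)
  interpret P: prob_space "env_law p" by (rule prob_space_env)
  interpret PP: pair_prob_space "env_law p" exp1 ..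
  let ?A = "{\<omega> \<in> space (env_law p \<Otimes>\<^sub>M exp1). ennreal r \<le> pagerank c \<omega>}"
  have [measurable]: "pagerank c \<in> borel_measurable (env_law p \<Otimes>\<^sub>M exp1)"
    using measurable_pagerank[of c p] by (simp add: pagerank_space_def)
  have A: "?A \<in> sets (env_law p \<Otimes>\<^sub>M exp1)" by measurable
  have "ennreal (pagerank_tail p c r) = emeasure (env_law p \<Otimes>\<^sub>M exp1) ?A"
    by (simp add: pagerank_tail_def pagerank_space_def PP.emeasure_eq_measure)
  also have "\<dots> = (\<integral>\<^sup>+t. emeasure (env_law p) ((\<lambda>\<xi>. (\<xi>, t)) -` ?A) \<partial>exp1)"
    by (rule PP.emeasure_pair_measure_alt2[OF A])
  also have "\<dots> = (\<integral>\<^sup>+t. hit_prob p c r t \<partial>exp1)"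
    unfolding hit_prob_def
    by (intro nn_integral_cong arg_cong[where f = "emeasure (env_law p)"]) (auto simp: space_pair_measure)
  finally show ?thesis .
qed

lemma hit_prob_le_1: "hit_prob p c r t \<le> 1"
proof -
  interpret P: prob_space "env_law p" by (rule prob_space_env)
  show ?thesis unfolding hit_prob_def by (rule P.emeasure_le_1)
qed

lemma measurable_pagerank_section: "(\<lambda>\<xi>. pagerank c (\<xi>, t)) \<in> borel_measurable (env_law p)"
proof -
  have 1: "(\<lambda>\<xi>. (\<xi>, t)) \<in> measurable (env_law p) (env_law p \<Otimes>\<^sub>M exp1)"
    by (intro measurable_Pair measurable_const) simp_all
  show ?thesis
    using measurable_compose[OF 1 measurable_pagerank[unfolded pagerank_space_def, of c p]] by simp
qed

text \<open>PageRank at least r forces the supremum of the weighted sums to be at least r / (1 - c),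
  which is strictly larger than r. So some finite n already reaches r, and a bound uniform in n
  passes to the increasing union of events.\<close>

lemma hit_prob_upper:
  assumes c: "0 < c" "c < 1" and r: "0 < r" and t: "0 \<le> t"
    and U: "\<And>n. emeasure (env_law p) {\<xi> \<in> space (env_law p). r \<le> weight_sum c n 0 \<xi> t} \<le> U"
  shows "hit_prob p c r t \<le> U"
proof -
  let ?B = "\<lambda>n. {\<xi> \<in> space (env_law p). r \<le> weight_sum c n 0 \<xi> t}"
  note [measurable] = measurable_weight_sum measurable_pagerank_section
  have B: "?B n \<in> sets (env_law p)" for n by measurable
  have "AE \<xi> in env_law p. ennreal r \<le> pagerank c (\<xi>, t) \<longrightarrow> \<xi> \<in> (\<Union>n. ?B n)"
    using AE_proper AE_space
  proof eventually_elim
    case (elim \<xi>)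
    show ?case
    proof
      assume "ennreal r \<le> pagerank c (\<xi>, t)"
      then have le: "ennreal r \<le> ennreal (1 - c) * (SUP n. ennreal (weight_sum c n 0 \<xi> t))"
        using pagerank_eq[OF elim(1) t, of c] c by simp
      have "\<exists>n. r \<le> weight_sum c n 0 \<xi> t"
      proof (rule ccontr)
        assume "\<not> ?thesis"
        then have "(SUP n. ennreal (weight_sum c n 0 \<xi> t)) \<le> ennreal r"
          by (intro SUP_least ennreal_leI) (auto simp: not_le less_imp_le)
        then have "ennreal r \<le> ennreal (1 - c) * ennreal r"
          using order_trans[OF le mult_left_mono] by simp
        also have "\<dots> = ennreal ((1 - c) * r)" using c r by (simp add: ennreal_mult')
        finally have "r \<le> (1 - c) * r" using c r by (simp add: ennreal_le_iff)
        moreover have "0 < c * r" using c r by simp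
        ultimately show False by (simp add: algebra_simps)
      qed
      then show "\<xi> \<in> (\<Union>n. ?B n)" using elim(2) by auto
    qed
  qed
  then have "hit_prob p c r t \<le> emeasure (env_law p) (\<Union>n. ?B n)"
    unfolding hit_prob_def using B by (intro emeasure_mono_AE) (auto elim: eventually_mono)
  also have "\<dots> = (SUP n. emeasure (env_law p) (?B n))"
  proof (rule SUP_emeasure_incseq[symmetric])
    show "incseq ?B" using c
      by (intro incseq_SucI) (auto intro: order_trans[OF _ weight_sum_mono] simp del: weight_sum.simps)
  qed (use B in auto)
  also have "\<dots> \<le> U" by (rule SUP_least) (rule U)
  finally show ?thesis .
qed

lemma hit_prob_lower:
  assumes c: "0 < c" "c < 1" and r: "0 < r" and t: "0 \<le> t"
  shows "emeasure (env_law p) {\<xi> \<in> space (env_law p). r / (1 - c) \<le> weight_sum c n 0 \<xi> t} \<le> hit_prob p c r t"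
proof -
  note [measurable] = measurable_weight_sum measurable_pagerank_section
  have "AE \<xi> in env_law p. r / (1 - c) \<le> weight_sum c n 0 \<xi> t \<longrightarrow> ennreal r \<le> pagerank c (\<xi>, t)"
    using AE_proper
  proof eventually_elim
    case (elim \<xi>)
    show ?case
    proof
      assume "r / (1 - c) \<le> weight_sum c n 0 \<xi> t"
      then have "r \<le> (1 - c) * weight_sum c n 0 \<xi> t" using c by (simp add: field_simps)
      then have "ennreal r \<le> ennreal (1 - c) * ennreal (weight_sum c n 0 \<xi> t)"
        using c by (simp add: ennreal_mult'[symmetric] ennreal_leI)
      also have "\<dots> \<le> ennreal (1 - c) * (SUP n. ennreal (weight_sum c n 0 \<xi> t))"
        by (intro mult_left_mono SUP_upper) auto
      also have "\<dots> = pagerank c (\<xi>, t)" using pagerank_eq[OF elim t, of c] c by simp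
      finally show "ennreal r \<le> pagerank c (\<xi>, t)" .
    qed
  qed
  then show ?thesis
    unfolding hit_prob_def by (intro emeasure_mono_AE) (auto elim: eventually_mono)
qed

lemma nn_integral_exp1_exp:
  assumes "b < 1" "0 \<le> K"
  shows "(\<integral>\<^sup>+t. ennreal (K * exp (b * t)) \<partial>exp1) = ennreal (K / (1 - b))"
proof -
  have "(\<integral>\<^sup>+t. ennreal (K * exp (b * t)) \<partial>exp1)
      = (\<integral>\<^sup>+t. ennreal (exponential_density 1 t) * ennreal (K * exp (b * t)) \<partial>lborel)"
    by (subst nn_integral_density) (auto simp: exponential_density_nonneg)
  also have "\<dots> = (\<integral>\<^sup>+t. ennreal (K * exp (- (1 - b) * t)) * indicator {0..} t \<partial>lborel)"
    using assms by (intro nn_integral_cong)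
      (auto simp: exponential_density_def ennreal_mult[symmetric] exp_add[symmetric] algebra_simps split: split_indicator)
  also have "\<dots> = ennreal (0 - (- (K / (1 - b)) * exp (- (1 - b) * 0)))"
  proof (rule nn_integral_FTC_atLeast[where F = "\<lambda>t. - (K / (1 - b)) * exp (- (1 - b) * t)"])
    have "filterlim (\<lambda>t. - ((1 - b) * t)) at_bot at_top"
      using assms by (intro filterlim_compose[OF filterlim_uminus_at_bot_at_top]
        filterlim_tendsto_pos_mult_at_top[OF tendsto_const] filterlim_ident) auto
    then have "((\<lambda>t. exp (- (1 - b) * t)) \<longlongrightarrow> 0) at_top"
      using filterlim_compose[OF exp_at_bot, of "\<lambda>t. - ((1 - b) * t)"] by (simp only: mult_minus_left)
    from tendsto_mult[OF tendsto_const[of "- (K / (1 - b))"] this]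
    show "((\<lambda>t. - (K / (1 - b)) * exp (- (1 - b) * t)) \<longlongrightarrow> 0) at_top" by simp
    show "((\<lambda>t. - (K / (1 - b)) * exp (- (1 - b) * t)) has_real_derivative K * exp (- (1 - b) * t)) (at t)" for t
    proof -
      have "((\<lambda>t. - (K / q) * exp (- q * t)) has_real_derivative K * exp (- q * t)) (at t)" if "0 < q" for q
        using that by (auto intro!: derivative_eq_intros)
      from this[of "1 - b"] assms show ?thesis by simp
    qed
  qed (use assms in auto)
  finally show ?thesis by simp
qed

lemma exp_le_linear:
  fixes e :: real
  assumes "0 < e"
  obtains \<kappa> where "0 < \<kappa>" "\<And>x. 0 \<le> x \<Longrightarrow> x \<le> \<kappa> \<Longrightarrow> exp x \<le> 1 + (1 + e) * x"
proof
  show "0 < min 1 e" using assms by simp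
  fix x :: real assume x: "0 \<le> x" "x \<le> min 1 e"
  then have "exp x \<le> 1 + x + x\<^sup>2" by (intro exp_bound) auto
  also have "x\<^sup>2 \<le> e * x" using x by (simp add: power2_eq_square mult_right_mono)
  finally show "exp x \<le> 1 + (1 + e) * x" by (simp add: algebra_simps)
qed

section \<open>From growth rates to tail bounds\<close>

context offspring
begin

text \<open>On the barrier e^(\<mu> t) s^-d exceeds \<rho>, with \<mu> = (1 + e) f s / s; raising
  this to the power \<theta> gives the crossing weight \<rho>^-\<theta> s1^-d e^(\<sigma> t), which
  is at least 1 there. Without a crossing, Markov's inequality for the exponential functional with
  parameter \<eta> = \<kappa> / \<rho> applies, its mean being at most e^\<kappa>. The exponent a
  admits \<sigma> \<ge> 1: min 1 x \<le> x^a, and e^(a \<sigma> t) is integrable against the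
  exponential time.\<close>

lemma tail_upper_explicit:
  fixes c s s1 e \<kappa> \<theta> \<sigma> a \<rho> r :: real
  assumes c: "0 < c" "c < 1" "c \<le> 1 / s" and s: "0 < s" "summ s" and e: "0 < e"
    and s1: "0 < s1" "summ s1" "s1 \<le> s powr \<theta>" "f s1 / s1 \<le> \<sigma>"
    and \<theta>: "0 < \<theta>" "\<theta> * ((1 + e) * (f s / s)) \<le> \<sigma>"
    and a: "0 < a" "a \<le> 1" "a * \<sigma> < 1"
    and \<kappa>: "0 < \<kappa>" "\<And>x. 0 \<le> x \<Longrightarrow> x \<le> \<kappa> \<Longrightarrow> exp x \<le> 1 + (1 + e) * x"
    and \<rho>: "0 < \<rho>" and r: "0 < r"
  shows "pagerank_tail p c r \<le> \<rho> powr (- (a * \<theta>)) / (1 - a * \<sigma>) + exp (\<kappa> - \<kappa> / \<rho> * r)"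
proof -
  interpret P: prob_space "env_law p" by (rule prob_space_env)
  interpret E: prob_space exp1 by (rule prob_space_exp1)
  define \<mu> where "\<mu> = (1 + e) * (f s / s)"
  define \<eta> where "\<eta> = \<kappa> / \<rho>"
  define G where "G = (\<lambda>d t. \<eta> * exp ((1 + e) * (f s / s) * t) * (1 / s) ^ d)"
  define bar where "bar = (\<lambda>d t. \<kappa> < G d t)"
  define C where "C = \<rho> powr (- \<theta>)"
  have \<eta>: "0 < \<eta>" using \<kappa> \<rho> by (simp add: \<eta>_def)
  have C: "0 < C" using \<rho> by (simp add: C_def)
  have meas: "Measurable.pred borel (bar d)" for d
    unfolding bar_def G_def by measurable
  have bar: "1 \<le> C * (1 / s1) ^ d * exp (\<sigma> * t)" if "0 \<le> t" "bar d t" for d t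
  proof -
    have "\<kappa> * 1 < \<kappa> * (inverse \<rho> * exp (\<mu> * t) * (1 / s) ^ d)"
      using that(2) by (simp add: bar_def G_def \<mu>_def \<eta>_def field_simps)
    then have 1: "1 < inverse \<rho> * exp (\<mu> * t) * (1 / s) ^ d"
      using \<kappa>(1) by (simp only: mult_less_cancel_left_pos)
    have "1 \<le> (inverse \<rho> * exp (\<mu> * t) * (1 / s) ^ d) powr \<theta>"
      using 1 \<theta> by (simp add: ge_one_powr_ge_zero)
    also have "\<dots> = C * exp (\<theta> * \<mu> * t) * (1 / (s powr \<theta>)) ^ d"
    proof -
      have "((1 / s) ^ d) powr \<theta> = (1 / (s powr \<theta>)) ^ d"
        using s by (simp add: powr_realpow[symmetric] powr_powr powr_divide mult.commute)
      moreover have "(inverse \<rho>) powr \<theta> = C"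
        using \<rho> by (simp add: C_def powr_minus powr_divide inverse_eq_divide)
      moreover have "exp (\<mu> * t) powr \<theta> = exp (\<theta> * \<mu> * t)"
        by (simp add: powr_def mult_ac)
      ultimately show ?thesis using \<rho> s by (simp add: powr_mult)
    qed
    also have "\<dots> \<le> C * exp (\<sigma> * t) * (1 / s1) ^ d"
    proof (intro mult_mono)
      show "exp (\<theta> * \<mu> * t) \<le> exp (\<sigma> * t)"
        using mult_right_mono[OF \<theta>(2)[folded \<mu>_def] that(1)] by simp
      show "(1 / s powr \<theta>) ^ d \<le> (1 / s1) ^ d"
        using s1 s by (intro power_mono divide_left_mono) auto
    qed (use C s in auto)
    finally show ?thesis by (simp add: mult_ac)
  qed
  have fixed: "emeasure (env_law p) {\<xi> \<in> space (env_law p). r \<le> weight_sum c n 0 \<xi> t}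
      \<le> ennreal (C * exp (\<sigma> * t)) + ennreal (exp (\<kappa> - \<eta> * r))" if t: "0 \<le> t" for n t
  proof -
    let ?b = "\<lambda>d. ennreal (exp (\<eta> * c ^ d))"
    let ?D = "\<lambda>\<xi>. crossings bar n 0 \<xi> t" and ?Y = "\<lambda>\<xi>. exp_fun bar ?b n 0 \<xi> t"
    have [measurable]: "?D \<in> borel_measurable (env_law p)" "?Y \<in> borel_measurable (env_law p)"
      using measurable_branch_fun_env[where bar = bar and opr = "(+)", OF meas measurable_ops(2)]
        measurable_branch_fun_env[where bar = bar and opr = "(*)", OF meas measurable_ops(1)] by blast+
    note [measurable] = measurable_weight_sum
    let ?A = "{\<xi> \<in> space (env_law p). r \<le> weight_sum c n 0 \<xi> t}"
    have "emeasure (env_law p) ?A = (\<integral>\<^sup>+\<xi>. indicator ?A \<xi> \<partial>env_law p)"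
      by (rule nn_integral_indicator[symmetric]) measurable
    also have "\<dots> \<le> (\<integral>\<^sup>+\<xi>. ?D \<xi> + ennreal (exp (- \<eta> * r)) * ?Y \<xi> \<partial>env_law p)"
    proof (rule nn_integral_mono)
      fix \<xi>
      show "indicator ?A \<xi> \<le> ?D \<xi> + ennreal (exp (- \<eta> * r)) * ?Y \<xi>"
      proof (cases "\<xi> \<in> ?A \<and> ?D \<xi> < 1")
        case True
        then have r_le: "r \<le> weight_sum c n 0 \<xi> t" by simp
        have "?Y \<xi> = ennreal (exp (\<eta> * weight_sum c n 0 \<xi> t))"
          using True by (intro crossings_or_exp_fun) simp
        then have "ennreal (exp (- \<eta> * r)) * ?Y \<xi> = ennreal (exp (\<eta> * (weight_sum c n 0 \<xi> t - r)))"
          by (simp add: ennreal_mult[symmetric] exp_add[symmetric] algebra_simps)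
        moreover have "1 \<le> exp (\<eta> * (weight_sum c n 0 \<xi> t - r))"
          using r_le \<eta> by simp
        ultimately have "1 \<le> ennreal (exp (- \<eta> * r)) * ?Y \<xi>"
          by (simp add: ennreal_ge_1)
        then show ?thesis using True by (simp add: add_increasing)
      next
        case False
        then consider "\<xi> \<notin> ?A" | "1 \<le> ?D \<xi>" by fastforce
        then show ?thesis
        proof cases
          case 1
          then have "indicator ?A \<xi> = (0 :: ennreal)" by (rule indicator_simps(2))
          then show ?thesis by (simp only: zero_le)
        next
          case 2
          have "indicator ?A \<xi> \<le> (1 :: ennreal)" by (simp add: indicator_def)
          also note 2
          also have "?D \<xi> \<le> ?D \<xi> + ennreal (exp (- \<eta> * r)) * ?Y \<xi>" by simp
          finally show ?thesis .
        qed
      qed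
    qed
    also have "\<dots> = (\<integral>\<^sup>+\<xi>. ?D \<xi> \<partial>env_law p) + ennreal (exp (- \<eta> * r)) * (\<integral>\<^sup>+\<xi>. ?Y \<xi> \<partial>env_law p)"
      by (simp add: nn_integral_add nn_integral_cmult)
    also have "(\<integral>\<^sup>+\<xi>. ?D \<xi> \<partial>env_law p) \<le> ennreal (C * (1 / s1) ^ 0 * exp (\<sigma> * t))"
      using C by (intro crossings_bound[OF s1(1,2,4) _ meas bar t]) auto
    also have "(\<integral>\<^sup>+\<xi>. ?Y \<xi> \<partial>env_law p) \<le> ennreal (exp \<kappa>)"
    proof -
      have "(\<integral>\<^sup>+\<xi>. ?Y \<xi> \<partial>env_law p) \<le> (if bar 0 t then 0 else ennreal (exp (G 0 t)))"
        unfolding bar_def G_def using s e \<eta> c \<kappa> t by (intro exp_fun_bound) auto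
      also have "\<dots> \<le> ennreal (exp \<kappa>)" by (auto simp: bar_def intro!: ennreal_leI)
      finally show ?thesis .
    qed
    finally have "emeasure (env_law p) ?A
        \<le> ennreal (C * exp (\<sigma> * t)) + ennreal (exp (- \<eta> * r)) * ennreal (exp \<kappa>)"
      by (simp add: add_mono mult_left_mono)
    also have "ennreal (exp (- \<eta> * r)) * ennreal (exp \<kappa>) = ennreal (exp (\<kappa> - \<eta> * r))"
      by (simp add: ennreal_mult[symmetric] exp_add[symmetric])
    finally show ?thesis .
  qed
  have hit: "hit_prob p c r t \<le> ennreal (C powr a * exp (a * \<sigma> * t)) + ennreal (exp (\<kappa> - \<eta> * r))"
    if t: "0 \<le> t" for t
  proof (cases "C * exp (\<sigma> * t) \<le> 1")
    case True
    have "C * exp (\<sigma> * t) \<le> (C * exp (\<sigma> * t)) powr a"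
      using powr_mono'[of a 1 "C * exp (\<sigma> * t)"] a C True by simp
    also have "\<dots> = C powr a * exp (a * \<sigma> * t)"
      using C by (simp add: powr_mult) (simp add: powr_def mult_ac)
    finally have "ennreal (C * exp (\<sigma> * t)) + ennreal (exp (\<kappa> - \<eta> * r))
        \<le> ennreal (C powr a * exp (a * \<sigma> * t)) + ennreal (exp (\<kappa> - \<eta> * r))"
      by (intro add_mono ennreal_leI) auto
    with hit_prob_upper[OF c(1,2) r t fixed[OF t]] show ?thesis by (rule order_trans)
  next
    case False
    then have "1 \<le> (C * exp (\<sigma> * t)) powr a" using a by (intro ge_one_powr_ge_zero) auto
    also have "\<dots> = C powr a * exp (a * \<sigma> * t)"
      using C by (simp add: powr_mult) (simp add: powr_def mult_ac)
    finally have "1 \<le> ennreal (C powr a * exp (a * \<sigma> * t))" by (simp only: ennreal_ge_1)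
    with hit_prob_le_1[of p c r t] have "hit_prob p c r t \<le> ennreal (C powr a * exp (a * \<sigma> * t))"
      by (rule order_trans)
    then show ?thesis by (rule order_trans) simp
  qed
  have "ennreal (pagerank_tail p c r) = (\<integral>\<^sup>+t. hit_prob p c r t \<partial>exp1)"
    by (rule pagerank_tail_eq)
  also have "\<dots> \<le> (\<integral>\<^sup>+t. ennreal (C powr a * exp (a * \<sigma> * t)) + ennreal (exp (\<kappa> - \<eta> * r)) \<partial>exp1)"
  proof (rule nn_integral_mono_AE)
    have "AE t in exp1. 0 \<le> t" by (subst AE_density) (auto simp: exponential_density_def)
    then show "AE t in exp1. hit_prob p c r t \<le> ennreal (C powr a * exp (a * \<sigma> * t)) + ennreal (exp (\<kappa> - \<eta> * r))"
      by eventually_elim (rule hit)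
  qed
  also have "\<dots> = (\<integral>\<^sup>+t. ennreal (C powr a * exp (a * \<sigma> * t)) \<partial>exp1) + ennreal (exp (\<kappa> - \<eta> * r))"
    using E.emeasure_space_1 by (subst nn_integral_add) auto
  also have "(\<integral>\<^sup>+t. ennreal (C powr a * exp (a * \<sigma> * t)) \<partial>exp1) = ennreal (C powr a / (1 - a * \<sigma>))"
    using a by (intro nn_integral_exp1_exp) auto
  also have "\<dots> + ennreal (exp (\<kappa> - \<eta> * r)) = ennreal (C powr a / (1 - a * \<sigma>) + exp (\<kappa> - \<eta> * r))"
    using a by (simp add: ennreal_plus)
  finally have "pagerank_tail p c r \<le> C powr a / (1 - a * \<sigma>) + exp (\<kappa> - \<eta> * r)"
    using a by (subst (asm) ennreal_le_iff) auto
  moreover have "C powr a = \<rho> powr (- (a * \<theta>))" by (simp add: C_def powr_powr mult.commute)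
  ultimately show ?thesis by (simp add: \<eta>_def)
qed

lemma tail_upper:
  fixes c s s1 e \<theta> \<sigma> a \<beta> :: real
  assumes c: "0 < c" "c < 1" "c \<le> 1 / s" and s: "0 < s" "summ s" and e: "0 < e"
    and s1: "0 < s1" "summ s1" "s1 \<le> s powr \<theta>" "f s1 / s1 \<le> \<sigma>"
    and \<theta>: "0 < \<theta>" "\<theta> * ((1 + e) * (f s / s)) \<le> \<sigma>"
    and a: "0 < a" "a \<le> 1" "a * \<sigma> < 1"
    and \<beta>: "0 < \<beta>" "\<beta> < a * \<theta>"
  obtains K where "0 < K" "eventually (\<lambda>r. pagerank_tail p c r \<le> K * r powr (- \<beta>)) at_top"
proof -
  obtain \<kappa> where \<kappa>: "0 < \<kappa>" "\<And>x. 0 \<le> x \<Longrightarrow> x \<le> \<kappa> \<Longrightarrow> exp x \<le> 1 + (1 + e) * x"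
    using exp_le_linear[OF e] by blast
  \<comment> \<open>With \<rho> = r^(1 - \<epsilon>) the crossing term is a multiple of r^-\<beta>,
    while the exponential term decays like exp (- \<kappa> r^\<epsilon>).\<close>
  define \<epsilon> where "\<epsilon> = 1 - \<beta> / (a * \<theta>)"
  have \<epsilon>: "0 < \<epsilon>" using \<beta> a \<theta> by (simp add: \<epsilon>_def field_simps)
  have \<epsilon>': "(1 - \<epsilon>) * (a * \<theta>) = \<beta>" using a \<theta> by (simp add: \<epsilon>_def)
  have "eventually (\<lambda>r. exp (\<kappa> - \<kappa> * r powr \<epsilon>) \<le> r powr (- \<beta>)) at_top"
    using \<kappa>(1) \<epsilon> \<beta> by real_asymp
  then have "eventually (\<lambda>r. pagerank_tail p c r \<le> (1 / (1 - a * \<sigma>) + 1) * r powr (- \<beta>)) at_top"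
    using eventually_gt_at_top[of 0]
  proof eventually_elim
    case (elim r)
    define \<rho> where "\<rho> = r powr (1 - \<epsilon>)"
    have \<rho>: "0 < \<rho>" using elim by (simp add: \<rho>_def)
    have "\<kappa> / \<rho> * r = \<kappa> * r powr \<epsilon>"
      using elim by (simp add: \<rho>_def powr_diff)
    moreover have "\<rho> powr (- (a * \<theta>)) = r powr (- \<beta>)"
      using \<epsilon>' by (simp add: \<rho>_def powr_powr)
    ultimately have "pagerank_tail p c r \<le> r powr (- \<beta>) / (1 - a * \<sigma>) + exp (\<kappa> - \<kappa> * r powr \<epsilon>)"
      using tail_upper_explicit[OF c s e s1 \<theta> a \<kappa> \<rho>, of r] elim by simp
    also have "\<dots> \<le> r powr (- \<beta>) / (1 - a * \<sigma>) + r powr (- \<beta>)" using elim by simp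
    finally show ?case by (simp add: algebra_simps)
  qed
  moreover have "0 < 1 / (1 - a * \<sigma>) + 1" using a by (simp add: add_pos_pos)
  ultimately show ?thesis by (intro that)
qed

text \<open>The exponential time falls into [T - 1, T] with probability at least e^-T, which is a
  multiple of r^(-1/\<mu>') if e^(\<mu>' T) = N r. At such a time the weighted sum reaches r / (1 -
  c) with probability at least \<alpha> / 2, uniformly in r, by Markov's inequality for its Laplace
  transform.\<close>

lemma tail_lower:
  fixes h :: "nat \<Rightarrow> real" and c \<kappa> \<mu> \<mu>' :: real
  assumes c: "0 < c" "c < 1" and \<mu>: "0 < \<mu>'" "\<mu>' < \<mu>"
    and h: "\<And>d. 0 \<le> h d" "0 < h 0" and \<kappa>: "0 < \<kappa>" "\<And>d. h d \<le> \<kappa> * c ^ d"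
    and super: "\<And>d. \<mu> * h d \<le> (\<Sum>k\<le>d. pmf p k * h (Suc d - k))"
  obtains K where "0 < K" "eventually (\<lambda>r. K * r powr (- (1 / \<mu>')) \<le> pagerank_tail p c r) at_top"
proof -
  interpret P: prob_space "env_law p" by (rule prob_space_env)
  \<comment> \<open>Keeping G below \<omega> ensures \<mu>' \<le> \<mu> (1 - G), as
    \<open>exp_fun_lower\<close> requires.\<close>
  define \<omega> where "\<omega> = 1 - \<mu>' / \<mu>"
  have \<omega>: "0 < \<omega>" "\<omega> < 1" using \<mu> by (auto simp: \<omega>_def)
  \<comment> \<open>A lower bound for G 0 y on the whole window [T - 1, T], whose length costs the
    factor exp (- \<mu>').\<close>
  define \<alpha> where "\<alpha> = \<omega> * h 0 / (2 * \<kappa>) * exp (- \<mu>')"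
  have \<alpha>: "0 < \<alpha>" using \<omega> h \<kappa> by (simp add: \<alpha>_def)
  have \<alpha>1: "\<alpha> < 1"
  proof -
    have "h 0 / (2 * \<kappa>) \<le> 1 / 2" using \<kappa>(2)[of 0] \<kappa>(1) by (simp add: field_simps)
    then have "\<omega> * (h 0 / (2 * \<kappa>)) * exp (- \<mu>') \<le> 1 * (1 / 2) * 1"
      using \<omega> h(1)[of 0] \<kappa>(1) \<mu> by (intro mult_mono) auto
    then show ?thesis by (simp add: \<alpha>_def)
  qed
  \<comment> \<open>Makes r / (1 - c) equal to \<alpha> / (4 \<eta>), a level at which the Laplace
    bound 1 - 3 \<alpha> / 4 is still below e^(-\<alpha> / 4).\<close>
  define N where "N = 4 * \<omega> / (\<alpha> * (1 - c))"
  have N: "0 < N" using \<omega> \<alpha> c by (simp add: N_def)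
  define K where "K = \<alpha> / 2 * N powr (- (1 / \<mu>'))"
  have K: "0 < K" using \<alpha> N by (simp add: K_def)
  have main: "K * r powr (- (1 / \<mu>')) \<le> pagerank_tail p c r" if r: "0 < r" and big: "1 \<le> ln (N * r) / \<mu>'" for r
  proof -
    define T where "T = ln (N * r) / \<mu>'"
    have T: "1 \<le> T" using big by (simp add: T_def)
    have eT: "exp (\<mu>' * T) = N * r" using N r \<mu> by (simp add: T_def)
    define \<eta> where "\<eta> = \<omega> * exp (- \<mu>' * T)"
    have \<eta>: "0 < \<eta>" "\<eta> \<le> 1" using \<omega> \<mu> T by (auto simp: \<eta>_def intro!: mult_le_one)
    \<comment> \<open>The factor 2 makes room for e^-x \<le> 1 - x / 2, valid on [0, 1], which gives
      the comparison at time 0.\<close>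
    define m where "m = \<eta> / (2 * \<kappa>)"
    have m: "0 \<le> m" using \<eta> \<kappa> by (simp add: m_def)
    define G where "G = (\<lambda>d y. m * exp (\<mu>' * y) * h d)"
    have mh: "m * h d \<le> \<eta> * c ^ d / 2" for d
      using mult_left_mono[OF \<kappa>(2)[of d], of m] m \<kappa>(1) \<eta> by (simp add: m_def field_simps)
    have small: "G d y \<le> 1 \<and> \<mu>' \<le> \<mu> * (1 - G d y)" if y: "0 \<le> y" "y \<le> T" for d y
    proof -
      have "G d y = exp (\<mu>' * y) * (m * h d)" by (simp add: G_def)
      also have "\<dots> \<le> exp (\<mu>' * T) * (\<eta> * 1 / 2)"
      proof (intro mult_mono)
        have "\<eta> * c ^ d / 2 \<le> \<eta> * 1 / 2"
          using \<eta> c by (intro divide_right_mono mult_left_mono power_le_one) auto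
        then show "m * h d \<le> \<eta> * 1 / 2" using mh[of d] by simp
      qed (use y \<mu> m h in auto)
      also have "\<dots> = \<omega> / 2" by (simp add: \<eta>_def exp_minus field_simps)
      finally have G: "G d y \<le> \<omega>" using \<omega> by simp
      have "\<mu>' = \<mu> * (1 - \<omega>)" using \<mu> by (simp add: \<omega>_def)
      also have "\<dots> \<le> \<mu> * (1 - G d y)" using G \<mu> by (intro mult_left_mono) auto
      finally show ?thesis using G \<omega> by simp
    qed
    have start: "exp (- \<eta> * c ^ d) \<le> 1 - m * h d" for d
    proof -
      define x where "x = \<eta> * c ^ d"
      have x: "0 \<le> x" "x \<le> 1" using \<eta> c by (auto simp: x_def intro!: mult_le_one power_le_one)
      have "1 + x \<le> exp x" by (rule exp_ge_add_one_self)
      then have "exp (- x) \<le> 1 / (1 + x)" using x by (simp add: exp_minus field_simps)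
      also have "\<dots> \<le> 1 - x / 2"
      proof -
        have "x * x \<le> x" using x by (simp add: mult_left_le)
        then have "1 \<le> (1 - x / 2) * (1 + x)" by (simp add: algebra_simps)
        then show ?thesis using x by (simp add: pos_divide_le_eq)
      qed
      finally show ?thesis using mh[of d] by (simp add: x_def)
    qed
    have "(\<lambda>n. (2 * T) ^ n / fact n) \<longlonglongrightarrow> 0"
      using power_tendsto_0_iff summable_LIMSEQ_zero[OF summable_exp[of "2 * T"]] by (simp add: field_simps)
    then have "eventually (\<lambda>n. (2 * T) ^ n / fact n < \<alpha> / 4) sequentially"
      using \<alpha> by (intro order_tendstoD) auto
    then obtain n where n: "(2 * T) ^ n / fact n < \<alpha> / 4"
      using eventually_happens'[OF sequentially_bot] by blast
    have rK: "r / (1 - c) = \<alpha> / 4 / \<eta>"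
    proof -
      have "\<alpha> / 4 / \<eta> = \<alpha> / (4 * \<omega>) * exp (\<mu>' * T)" by (simp add: \<eta>_def exp_minus field_simps)
      also have "\<dots> = \<alpha> / (4 * \<omega>) * N * r" by (simp add: eT)
      also have "\<alpha> / (4 * \<omega>) * N = 1 / (1 - c)" using \<omega> \<alpha> by (simp add: N_def)
      finally show ?thesis by simp
    qed
    have hit: "ennreal (\<alpha> / 2) \<le> hit_prob p c r y" if y: "T - 1 \<le> y" "y \<le> T" for y
    proof -
      note [measurable] = measurable_weight_sum
      have y0: "0 \<le> y" using y T by simp
      let ?A = "{\<xi> \<in> space (env_law p). r / (1 - c) \<le> weight_sum c n 0 \<xi> y}"
      let ?Y = "\<lambda>\<xi>. exp_fun (\<lambda>_ _. False) (\<lambda>d. ennreal (exp (- \<eta> * c ^ d))) n 0 \<xi> y"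
      have A: "?A \<in> sets (env_law p)" by measurable
      have "\<alpha> \<le> G 0 y"
      proof -
        have "\<alpha> = \<omega> * h 0 / (2 * \<kappa>) * exp (- \<mu>')" by (simp add: \<alpha>_def)
        also have "\<dots> \<le> \<omega> * h 0 / (2 * \<kappa>) * exp (\<mu>' * (y - T))"
          using \<omega> h(2) \<kappa>(1) \<mu> mult_left_mono[of "-1" "y - T" \<mu>'] y by (intro mult_left_mono) auto
        also have "\<dots> = G 0 y" by (simp add: G_def m_def \<eta>_def exp_diff exp_minus right_diff_distrib field_simps)
        finally show ?thesis .
      qed
      moreover have "(2 * y) ^ n / fact n \<le> (2 * T) ^ n / fact n"
        using y y0 by (intro divide_right_mono power_mono) auto
      ultimately have le: "1 - G 0 y + (2 * y) ^ n / fact n \<le> 1 - 3 / 4 * \<alpha>" using n by linarith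
      have "emeasure (env_law p) (space (env_law p) - ?A) * ennreal (exp (- (\<alpha> / 4)))
          = (\<integral>\<^sup>+\<xi>. ennreal (exp (- (\<alpha> / 4))) * indicator (space (env_law p) - ?A) \<xi> \<partial>env_law p)"
        using A by (subst nn_integral_cmult_indicator) (auto simp: mult.commute)
      also have "\<dots> \<le> (\<integral>\<^sup>+\<xi>. ?Y \<xi> \<partial>env_law p)"
      proof (rule nn_integral_mono)
        fix \<xi>
        show "ennreal (exp (- (\<alpha> / 4))) * indicator (space (env_law p) - ?A) \<xi> \<le> ?Y \<xi>"
        proof (cases "\<xi> \<in> space (env_law p) - ?A")
          case True
          then have "weight_sum c n 0 \<xi> y < \<alpha> / 4 / \<eta>" using rK by auto
          then have "\<eta> * weight_sum c n 0 \<xi> y \<le> \<alpha> / 4" using \<eta> by (simp add: field_simps)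
          then have "exp (- (\<alpha> / 4)) \<le> exp (- \<eta> * weight_sum c n 0 \<xi> y)" by simp
          then show ?thesis
            unfolding weight_sum_eq_exp_fun indicator_simps(1)[OF True] by (simp add: ennreal_leI)
        next
          case False
          then have "indicator (space (env_law p) - ?A) \<xi> = (0 :: ennreal)" by (rule indicator_simps(2))
          then show ?thesis by (simp only: mult_zero_right zero_le)
        qed
      qed
      also have "\<dots> \<le> ennreal (1 - G 0 y + (2 * y) ^ n / fact n)"
        unfolding G_def using c \<eta> m \<mu> h small[unfolded G_def] start super y y0
        by (intro exp_fun_lower[where T = T and \<mu> = \<mu>]) auto
      also have "\<dots> \<le> ennreal (1 - 3 / 4 * \<alpha>)" by (rule ennreal_leI) (rule le)
      finally have "ennreal (measure (env_law p) (space (env_law p) - ?A) * exp (- (\<alpha> / 4))) \<le> ennreal (1 - 3 / 4 * \<alpha>)"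
        by (simp add: P.emeasure_eq_measure ennreal_mult)
      moreover have "0 \<le> 1 - 3 / 4 * \<alpha>" using \<alpha>1 by simp
      ultimately have "measure (env_law p) (space (env_law p) - ?A) * exp (- (\<alpha> / 4)) \<le> 1 - 3 / 4 * \<alpha>"
        by (simp add: ennreal_le_iff)
      also have "\<dots> \<le> (1 - \<alpha> / 2) * (1 - \<alpha> / 4)"
        using zero_le_square[of \<alpha>] by (simp add: algebra_simps)
      also have "\<dots> \<le> (1 - \<alpha> / 2) * exp (- (\<alpha> / 4))"
        using \<alpha>1 exp_ge_add_one_self[of "- (\<alpha> / 4)"] by (intro mult_left_mono) auto
      finally have "measure (env_law p) (space (env_law p) - ?A) \<le> 1 - \<alpha> / 2" by simp
      then have "\<alpha> / 2 \<le> measure (env_law p) ?A"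
        using P.prob_compl[OF A] by simp
      then have "ennreal (\<alpha> / 2) \<le> emeasure (env_law p) ?A"
        by (simp add: P.emeasure_eq_measure ennreal_leI)
      also have "\<dots> \<le> hit_prob p c r y"
        by (rule hit_prob_lower[OF c r y0])
      finally show ?thesis .
    qed
    have "ennreal (exp (- T) * (\<alpha> / 2)) = (\<integral>\<^sup>+y. ennreal (exp (- T) * (\<alpha> / 2)) * indicator {T - 1..T} y \<partial>lborel)"
      by (subst nn_integral_cmult_indicator) auto
    also have "\<dots> \<le> (\<integral>\<^sup>+y. ennreal (exponential_density 1 y) * (ennreal (\<alpha> / 2) * indicator {T - 1..T} y) \<partial>lborel)"
    proof (rule nn_integral_mono)
      fix y
      show "ennreal (exp (- T) * (\<alpha> / 2)) * indicator {T - 1..T} y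
          \<le> ennreal (exponential_density 1 y) * (ennreal (\<alpha> / 2) * indicator {T - 1..T} y)"
      proof (cases "y \<in> {T - 1..T}")
        case True
        then have "exp (- T) * (\<alpha> / 2) \<le> exp (- y) * (\<alpha> / 2)" using \<alpha> by (intro mult_right_mono) auto
        then show ?thesis using True T \<alpha>
          by (simp add: exponential_density_def ennreal_mult'[symmetric] ennreal_leI)
      qed simp
    qed
    also have "\<dots> = (\<integral>\<^sup>+y. ennreal (\<alpha> / 2) * indicator {T - 1..T} y \<partial>exp1)"
      by (subst nn_integral_density) (auto simp: exponential_density_nonneg)
    also have "\<dots> \<le> (\<integral>\<^sup>+y. hit_prob p c r y \<partial>exp1)"
      using hit by (intro nn_integral_mono) (auto split: split_indicator)
    also have "\<dots> = ennreal (pagerank_tail p c r)" by (rule pagerank_tail_eq[symmetric])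
    finally have "exp (- T) * (\<alpha> / 2) \<le> pagerank_tail p c r"
      by (subst (asm) ennreal_le_iff) (auto simp: pagerank_tail_def)
    moreover have "exp (- T) = (N * r) powr (- (1 / \<mu>'))"
      using N r by (simp add: T_def powr_def)
    ultimately show ?thesis using N r by (simp add: K_def powr_mult mult_ac)
  qed
  have "eventually (\<lambda>r. 1 \<le> ln (N * r) / \<mu>') at_top"
    using N \<mu>(1) by real_asymp
  then have "eventually (\<lambda>r. K * r powr (- (1 / \<mu>')) \<le> pagerank_tail p c r) at_top"
    using eventually_gt_at_top[of 0] by eventually_elim (rule main)
  with K show ?thesis by (rule that)
qed

end

section \<open>Sub-eigenvectors of the killed mean operator\<close>

text \<open>The eigenvalue equation of the killed mean operator solved for its highest index: for d
  \<ge> 1 the sum of p_k h (d + 1 - k) over k \<le> min d K equals \<mu> h d. Cutting off at K gives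
  the recursion finite memory, which the ratio argument of \<open>eig_nonpos\<close> relies
  on.\<close>

function eig :: "nat pmf \<Rightarrow> nat \<Rightarrow> real \<Rightarrow> nat \<Rightarrow> real" where
  "eig p K \<mu> d = (if d \<le> 1 then 1
     else (\<mu> * eig p K \<mu> (d - 1) - (\<Sum>k\<in>{1..min (d - 1) K}. pmf p k * eig p K \<mu> (d - k))) / pmf p 0)"
  by pat_completeness auto
termination by (relation "Wellfounded.measure (\<lambda>(p, K, \<mu>, d). d)") auto

declare eig.simps [simp del]

context offspring
begin

text \<open>The inequality at depth 0 reads \<mu> h 0 \<le> p_0 h 1, and children have positive
  depth, so h 0 enters no other inequality. It is reset to satisfy this one with equality; it is
  then positive, as \<open>tail_lower\<close> requires at the starting depth.\<close>

lemma tail_lower_positive_depths: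
  fixes h :: "nat \<Rightarrow> real" and c \<kappa> \<mu> \<mu>' :: real
  assumes c: "0 < c" "c < 1" and \<mu>: "0 < \<mu>'" "\<mu>' < \<mu>"
    and h: "\<And>d. 1 \<le> d \<Longrightarrow> 0 \<le> h d" "0 < h 1" and \<kappa>: "\<And>d. 1 \<le> d \<Longrightarrow> h d \<le> \<kappa> * c ^ d"
    and super: "\<And>d. 1 \<le> d \<Longrightarrow> \<mu> * h d \<le> (\<Sum>k\<le>d. pmf p k * h (Suc d - k))"
  obtains K where "0 < K" "eventually (\<lambda>r. K * r powr (- (1 / \<mu>')) \<le> pagerank_tail p c r) at_top"
proof -
  define g where "g d = (if d = 0 then pmf p 0 * h 1 / \<mu> else h d)" for d
  have g0: "0 < g 0" using p0_pos h \<mu> by (simp add: g_def)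
  show thesis
  proof (rule tail_lower[OF c \<mu>, of g "max \<kappa> (g 0)"])
    show "0 \<le> g d" for d using h g0 by (cases "d = 0") (auto simp: g_def)
    show "g d \<le> max \<kappa> (g 0) * c ^ d" for d
    proof (cases "d = 0")
      case False
      then have "g d \<le> \<kappa> * c ^ d" using \<kappa>[of d] by (simp add: g_def)
      also have "\<dots> \<le> max \<kappa> (g 0) * c ^ d" using c by (intro mult_right_mono) auto
      finally show ?thesis .
    qed simp
    show "\<mu> * g d \<le> (\<Sum>k\<le>d. pmf p k * g (Suc d - k))" for d
    proof (cases "d = 0")
      case True
      then show ?thesis using \<mu> by (simp add: g_def)
    next
      case False
      have "(\<Sum>k\<le>d. pmf p k * g (Suc d - k)) = (\<Sum>k\<le>d. pmf p k * h (Suc d - k))"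
        by (rule sum.cong) (auto simp: g_def)
      then show ?thesis using super[of d] False by (simp add: g_def)
    qed
  qed (use g0 that in auto)
qed

text \<open>The weight s^-d with s = 1 / c is an eigenvector of the operator without killing only.
  Subtracting t^-d with s < t < s_0 repairs this: the killed terms k = d + 1 + j carry p_k (s^j -
  t^j) \<le> 0, so omitting them raises the sum, and f t / t < f s / s gives the remaining error the
  right sign.\<close>

lemma tail_lower_interior:
  fixes c \<mu>' :: real
  assumes c: "0 < c" "c < 1" "1 / c < s0 p" and \<mu>': "0 < \<mu>'" "\<mu>' < c * f (1 / c)"
  obtains K where "0 < K" "eventually (\<lambda>r. K * r powr (- (1 / \<mu>')) \<le> pagerank_tail p c r) at_top"
proof -
  define s where "s = 1 / c"
  define t where "t = (s + s0 p) / 2"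
  have st: "0 < s" "s < t" "t < s0 p" using c by (auto simp: s_def t_def)
  have c_eq: "c = 1 / s" using c by (simp add: s_def)
  have sm: "summ s" "summ t" using st below_s0 by auto
  have \<mu>_eq: "c * f (1 / c) = f s / s" by (simp add: s_def)
  have dec: "f t / t < f s / s" using st by (intro ratio_decreasing)
  define h where "h d = (1 / s) ^ d - (1 / t) ^ d" for d :: nat
  have le: "(1 / t) ^ d \<le> (1 / s) ^ d" for d using st by (intro power_mono divide_left_mono) auto
  show thesis
  proof (rule tail_lower_positive_depths[OF c(1,2) \<mu>', of h 1])
    show "0 \<le> h d" for d using le[of d] by (simp add: h_def)
    show "0 < h 1" using st by (simp add: h_def frac_less2)
    show "h d \<le> 1 * c ^ d" for d using st by (simp add: h_def c_eq)
    show "c * f (1 / c) * h d \<le> (\<Sum>k\<le>d. pmf p k * h (Suc d - k))" for d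
    proof -
      let ?a = "\<lambda>k. pmf p k * ((1 / s) ^ d * (1 / s) * s ^ k - (1 / t) ^ d * (1 / t) * t ^ k)"
      have sums: "?a sums ((1 / s) ^ d * (1 / s) * f s - (1 / t) ^ d * (1 / t) * f t)"
        using sums_diff[OF sums_mult[OF summable_sums[OF sm(1)], of "(1 / s) ^ d * (1 / s)"]
            sums_mult[OF summable_sums[OF sm(2)], of "(1 / t) ^ d * (1 / t)"]]
        by (simp add: pgf_def algebra_simps)
      have "(\<Sum>k\<le>d. - ?a k) \<le> (\<Sum>k. - ?a k)"
      proof (rule sum_le_suminf)
        show "summable (\<lambda>k. - ?a k)" using sums_minus[OF sums] by (rule sums_summable)
        fix k assume "k \<in> - {..d}"
        then obtain j where k: "k = Suc d + j" by (metis ComplD atMost_iff less_imp_Suc_add not_le add_Suc)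
        have "(1 / x) ^ d * (1 / x) * x ^ k = x ^ j" if "0 < x" for x :: real
          using that by (simp add: k power_add power_divide)
        then have "?a k = pmf p k * (s ^ j - t ^ j)" using st(1) order.strict_trans[OF st(1,2)] by (simp only:)
        moreover have "s ^ j \<le> t ^ j" using st by (intro power_mono) auto
        then have "pmf p k * (s ^ j - t ^ j) \<le> 0" by (intro mult_nonneg_nonpos) auto
        ultimately show "0 \<le> - ?a k" by (simp only: neg_0_le_iff_le)
      qed simp
      also have "(\<Sum>k. - ?a k) = - ((1 / s) ^ d * (1 / s) * f s - (1 / t) ^ d * (1 / t) * f t)"
        using sums_minus[OF sums] by (simp add: sums_iff)
      finally have "(1 / s) ^ d * (f s / s) - (1 / t) ^ d * (f t / t) \<le> (\<Sum>k\<le>d. ?a k)"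
        by (simp add: sum_negf)
      also have "(\<Sum>k\<le>d. ?a k) = (\<Sum>k\<le>d. pmf p k * h (Suc d - k))"
        using st by (intro sum.cong refl) (simp add: h_def scaled_power)
      finally have "(1 / s) ^ d * (f s / s) - (1 / t) ^ d * (f t / t) \<le> (\<Sum>k\<le>d. pmf p k * h (Suc d - k))" .
      moreover have "(1 / t) ^ d * (f t / t) \<le> (1 / t) ^ d * (f s / s)"
        using dec st by (intro mult_left_mono) auto
      moreover have "f s / s * h d = (1 / s) ^ d * (f s / s) - (1 / t) ^ d * (f s / s)"
        by (simp add: h_def right_diff_distrib mult.commute)
      ultimately show ?thesis unfolding \<mu>_eq by linarith
    qed
  qed (use that in auto)
qed

text \<open>
  Truncating \<open>f\<close> to a polynomial hardly lowers the minimum \<open>1 / R\<close> of \<open>f y / y\<close>: a sequence of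
  counterexamples would stay in a compact interval and accumulate at a counterexample for \<open>f\<close>.
\<close>

lemma truncated_pgf_ge:
  assumes \<mu>: "0 < \<mu>" "\<mu> < 1 / R_const p"
  obtains K where "2 \<le> K" "\<And>y. 0 < y \<Longrightarrow> \<mu> * y \<le> (\<Sum>k\<le>K. pmf p k * y ^ k)"
proof (rule ccontr)
  assume "\<not> thesis"
  then have ex: "\<exists>y>0. (\<Sum>k\<le>K. pmf p k * y ^ k) < \<mu> * y" if "2 \<le> K" for K
    using that by (metis \<open>\<And>K. \<lbrakk>2 \<le> K; \<And>y. 0 < y \<Longrightarrow> \<mu> * y \<le> (\<Sum>k\<le>K. pmf p k * y ^ k)\<rbrakk> \<Longrightarrow> thesis\<close> not_le)
  obtain m where m: "2 \<le> m" "0 < pmf p m" by (rule obtain_ge2)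
  have "\<exists>y. 0 < y \<and> (\<Sum>k\<le>m + n. pmf p k * y ^ k) < \<mu> * y" for n
    using ex[of "m + n"] m by auto
  then obtain y where y: "\<And>n. 0 < y n" "\<And>n. (\<Sum>k\<le>m + n. pmf p k * y n ^ k) < \<mu> * y n"
    by metis
  have term_le: "pmf p k * y n ^ k < \<mu> * y n" if "k \<le> m + n" for k n
  proof -
    have "pmf p k * y n ^ k \<le> (\<Sum>k\<le>m + n. pmf p k * y n ^ k)"
      using that y(1)[of n] by (intro member_le_sum) auto
    with y(2)[of n] show ?thesis by simp
  qed
  \<comment> \<open>The terms of index 0 and m confine the counterexamples from below and from
    above; the latter works because m \<ge> 2.\<close>
  have lower: "pmf p 0 / \<mu> \<le> y n" for n
    using term_le[of 0 n] \<mu> by (simp add: field_simps)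
  have upper: "y n \<le> max 1 (\<mu> / pmf p m)" for n
  proof (cases "y n \<le> 1")
    case False
    have "pmf p m * y n * y n \<le> pmf p m * y n ^ m"
      using m False power_increasing[of 2 m "y n"] by (simp add: power2_eq_square mult.assoc)
    also have "\<dots> < \<mu> * y n" by (rule term_le) simp
    finally have "pmf p m * y n < \<mu>" using y(1)[of n] by (simp only: mult_less_cancel_right_pos)
    then have "y n < \<mu> / pmf p m" using m by (simp add: field_simps)
    then show ?thesis by simp
  qed simp
  have "\<forall>n. y n \<in> {pmf p 0 / \<mu>..max 1 (\<mu> / pmf p m)}" using lower upper by auto
  then obtain l r where l: "l \<in> {pmf p 0 / \<mu>..max 1 (\<mu> / pmf p m)}"
    and r: "strict_mono r" "(y \<circ> r) \<longlonglongrightarrow> l"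
    using compact_Icc[unfolded compact_def] by metis
  have "0 < pmf p 0 / \<mu>" using p0_pos \<mu> by simp
  then have l_pos: "0 < l" by (rule less_le_trans) (use l in simp)
  \<comment> \<open>Each fixed partial sum passes to the limit. The common bound also yields
    convergence of the series at l, so that f l / l is subject to the lower bound 1 / R.\<close>
  have partial: "(\<Sum>k\<le>J. pmf p k * l ^ k) \<le> \<mu> * l" for J
  proof (rule tendsto_le[OF sequentially_bot])
    show "(\<lambda>i. \<mu> * y (r i)) \<longlonglongrightarrow> \<mu> * l"
      using r(2) by (intro tendsto_intros) (simp add: o_def)
    show "(\<lambda>i. \<Sum>k\<le>J. pmf p k * y (r i) ^ k) \<longlonglongrightarrow> (\<Sum>k\<le>J. pmf p k * l ^ k)"
      using r(2) by (intro tendsto_intros) (simp add: o_def)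
    have "(\<Sum>k\<le>J. pmf p k * y (r i) ^ k) \<le> \<mu> * y (r i)" if "J \<le> i" for i
    proof -
      have "J \<le> m + r i" using that seq_suble[OF r(1), of i] by simp
      then have "(\<Sum>k\<le>J. pmf p k * y (r i) ^ k) \<le> (\<Sum>k\<le>m + r i. pmf p k * y (r i) ^ k)"
        using y(1)[of "r i"] by (intro sum_mono2) auto
      with y(2)[of "r i"] show ?thesis by simp
    qed
    then show "eventually (\<lambda>i. (\<Sum>k\<le>J. pmf p k * y (r i) ^ k) \<le> \<mu> * y (r i)) sequentially"
      by (auto simp: eventually_sequentially)
  qed
  have sm: "summ l"
    using partial l_pos by (intro bounded_imp_summable[where B = "\<mu> * l"]) auto
  have "f l \<le> \<mu> * l"
    unfolding pgf_def
  proof (rule suminf_le_const[OF sm])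
    fix n
    have "(\<Sum>k<n. pmf p k * l ^ k) \<le> (\<Sum>k\<le>n. pmf p k * l ^ k)"
      using l_pos by (intro sum_mono2) auto
    with partial[of n] show "(\<Sum>k<n. pmf p k * l ^ k) \<le> \<mu> * l" by simp
  qed
  then have "R_const p * f l \<le> R_const p * (\<mu> * l)" using R_pos by (intro mult_left_mono) auto
  then have "1 * l \<le> (R_const p * \<mu>) * l" using le_R_pgf[OF l_pos sm] by (simp add: mult.assoc)
  moreover have "R_const p * \<mu> < 1" using \<mu> R_pos by (simp add: field_simps)
  ultimately show False using l_pos by (simp only: mult_le_cancel_right_pos)
qed

lemma eig_step:
  assumes "1 \<le> d"
  shows "pmf p 0 * eig p K \<mu> (Suc d) + (\<Sum>k\<in>{1..min d K}. pmf p k * eig p K \<mu> (Suc d - k)) = \<mu> * eig p K \<mu> d"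
  using assms p0_pos by (subst eig.simps) simp

text \<open>
  If the solution stayed positive, an upper bound \<open>M\<close> for the ratios of consecutive entries would
  improve to \<open>M - \<eta> / p\<^sub>0\<close> a few steps later, by the equation and \<open>M f (1 / M) \<ge> \<mu> + \<eta>\<close>.
\<close>

lemma eig_nonpos:
  assumes \<mu>: "0 < \<mu>" and \<eta>: "0 < \<eta>" and K: "1 \<le> K"
    and ge: "\<And>y. 0 < y \<Longrightarrow> (\<mu> + \<eta>) * y \<le> (\<Sum>k\<le>K. pmf p k * y ^ k)"
  shows "\<exists>d\<ge>1. eig p K \<mu> (Suc d) \<le> 0"
proof (rule ccontr)
  let ?h = "eig p K \<mu>"
  assume "\<not> ?thesis"
  then have pos: "0 < ?h d" if "2 \<le> d" for d
    using that by (metis Suc_le_D Suc_le_mono not_le numeral_2_eq_2 One_nat_def)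
  have "?h 1 = 1" by (subst eig.simps) simp
  then have pos: "0 < ?h d" if "1 \<le> d" for d
    using pos[of d] that by (cases "d = 1") auto
  have "\<exists>D\<ge>1. \<forall>d\<ge>D. ?h (Suc d) \<le> (\<mu> / pmf p 0 - real i * (\<eta> / pmf p 0)) * ?h d" for i
  proof (induction i)
    case 0
    have "?h (Suc d) \<le> \<mu> / pmf p 0 * ?h d" if "1 \<le> d" for d
    proof -
      have "0 \<le> (\<Sum>k\<in>{1..min d K}. pmf p k * ?h (Suc d - k))"
        using pos by (intro sum_nonneg mult_nonneg_nonneg) (auto intro!: less_imp_le)
      then have "pmf p 0 * ?h (Suc d) \<le> \<mu> * ?h d" using eig_step[OF that, of K \<mu>] by linarith
      then show ?thesis using p0_pos by (simp add: field_simps)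
    qed
    then show ?case by auto
  next
    case (Suc i)
    define M where "M = \<mu> / pmf p 0 - real i * (\<eta> / pmf p 0)"
    from Suc obtain D where D: "1 \<le> D" "\<And>d. D \<le> d \<Longrightarrow> ?h (Suc d) \<le> M * ?h d"
      unfolding M_def by blast
    have M: "0 < M"
    proof -
      have "0 < M * ?h D" using pos[of "Suc D"] D(2)[of D] by simp
      with pos[OF D(1)] show ?thesis by (simp only: zero_less_mult_pos2)
    qed
    have step: "?h (Suc d) \<le> (M - \<eta> / pmf p 0) * ?h d" if d: "D + K \<le> d" for d
    proof -
      \<comment> \<open>The ratio bound is chained backwards over at most K steps; d \<ge> D + K
        keeps all of them in its range.\<close>
      have prev: "?h d * (1 / M) ^ j \<le> ?h (d - j)" if "j \<le> K" for j
        using that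
      proof (induction j)
        case (Suc j)
        have "?h (Suc (d - Suc j)) \<le> M * ?h (d - Suc j)"
          using Suc.prems d by (intro D(2)) simp
        moreover have "Suc (d - Suc j) = d - j" using Suc.prems d D(1) by simp
        ultimately have "?h d * (1 / M) ^ j \<le> M * ?h (d - Suc j)" using Suc by simp
        then show ?case using M by (simp add: field_simps)
      qed simp
      have hd: "0 < ?h d" using pos d D(1) by simp
      \<comment> \<open>M (1 / M)^k stands for M^-(k - 1): the term of index k reaches back k - 1
        steps from d.\<close>
      have "(\<Sum>k\<in>{1..K}. pmf p k * (?h d * (M * (1 / M) ^ k))) \<le> (\<Sum>k\<in>{1..min d K}. pmf p k * ?h (Suc d - k))"
      proof -
        have "min d K = K" using d by simp
        moreover have "?h d * (M * (1 / M) ^ k) \<le> ?h (Suc d - k)" if "k \<in> {1..K}" for k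
        proof -
          obtain j where k: "k = Suc j" using \<open>k \<in> {1..K}\<close> by (cases k) auto
          then show ?thesis using prev[of j] that M by simp
        qed
        ultimately show ?thesis by (simp only:) (intro sum_mono mult_left_mono; simp)
      qed
      then have "pmf p 0 * ?h (Suc d) \<le> \<mu> * ?h d - (\<Sum>k\<in>{1..K}. pmf p k * (?h d * (M * (1 / M) ^ k)))"
        using eig_step[of d K \<mu>] d D(1) by simp
      also have "(\<Sum>k\<in>{1..K}. pmf p k * (?h d * (M * (1 / M) ^ k)))
          = ?h d * M * ((\<Sum>k\<le>K. pmf p k * (1 / M) ^ k) - pmf p 0)"
      proof -
        have "{..K} = insert 0 {1..K}" by auto
        then show ?thesis by (simp add: sum_distrib_left mult_ac)
      qed
      also have "\<mu> * ?h d - \<dots> \<le> \<mu> * ?h d - ?h d * M * ((\<mu> + \<eta>) * (1 / M) - pmf p 0)"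
        using ge[of "1 / M"] M hd by (intro diff_left_mono mult_left_mono) auto
      also have "\<dots> = (pmf p 0 * M - \<eta>) * ?h d" using M by (simp add: field_simps)
      finally show ?thesis using p0_pos by (simp add: field_simps)
    qed
    have "M - \<eta> / pmf p 0 = \<mu> / pmf p 0 - real (Suc i) * (\<eta> / pmf p 0)"
      by (simp add: M_def algebra_simps add_divide_distrib)
    with step D(1) show ?case by (intro exI[of _ "D + K"]) auto
  qed
  note bound = this
  \<comment> \<open>After enough improvements the ratio bound is negative, which contradicts
    positivity.\<close>
  obtain i where "\<mu> / pmf p 0 < real i * (\<eta> / pmf p 0)"
    using reals_Archimedean3[of "\<eta> / pmf p 0"] \<eta> p0_pos by (metis divide_pos_pos)
  moreover obtain D where "1 \<le> D" "?h (Suc D) \<le> (\<mu> / pmf p 0 - real i * (\<eta> / pmf p 0)) * ?h D"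
    using bound[of i] by blast
  ultimately show False
    using pos[of D] pos[of "Suc D"] mult_neg_pos[of "\<mu> / pmf p 0 - real i * (\<eta> / pmf p 0)" "?h D"] by linarith
qed

text \<open>The solution is set to 0 beyond L, just before its first nonpositive entry. Replacing h
  (L + 1) \<le> 0 by 0 can only raise the operator at depth L, and finite support gives the
  comparison with c^d for every c. The intermediate rate \<mu>2 supplies the excess \<mu>2 - \<mu>
  for \<open>eig_nonpos\<close>.\<close>

lemma tail_lower_R:
  fixes c \<mu>' :: real
  assumes c: "0 < c" "c < 1" and \<mu>': "0 < \<mu>'" "\<mu>' < 1 / R_const p"
  obtains K where "0 < K" "eventually (\<lambda>r. K * r powr (- (1 / \<mu>')) \<le> pagerank_tail p c r) at_top"
proof -
  obtain \<mu>2 where \<mu>2: "\<mu>' < \<mu>2" "\<mu>2 < 1 / R_const p" using dense \<mu>'(2) by blast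
  obtain \<mu> where \<mu>: "\<mu>' < \<mu>" "\<mu> < \<mu>2" using dense \<mu>2(1) by blast
  obtain K where K: "2 \<le> K" "\<And>y. 0 < y \<Longrightarrow> \<mu>2 * y \<le> (\<Sum>k\<le>K. pmf p k * y ^ k)"
    using truncated_pgf_ge[of \<mu>2] \<mu>2 \<mu>' by auto
  let ?h = "eig p K \<mu>"
  have ex: "\<exists>d. 1 \<le> d \<and> ?h (Suc d) \<le> 0"
    using eig_nonpos[of \<mu> "\<mu>2 - \<mu>" K] K \<mu> \<mu>' by auto
  define L where "L = (LEAST d. 1 \<le> d \<and> ?h (Suc d) \<le> 0)"
  have L: "1 \<le> L" "?h (Suc L) \<le> 0" using LeastI_ex[OF ex] by (auto simp: L_def)
  have one: "?h 1 = 1" by (subst eig.simps) simp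
  have pos: "0 < ?h d" if "1 \<le> d" "d \<le> L" for d
  proof (cases "d = 1")
    case False
    then obtain e where e: "d = Suc e" "1 \<le> e" using \<open>1 \<le> d\<close> by (cases d) auto
    then have "\<not> (1 \<le> e \<and> ?h (Suc e) \<le> 0)" 
      using that(2) not_less_Least[of e "\<lambda>d. 1 \<le> d \<and> ?h (Suc d) \<le> 0"] unfolding L_def by simp
    with e show ?thesis by simp
  qed (use one in simp)
  define h where "h d = (if 1 \<le> d \<and> d \<le> L then ?h d else 0)" for d
  have h_nonneg: "0 \<le> h d" for d using pos[of d] by (auto simp: h_def)
  show thesis
  proof (rule tail_lower_positive_depths[OF c \<mu>'(1) \<mu>(1), of h "\<Sum>d\<in>{1..L}. h d / c ^ d"])
    show "0 \<le> h d" for d by (rule h_nonneg)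
    show "0 < h 1" using L(1) one by (simp add: h_def)
    show "h d \<le> (\<Sum>d\<in>{1..L}. h d / c ^ d) * c ^ d" if "1 \<le> d" for d
    proof (cases "d \<le> L")
      case True
      then have "h d / c ^ d \<le> (\<Sum>d\<in>{1..L}. h d / c ^ d)"
        using that h_nonneg c by (intro member_le_sum) auto
      then show ?thesis using c by (simp add: field_simps)
    next
      case False
      then have "h d = 0" by (simp add: h_def)
      then show ?thesis using h_nonneg c by (simp add: sum_nonneg)
    qed
    show "\<mu> * h d \<le> (\<Sum>k\<le>d. pmf p k * h (Suc d - k))" if d: "1 \<le> d" for d
    proof (cases "d \<le> L")
      case True
      have "\<mu> * h d = pmf p 0 * ?h (Suc d) + (\<Sum>k\<in>{1..min d K}. pmf p k * ?h (Suc d - k))"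
        using eig_step[OF d, of K \<mu>] d True by (simp add: h_def)
      also have "?h (Suc d) \<le> h (Suc d)"
      proof (cases "d = L")
        case False
        then show ?thesis using True by (simp add: h_def)
      qed (use L in \<open>simp add: h_def\<close>)
      also have "(\<Sum>k\<in>{1..min d K}. pmf p k * ?h (Suc d - k)) = (\<Sum>k\<in>{1..min d K}. pmf p k * h (Suc d - k))"
        using True by (intro sum.cong) (auto simp: h_def)
      also have "\<dots> \<le> (\<Sum>k\<in>{1..d}. pmf p k * h (Suc d - k))"
        using h_nonneg by (intro sum_mono2) auto
      finally have "\<mu> * h d \<le> pmf p 0 * h (Suc d) + (\<Sum>k\<in>{1..d}. pmf p k * h (Suc d - k))"
        by (simp add: mult_left_mono)
      also have "\<dots> = (\<Sum>k\<le>d. pmf p k * h (Suc d - k))"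
      proof -
        have "{..d} = insert 0 {1..d}" by auto
        then show ?thesis by simp
      qed
      finally show ?thesis .
    next
      case False
      then have "h d = 0" by (simp add: h_def)
      then show ?thesis using h_nonneg by (simp add: sum_nonneg)
    qed
  qed (use that in auto)
qed

end

section \<open>Logarithmic asymptotics\<close>

lemma eventually_ln_ratio_le:
  fixes g :: "real \<Rightarrow> real"
  assumes "0 < K" "eventually (\<lambda>r. g r \<le> K * r powr (- \<beta>)) at_top" "eventually (\<lambda>r. 0 < g r) at_top"
    and "- \<beta> < x"
  shows "eventually (\<lambda>r. ln (g r) / ln r < x) at_top"
proof -
  have "eventually (\<lambda>r. ln K / ln r + (- \<beta>) < x) at_top"
    using assms(1,4) by real_asymp
  with assms(2,3) eventually_gt_at_top[of 1] show ?thesis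
  proof eventually_elim
    case (elim r)
    then have "ln (g r) \<le> ln (K * r powr (- \<beta>))" by simp
    also have "\<dots> = ln K + (- \<beta>) * ln r" using assms(1) elim by (simp add: ln_mult ln_powr)
    finally have "ln (g r) / ln r \<le> (ln K + (- \<beta>) * ln r) / ln r"
      using elim by (intro divide_right_mono) auto
    also have "(ln K + (- \<beta>) * ln r) / ln r = ln K / ln r + (- \<beta>)"
      using ln_gt_zero[of r] elim by (simp add: field_simps)
    finally show ?case using elim by linarith
  qed
qed

lemma eventually_ln_ratio_ge:
  fixes g :: "real \<Rightarrow> real"
  assumes "0 < K" "eventually (\<lambda>r. K * r powr (- \<beta>) \<le> g r) at_top" and "x < - \<beta>"
  shows "eventually (\<lambda>r. x < ln (g r) / ln r) at_top"
proof -
  have "eventually (\<lambda>r. x < ln K / ln r + (- \<beta>)) at_top"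
    using assms(1,3) by real_asymp
  with assms(2) eventually_gt_at_top[of 1] show ?thesis
  proof eventually_elim
    case (elim r)
    then have pos: "0 < K * r powr (- \<beta>)" using assms(1) by simp
    have "ln K / ln r + (- \<beta>) = (ln K + (- \<beta>) * ln r) / ln r"
      using ln_gt_zero[of r] elim by (simp add: field_simps)
    also have "ln K + (- \<beta>) * ln r = ln (K * r powr (- \<beta>))" using assms(1) elim by (simp add: ln_mult ln_powr)
    also have "\<dots> / ln r \<le> ln (g r) / ln r"
      using elim pos by (intro divide_right_mono) auto
    finally show ?case using elim by linarith
  qed
qed

lemma eventually_pos_of_lower:
  fixes g :: "real \<Rightarrow> real"
  assumes "0 < K" "eventually (\<lambda>r. K * r powr (- \<beta>) \<le> g r) at_top"
  shows "eventually (\<lambda>r. 0 < g r) at_top"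
  using assms(2) eventually_gt_at_top[of 0]
proof eventually_elim
  case (elim r)
  then have "0 < K * r powr (- \<beta>)" using assms(1) by simp
  with elim show ?case by linarith
qed

text \<open>The witness makes 1 / \<mu> the midpoint of B and - x.\<close>

lemma exponent_below:
  fixes B x :: real
  assumes "0 < B" "x < - B"
  obtains \<mu> where "0 < \<mu>" "\<mu> < 1 / B" "x < - (1 / \<mu>)"
proof
  define \<mu> where "\<mu> = 2 / (B - x)"
  show "0 < \<mu>" "\<mu> < 1 / B" "x < - (1 / \<mu>)" using assms by (auto simp: \<mu>_def field_simps)
qed

context offspring
begin

lemma eventually_tail_exponent_ge_R:
  assumes "0 < c" "c < 1" "x < - R_const p"
  shows "eventually (\<lambda>r. x < ln (pagerank_tail p c r) / ln r) at_top"
proof -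
  obtain \<mu> where \<mu>: "0 < \<mu>" "\<mu> < 1 / R_const p" "x < - (1 / \<mu>)"
    using exponent_below[OF R_pos assms(3)] .
  obtain K where "0 < K" "eventually (\<lambda>r. K * r powr (- (1 / \<mu>)) \<le> pagerank_tail p c r) at_top"
    using tail_lower_R[OF assms(1,2) \<mu>(1,2)] .
  then show ?thesis using \<mu>(3) by (intro eventually_ln_ratio_ge)
qed

text \<open>Upper bounds pass through \<open>ln\<close> only where the tail is positive; positivity
  is inherited from the lower bound.\<close>

lemma eventually_tail_pos:
  assumes "0 < c" "c < 1"
  shows "eventually (\<lambda>r. 0 < pagerank_tail p c r) at_top"
proof -
  have "0 < 1 / R_const p" using R_pos by simp
  then obtain \<mu> where \<mu>: "0 < \<mu>" "\<mu> < 1 / R_const p" using dense by blast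
  obtain K where "0 < K" "eventually (\<lambda>r. K * r powr (- (1 / \<mu>)) \<le> pagerank_tail p c r) at_top"
    using tail_lower_R[OF assms \<mu>] .
  then show ?thesis by (rule eventually_pos_of_lower)
qed

lemma eventually_tail_exponent_le:
  assumes c: "0 < c" "c < 1" "c \<le> 1 / s" and s: "0 < s" "summ s" and e: "0 < e"
    and s1: "0 < s1" "summ s1" "s1 \<le> s powr \<theta>" "f s1 / s1 \<le> \<sigma>"
    and \<theta>: "0 < \<theta>" "\<theta> * ((1 + e) * (f s / s)) \<le> \<sigma>"
    and a: "0 < a" "a \<le> 1" "a * \<sigma> < 1"
    and x: "- (a * \<theta>) < x"
  shows "eventually (\<lambda>r. ln (pagerank_tail p c r) / ln r < x) at_top"
proof -
  have "max 0 (- x) < a * \<theta>" using x a \<theta> by simp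
  then obtain \<beta> where \<beta>: "max 0 (- x) < \<beta>" "\<beta> < a * \<theta>" using dense by blast
  then have "0 < \<beta>" by simp
  obtain K where "0 < K" "eventually (\<lambda>r. pagerank_tail p c r \<le> K * r powr (- \<beta>)) at_top"
    using tail_upper[OF c s e s1 \<theta> a \<open>0 < \<beta>\<close> \<beta>(2)] .
  then show ?thesis using eventually_tail_pos[OF c(1,2)] \<beta> by (intro eventually_ln_ratio_le) auto
qed

section \<open>Upper exponents in the supercritical, subcritical and critical cases\<close>

lemma obtain_slack:
  fixes q :: real
  assumes "q < 1"
  obtains e where "0 < e" "(1 + e) * q < 1"
proof (cases "q \<le> 0")
  case True
  then show ?thesis by (intro that[of 1]) auto
next
  case False
  then have "1 < 1 / q" using assms by simp
  then obtain t where t: "1 < t" "t < 1 / q" using dense by blast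
  then show ?thesis using False by (intro that[of "t - 1"]) (auto simp: field_simps)
qed

text \<open>The barrier uses s = s_0 and the crossing count s1 = s_0^\<theta>. As ln s_0 < 0, the
  bound \<theta> < ln q / ln s_0 with q = \<open>q_star p\<close> means s1 > q, hence f s1 < s1,
  while \<theta> < R gives \<theta> f s_0 / s_0 < 1. Both rates are below one, so a = 1 can be
  taken. The condition c \<le> 1 / s_0 is automatic because s_0 < 1.\<close>

lemma supercritical_upper:
  assumes c: "0 < c" "c < 1" and mean: "1 < measure_pmf.expectation p real"
    and x: "- min (R_const p) (ln (q_star p) / ln (s0 p)) < x"
  shows "eventually (\<lambda>r. ln (pagerank_tail p c r) / ln r < x) at_top"
proof -
  let ?s = "s0 p" and ?q = "q_star p"
  note s0 = supercritical_s0[OF mean] and q = supercritical_q_star[OF mean]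
  have ln_s: "ln ?s < 0" using s0(1) s0_pos by simp
  have "ln ?q < 0" using q s0(1) by simp
  with ln_s have quot: "0 < ln ?q / ln ?s" by (simp add: divide_neg_neg)
  have "max 0 (- x) < min (R_const p) (ln ?q / ln ?s)"
    using x R_pos quot by auto
  then obtain \<theta> where \<theta>: "max 0 (- x) < \<theta>" "\<theta> < min (R_const p) (ln ?q / ln ?s)"
    using dense by blast
  have \<theta>0: "0 < \<theta>" and \<theta>x: "- (1 * \<theta>) < x" using \<theta>(1) by auto
  define s1 where "s1 = ?s powr \<theta>"
  have "ln ?q < \<theta> * ln ?s" using \<theta>(2) ln_s by (simp add: field_simps)
  then have "exp (ln ?q) < exp (\<theta> * ln ?s)" by simp
  then have s1: "?q < s1" using q s0_pos by (simp add: s1_def powr_def)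
  have s1_less: "s1 < 1" unfolding s1_def using powr_less_mono2[of \<theta> ?s 1] s0(1) s0_pos \<theta>0 by simp
  have s1_pos: "0 < s1" using s1 q by simp
  have f_s1: "f s1 / s1 < 1" using supercritical_pgf_less[OF mean s1 s1_less] s1_pos by simp
  have "\<theta> * (f ?s / ?s) < 1"
  proof -
    have "\<theta> * f ?s < R_const p * f ?s"
      using \<theta>(2) pgf_pos[OF s0(3)] s0_pos by (intro mult_strict_right_mono) auto
    also have "R_const p * f ?s \<le> ?s"
    proof -
      have "R_const p \<le> ?s / f ?s"
        unfolding R_const_eq
      proof (rule cSUP_least)
        fix s assume s: "s \<in> {0<..<?s}"
        have "f ?s * s \<le> f s * ?s"
          using pgf_tangent(1)[of ?s s] s0 s s0_pos below_s0[of s] by simp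
        moreover have "0 < f s" "0 < f ?s" using s below_s0[of s] s0 s0_pos by (auto intro!: pgf_pos)
        ultimately show "s / f s \<le> ?s / f ?s" by (simp add: field_simps)
      qed (use s0_pos in simp)
      then show ?thesis using pgf_pos[OF s0(3)] s0_pos by (simp add: field_simps)
    qed
    finally show ?thesis using s0_pos by simp
  qed
  then obtain e where e: "0 < e" "(1 + e) * (\<theta> * (f ?s / ?s)) < 1" using obtain_slack by blast
  define \<sigma> where "\<sigma> = max (f s1 / s1) (\<theta> * ((1 + e) * (f ?s / ?s)))"
  show ?thesis
  proof (rule eventually_tail_exponent_le[of c ?s e s1 \<theta> \<sigma> 1])
    show "c \<le> 1 / ?s" using c s0(1) s0_pos by (simp add: field_simps) (meson less_imp_le mult_le_one order_trans)
    show "summ s1" using summ_le[OF summ_1] s1_pos s1_less by simp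
    show "1 * \<sigma> < 1" using f_s1 e by (simp add: \<sigma>_def mult_ac)
  qed (use c s0 s0_pos e \<theta>0 \<theta>x s1_pos in \<open>auto simp: \<sigma>_def s1_def\<close>)
qed

text \<open>Here s1 = s serves both purposes: for s > 1 an exponent t \<ge> 1 gives s \<le> s^t, and
  t < s / f s makes the rate t f s / s less than one.\<close>

lemma subcritical_upper:
  assumes c: "0 < c" "c < 1" "c \<le> 1 / s" and s: "1 < s" "s < s0 p"
    and x: "- (s / f s) < x"
    and \<theta>: "1 \<le> s / f s" "f s / s < 1"
  shows "eventually (\<lambda>r. ln (pagerank_tail p c r) / ln r < x) at_top"
proof -
  note b = below_s0[of s]
  have sm: "summ s" using s b by simp
  have f: "0 < f s" using s by (intro pgf_pos sm) auto
  have "max 1 (- x) < s / f s" using x \<theta> f s by (auto simp: field_simps)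
  then obtain t where t: "max 1 (- x) < t" "t < s / f s" using dense by blast
  have "t * (f s / s) < 1" using t(2) f s by (simp add: field_simps)
  then obtain e where e: "0 < e" "(1 + e) * (t * (f s / s)) < 1" using obtain_slack by blast
  define \<sigma> where "\<sigma> = max (f s / s) (t * ((1 + e) * (f s / s)))"
  show ?thesis
  proof (rule eventually_tail_exponent_le[OF c, of e s t \<sigma> 1])
    have "s powr 1 \<le> s powr t" using s t by (intro powr_mono) auto
    then show "s \<le> s powr t" using s by simp
    show "1 * \<sigma> < 1" using e \<theta> by (simp add: \<sigma>_def mult_ac)
  qed (use s t e sm in \<open>auto simp: \<sigma>_def\<close>)
qed

text \<open>With s = s1 = \<theta> = 1 the growth rate is f 1 = 1, so \<sigma> = 1 + e exceeds one
  and a power a < 1 of the crossing bound has to be used; a can be taken as close to 1 as x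
  requires.\<close>

lemma critical_upper:
  assumes c: "0 < c" "c < 1" and x: "- 1 < x"
  shows "eventually (\<lambda>r. ln (pagerank_tail p c r) / ln r < x) at_top"
proof -
  have "max 0 (- x) < 1" using x by simp
  then obtain a where a: "max 0 (- x) < a" "a < 1" using dense by blast
  then obtain e where e: "0 < e" "(1 + e) * a < 1" using obtain_slack by blast
  show ?thesis
    by (rule eventually_tail_exponent_le[of c 1 e 1 1 "1 + e" a])
       (use c a e summ_1 in \<open>auto simp: f_1 mult.commute\<close>)
qed

lemma subcritical_ratio:
  assumes "measure_pmf.expectation p real \<le> 1" "1 < s" "s < s0 p"
  shows "f s / s < 1"
proof -
  have "f s < s"
    using pgf_tangent(2)[of s 1] below_s0[of s] assms summ_1
      mult_neg_neg[of "tilt s" "1 - s"] by (simp add: f_1)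
  then show ?thesis using assms by simp
qed

end

theorem theorem3p16:
  fixes p :: "nat pmf"
  assumes "integrable (measure_pmf p) real"
    and "0 < pmf p 0" and "pmf p 0 < 1"
    and "pmf p 0 + pmf p 1 < 1"
    and "Gcd {j. 0 < pmf p j} = 1"
  shows
    "(1 < measure_pmf.expectation p real \<longrightarrow>
       (\<forall>c. 0 < c \<and> c < 1 \<longrightarrow>
          - ereal (R_const p)
            \<le> Liminf at_top (\<lambda>r. ereal (ln (pagerank_tail p c r) / ln r)) \<and>
          Liminf at_top (\<lambda>r. ereal (ln (pagerank_tail p c r) / ln r))
            \<le> Limsup at_top (\<lambda>r. ereal (ln (pagerank_tail p c r) / ln r)) \<and>
          Limsup at_top (\<lambda>r. ereal (ln (pagerank_tail p c r) / ln r))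
            \<le> - ereal (min (R_const p) (ln (q_star p) / ln (s0 p))))) \<and>
     (measure_pmf.expectation p real \<le> 1 \<longrightarrow>
       (\<forall>c. 0 < c \<and> c \<le> inverse (s0 p) \<and> c < 1 \<longrightarrow>
          ((\<lambda>r. ln (pagerank_tail p c r) / ln r) \<longlongrightarrow> - R_const p) at_top) \<and>
       (\<forall>c. 1 < s0 p \<and> inverse (s0 p) < c \<and> c < 1 \<longrightarrow>
          ((\<lambda>r. ln (pagerank_tail p c r) / ln r) \<longlongrightarrow> - 1 / (c * pgf p (1 / c))) at_top))"
proof -
  interpret offspring p using assms by unfold_locales
  have a: "- ereal (R_const p) \<le> Liminf at_top (\<lambda>r. ereal (ln (pagerank_tail p c r) / ln r)) \<and>
      Liminf at_top (\<lambda>r. ereal (ln (pagerank_tail p c r) / ln r))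
        \<le> Limsup at_top (\<lambda>r. ereal (ln (pagerank_tail p c r) / ln r)) \<and>
      Limsup at_top (\<lambda>r. ereal (ln (pagerank_tail p c r) / ln r))
        \<le> - ereal (min (R_const p) (ln (q_star p) / ln (s0 p)))"
    if mean: "1 < measure_pmf.expectation p real" and c: "0 < c" "c < 1" for c
  proof (intro conjI)
    let ?g = "\<lambda>r. ln (pagerank_tail p c r) / ln r"
    show "- ereal (R_const p) \<le> Liminf at_top (\<lambda>r. ereal (?g r))"
      unfolding le_Liminf_iff
    proof (intro allI impI)
      fix y assume y: "y < - ereal (R_const p)"
      then obtain z where z: "y < ereal z" "ereal z < - ereal (R_const p)" using ereal_dense2 by blast
      then have "eventually (\<lambda>r. z < ?g r) at_top"
        using c by (intro eventually_tail_exponent_ge_R) auto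
      then show "eventually (\<lambda>r. y < ereal (?g r)) at_top"
      proof eventually_elim
        case (elim r)
        then have "ereal z < ereal (?g r)" by simp
        with z(1) show ?case by (rule less_trans)
      qed
    qed
    show "Liminf at_top (\<lambda>r. ereal (?g r)) \<le> Limsup at_top (\<lambda>r. ereal (?g r))"
      by (rule Liminf_le_Limsup) simp
    show "Limsup at_top (\<lambda>r. ereal (?g r)) \<le> - ereal (min (R_const p) (ln (q_star p) / ln (s0 p)))"
      unfolding Limsup_le_iff
    proof (intro allI impI)
      fix y assume y: "- ereal (min (R_const p) (ln (q_star p) / ln (s0 p))) < y"
      then obtain z where z: "- ereal (min (R_const p) (ln (q_star p) / ln (s0 p))) < ereal z" "ereal z < y"
        using ereal_dense2 by blast
      then have "eventually (\<lambda>r. ?g r < z) at_top"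
        using c mean by (intro supercritical_upper) (simp_all only: uminus_ereal.simps less_ereal.simps)
      then show "eventually (\<lambda>r. ereal (?g r) < y) at_top"
      proof eventually_elim
        case (elim r)
        then have "ereal (?g r) < ereal z" by simp
        then show ?case using z(2) by (rule less_trans)
      qed
    qed
  qed
  have b1: "((\<lambda>r. ln (pagerank_tail p c r) / ln r) \<longlongrightarrow> - R_const p) at_top"
    if mean: "measure_pmf.expectation p real \<le> 1" and c: "0 < c" "c \<le> inverse (s0 p)" "c < 1" for c
  proof (rule order_tendstoI)
    fix x assume x: "- R_const p < x"
    show "eventually (\<lambda>r. ln (pagerank_tail p c r) / ln r < x) at_top"
    proof (cases "s0 p = 1")
      case True
      then show ?thesis using R_eq_1[OF mean True] x c by (intro critical_upper) auto
    next
      case False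
      then have s0: "1 < s0 p" using s0_ge_1[OF mean] by simp
      \<comment> \<open>A growth rate above 1 / R whose exponent - 1 / y is still below x; for x
        \<ge> 0 every y > 1 / R qualifies.\<close>
      have "\<exists>y. 1 / R_const p < y \<and> (0 < - x \<longrightarrow> y < 1 / (- x))"
      proof (cases "0 < - x")
        case True
        then have "1 / R_const p < 1 / (- x)"
          using x mult_pos_neg[OF R_pos, of x] by (intro divide_strict_left_mono) auto
        then show ?thesis using dense by blast
      qed (auto intro: gt_ex)
      then obtain y where y: "1 / R_const p < y" "0 < - x \<Longrightarrow> y < 1 / (- x)" by blast
      \<comment> \<open>Since c \<le> 1 / s_0, every s in (1, s_0) satisfies c < 1 / s, so s may
        approach s_0 until the rate f s / s falls below y.\<close>
      obtain s where s: "1 < s" "0 < s" "s < s0 p" "f s / s < y"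
        using ratio_near_R[OF y(1) s0] .
      have f: "0 < f s" using s below_s0[of s] by (intro pgf_pos) auto
      have lt: "f s / s < 1" by (rule subcritical_ratio[OF mean s(1,3)])
      have "- (s / f s) < x"
      proof (cases "0 < - x")
        case True
        with y(2) s have "f s / s < 1 / (- x)" by simp
        then show ?thesis using True f s by (simp add: field_simps)
      next
        case False
        moreover have "0 < s / f s" using f s by simp
        ultimately show ?thesis by linarith
      qed
      moreover have "c \<le> 1 / s"
      proof -
        have "inverse (s0 p) \<le> inverse s" using s by (intro le_imp_inverse_le) auto
        with c show ?thesis by (simp add: inverse_eq_divide)
      qed
      ultimately show ?thesis
        using c s lt f by (intro subcritical_upper[of c s]) (auto simp: field_simps)
    qed
  qed (use c in \<open>auto intro: eventually_tail_exponent_ge_R\<close>)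
  have b2: "((\<lambda>r. ln (pagerank_tail p c r) / ln r) \<longlongrightarrow> - 1 / (c * pgf p (1 / c))) at_top"
    if mean: "measure_pmf.expectation p real \<le> 1" and c: "1 < s0 p" "inverse (s0 p) < c" "c < 1" for c
  proof -
    \<comment> \<open>For c > 1 / s_0 the condition c \<le> 1 / s stops s at 1 / c, before s_0 is
      reached; both bounds are taken at this point.\<close>
    define s where "s = 1 / c"
    have "0 < inverse (s0 p)" using s0_pos by simp
    then have c0: "0 < c" using c(2) by (rule less_trans)
    have s: "1 < s" "s < s0 p" using c c0 by (auto simp: s_def field_simps)
    have f: "0 < f s" using s below_s0[of s] by (intro pgf_pos) auto
    have lt: "f s / s < 1" by (rule subcritical_ratio[OF mean s])
    have eq: "- 1 / (c * f (1 / c)) = - (s / f s)" using c0 by (simp add: s_def)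
    show ?thesis
      unfolding eq
    proof (rule order_tendstoI)
      fix x assume "x < - (s / f s)"
      moreover have "0 < s / f s" using f s by simp
      ultimately obtain \<mu> where \<mu>: "0 < \<mu>" "\<mu> < 1 / (s / f s)" "x < - (1 / \<mu>)"
        using exponent_below by blast
      have "\<mu> < c * f (1 / c)" using \<mu>(2) by (simp add: s_def mult.commute)
      then obtain K where "0 < K" "eventually (\<lambda>r. K * r powr (- (1 / \<mu>)) \<le> pagerank_tail p c r) at_top"
        using tail_lower_interior[OF c0 c(3) _ \<mu>(1)] s by (auto simp: s_def)
      then show "eventually (\<lambda>r. x < ln (pagerank_tail p c r) / ln r) at_top"
        using \<mu>(3) by (intro eventually_ln_ratio_ge)
    next
      fix x assume "- (s / f s) < x"
      then show "eventually (\<lambda>r. ln (pagerank_tail p c r) / ln r < x) at_top"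
        using c c0 s lt f by (intro subcritical_upper[of c s]) (auto simp: s_def field_simps)
    qed
  qed
  show ?thesis using a b1 b2 by blast
qed

end
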